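(* Let $\omega$ be a weight function with constants $K,b$, let $E\subset\mathbb{R}^{2N}$ be a Lebesgue measurable set, $1\le p\le\infty$, $\tau\in(0,1)$ and $\varepsilon\in(0,1)$. Suppose that one of the following conditions holds. (a) There exist $f\in\mathcal{S}_\omega(\mathbb{R}^N)$, $f\ne0$, and $\lambda\ge0$ such that $$\int_E e^{\lambda\omega(x,\xi)}|\mathrm{Wig}_\tau(f)(x,\xi)|\,dx\,d\xi\ge(1-\varepsilon)\sqrt{D_\lambda^{(3)}}\,\|e^{4K^2\lambda\omega}Rf\|_p^{1/2}\,\|e^{4K^2\lambda\omega}Rf\|_{p'}^{1/2},$$ where $D_\lambda^{(3)}=\dfrac{e^{K(1+2K)\lambda}}{(2\pi)^N(\tau-\tau^2)^N}$. (b) There exist $f\in\mathcal{S}_\omega(\mathbb{R}^N)$, $f\ne0$, $\lambda\ge0$ and $\mu>\frac{2N}{b(2p)'}$ such that $$\int_E e^{\lambda\omega(x,\xi)}|Rf(x,\xi)|\,dx\,d\xi\ge(1-\varepsilon)D_{\lambda,\mu}^{(4)}\,\|e^{2K(K^2\lambda+\mu)\omega}\mathrm{Wig}_\tau(f)\|_p,$$ where $$D_{\lambda,\mu}^{(4)}=\inf_{g\in\mathcal{S}_\omega(\mathbb{R}^N),\,g\ne0}\Big[D_{\lambda,\mu}^{(2)}(g)\,e^{2K(K^2\lambda+\mu)}\,\|e^{2K(K^2\lambda+\mu)\omega}\mathrm{Wig}_{1-\tau}(\tilde g)\|_1\Big],\quad \tilde g(t):=g(-t),$$ $$D_{\lambda,\mu}^{(2)}(g)=\frac{e^{K(1+2K)\lambda}\,\|e^{K^2\lambda\omega}g\|_\infty\,\|e^{K^2\lambda\omega}\hat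 g\|_\infty\,\|e^{-\mu\omega}\|^2_{L^{(2p)'}(\mathbb{R}^{2N})}}{(2\pi)^{2N}\|g\|_2^4}.$$ Then $m(E)\ge1-\varepsilon$, where $m(E)$ is the Lebesgue measure of $E$.
   Context: A weight function is a continuous increasing (i.e. nondecreasing) function $\omega:[0,\infty)\to[0,\infty)$ such that: ($\alpha$) there is $K\ge1$ with $\omega(2t)\le K(1+\omega(t))$ for all $t\ge0$; ($\beta$) $\omega(t)=o(t)$ as $t\to\infty$; ($\gamma$) there are $a\in\mathbb{R}$, $b>0$ with $\omega(t)\ge a+b\log(1+t)$ for all $t\ge0$; ($\delta$) $t\mapsto\omega(e^t)$ is convex. $K$ and $b$ always denote the constants in ($\alpha$) and ($\gamma$). One extends $\omega$ to $\mathbb{R}^M$ by $\omega(z)=\omega(|z|)$; in particular $\omega(x,\xi)=\omega(|(x,\xi)|)$ on $\mathbb{R}^{2N}$. Fourier transform: $\hat f(\xi)=\int_{\mathbb{R}^N}e^{-ix\xi}f(x)\,dx$. $\mathcal{S}_\omega(\mathbb{R}^N)$ is the set of all $f\in L^1(\mathbb{R}^N)$ with $f,\hat f\in C^\infty(\mathbb{R}^N)$ and $\|e^{\lambda\omega}\partial^\alpha f\|_\infty<\infty$, $\|e^{\lambda\omega}\partial^\alpha\hat f\|_\infty<\infty$ for all $\lambda>0$, $\alpha\in\mathbb{N}_0^N$. $\tau$-Wigner transform, $\tau\in[0,1]$: $\mathrm{Wig}_\tau(f)(x,\xi)=\int_{\mathbb{R}^N}e^{-it\xi}f(x+\tau t)\overline{f(x-(1-\tau)t)}\,dt$.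 Rihaczek form: $Rf(x,\xi)=e^{-ix\xi}f(x)\overline{\hat f(\xi)}$, $(x,\xi)\in\mathbb{R}^{2N}$. $p'$ is the conjugate exponent of $p\in[1,\infty]$; $(2p)'$ is defined by $\frac1{2p}+\frac1{(2p)'}=1$, with $(2p)'=1$ for $p=\infty$. Norms of functions on $\mathbb{R}^N$ are in $L^q(\mathbb{R}^N)$, norms of functions on $\mathbb{R}^{2N}$ are in $L^q(\mathbb{R}^{2N})$. *)

theory Defs
  imports
    "HOL-Analysis.Analysis"
    "HOL-Library.Landau_Symbols"
    "HOL-Probability.Essential_Supremum"
begin

section \<open>Exponents and Lebesgue norms\<close>

text \<open>Only used for exponents \<open>r > 0\<close>.\<close>

definition ennreal_powr :: "ennreal \<Rightarrow> real \<Rightarrow> ennreal" where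
  "ennreal_powr x r = (if x = \<infinity> then \<infinity> else ennreal (enn2real x powr r))"

lemma ennreal_powr_simps:
  "ennreal_powr \<infinity> r = \<infinity>"
  "0 \<le> x \<Longrightarrow> ennreal_powr (ennreal x) r = ennreal (x powr r)"
  by (simp_all add: ennreal_powr_def)

text \<open>The exponents \<open>1\<close> and \<open>\<infinity>\<close> need no special treatment, since
  \<open>inverse 0 = \<infinity>\<close> and \<open>inverse \<infinity> = 0\<close> in \<^typ>\<open>ennreal\<close>.\<close>

definition conj_exp :: "ennreal \<Rightarrow> ennreal" where
  "conj_exp p = inverse (1 - inverse p)"

lemma inverse_inverse_ennreal: "inverse (inverse (x::ennreal)) = x"
proof (cases x)
  case (real r)
  then show ?thesis
    by (cases "r = 0") (auto simp: inverse_ennreal)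
qed simp

lemma conj_exp_iff:
  assumes "1 \<le> p"
  shows "q = conj_exp p \<longleftrightarrow> inverse p + inverse q = 1"
proof -
  have "inverse p \<le> 1"
    using assms by (cases p) (auto simp: inverse_ennreal field_simps)
  then have *: "inverse p + (1 - inverse p) = 1"
    by auto
  show ?thesis
  proof
    assume "q = conj_exp p"
    then show "inverse p + inverse q = 1"
      using * by (simp add: conj_exp_def inverse_inverse_ennreal)
  next
    assume "inverse p + inverse q = 1"
    then have "inverse q = 1 - inverse p"
      by (metis ennreal_add_diff_cancel_left ennreal_add_eq_top ennreal_top_neq_one)
    then show "q = conj_exp p"
      by (metis conj_exp_def inverse_inverse_ennreal)
  qed
qed

text \<open>The value \<open>\<infinity>\<close> stands for a function that is not in \<open>L\<^sup>p\<close>.\<close>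

definition Lp_norm :: "ennreal \<Rightarrow> ('a::euclidean_space \<Rightarrow> 'b::real_normed_vector) \<Rightarrow> ennreal" where
  "Lp_norm p f =
     (if p = \<infinity> then esssup lebesgue (\<lambda>x. ennreal (norm (f x)))
      else ennreal_powr (\<integral>\<^sup>+ x. ennreal (norm (f x) powr enn2real p) \<partial>lebesgue) (1 / enn2real p))"

section \<open>Weight functions\<close>

text \<open>The real function \<open>\<omega>\<close> represents a function on \<open>[0, \<infinity>)\<close>; its values at negative
  arguments are irrelevant.\<close>

definition weight_function :: "(real \<Rightarrow> real) \<Rightarrow> real \<Rightarrow> real \<Rightarrow> bool" where
  "weight_function \<omega> K b \<longleftrightarrow>
     continuous_on {0..} \<omega> \<and> mono_on {0..} \<omega> \<and> (\<forall>t\<ge>0. 0 \<le> \<omega> t) \<and>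
     1 \<le> K \<and> (\<forall>t\<ge>0. \<omega> (2 * t) \<le> K * (1 + \<omega> t)) \<and>
     \<omega> \<in> o[at_top](\<lambda>t. t) \<and>
     0 < b \<and> (\<exists>a. \<forall>t\<ge>0. \<omega> t \<ge> a + b * ln (1 + t)) \<and>
     convex_on UNIV (\<lambda>t. \<omega> (exp t))"

definition weighted ::
    "(real \<Rightarrow> real) \<Rightarrow> real \<Rightarrow> ('a::euclidean_space \<Rightarrow> complex) \<Rightarrow> 'a \<Rightarrow> complex" where
  "weighted \<omega> c F z = of_real (exp (c * \<omega> (norm z))) * F z"

section \<open>Smooth functions and the space \<open>S\<^sub>\<omega>\<close>\<close>

definition partial_deriv :: "'n::finite \<Rightarrow> (real^'n \<Rightarrow> complex) \<Rightarrow> real^'n \<Rightarrow> complex" where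
  "partial_deriv i f x = vector_derivative (\<lambda>t. f (x + t *\<^sub>R axis i 1)) (at 0)"

text \<open>A list of directions plays the role of a multi-index: \<open>iter_partial is f\<close> is
  \<open>\<partial>\<^sup>\<alpha> f\<close> with \<open>\<alpha> i\<close> the number of occurrences of \<open>i\<close> in \<open>is\<close>. For smooth \<open>f\<close> the order
  of the directions does not matter, so the lists give exactly the derivatives \<open>\<partial>\<^sup>\<alpha> f\<close>.\<close>

fun iter_partial :: "'n::finite list \<Rightarrow> (real^'n \<Rightarrow> complex) \<Rightarrow> real^'n \<Rightarrow> complex" where
  "iter_partial [] f = f"
| "iter_partial (i # is) f = partial_deriv i (iter_partial is f)"

definition smooth :: "(real^'n::finite \<Rightarrow> complex) \<Rightarrow> bool" where
  "smooth f \<longleftrightarrow>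
     (\<forall>is. continuous_on UNIV (iter_partial is f) \<and>
           (\<forall>i x. (\<lambda>t. iter_partial is f (x + t *\<^sub>R axis i 1)) differentiable (at (0::real))))"

definition fourier :: "(real^'n::finite \<Rightarrow> complex) \<Rightarrow> real^'n \<Rightarrow> complex" where
  "fourier f \<xi> = (LINT x|lebesgue. exp (- \<i> * of_real (x \<bullet> \<xi>)) * f x)"

definition S_space :: "(real \<Rightarrow> real) \<Rightarrow> (real^'n::finite \<Rightarrow> complex) set" where
  "S_space \<omega> =
     {f. integrable lebesgue f \<and> smooth f \<and> smooth (fourier f) \<and>
         (\<forall>lam>0. \<forall>is. Lp_norm \<infinity> (weighted \<omega> lam (iter_partial is f)) < \<infinity> \<and>
                     Lp_norm \<infinity> (weighted \<omega> lam (iter_partial is (fourier f))) < \<infinity>)}"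

section \<open>Time-frequency representations\<close>

text \<open>\<open>\<real>\<^sup>2\<^sup>N\<close> is \<open>\<real>\<^sup>N \<times> \<real>\<^sup>N\<close>; the norm of a pair is the Euclidean one.\<close>

definition Wig :: "real \<Rightarrow> (real^'n::finite \<Rightarrow> complex) \<Rightarrow> (real^'n) \<times> (real^'n) \<Rightarrow> complex" where
  "Wig \<tau> f = (\<lambda>(x, \<xi>). LINT t|lebesgue.
     exp (- \<i> * of_real (t \<bullet> \<xi>)) * f (x + \<tau> *\<^sub>R t) * cnj (f (x - (1 - \<tau>) *\<^sub>R t)))"

definition Rihaczek :: "(real^'n::finite \<Rightarrow> complex) \<Rightarrow> (real^'n) \<times> (real^'n) \<Rightarrow> complex" where
  "Rihaczek f = (\<lambda>(x, \<xi>). exp (- \<i> * of_real (x \<bullet> \<xi>)) * f x * cnj (fourier f \<xi>))"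

section \<open>The constants\<close>

definition D3 :: "nat \<Rightarrow> real \<Rightarrow> real \<Rightarrow> real \<Rightarrow> real" where
  "D3 N K \<tau> lam = exp (K * (1 + 2 * K) * lam) / ((2 * pi) ^ N * (\<tau> - \<tau>\<^sup>2) ^ N)"

definition D2 :: "(real \<Rightarrow> real) \<Rightarrow> real \<Rightarrow> ennreal \<Rightarrow> real \<Rightarrow> real \<Rightarrow> (real^'n::finite \<Rightarrow> complex) \<Rightarrow> ennreal" where
  "D2 \<omega> K p lam \<mu> g =
     ennreal (exp (K * (1 + 2 * K) * lam)) *
     Lp_norm \<infinity> (weighted \<omega> (K\<^sup>2 * lam) g) *
     Lp_norm \<infinity> (weighted \<omega> (K\<^sup>2 * lam) (fourier g)) *
     (Lp_norm (conj_exp (2 * p)) (\<lambda>z::(real^'n) \<times> (real^'n). exp (- \<mu> * \<omega> (norm z))))\<^sup>2 /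
     (ennreal ((2 * pi) ^ (2 * CARD('n))) * (Lp_norm 2 g) ^ 4)"

text \<open>The type argument only fixes the dimension \<open>N = CARD('n)\<close>.\<close>

definition D4 :: "'n::finite itself \<Rightarrow> (real \<Rightarrow> real) \<Rightarrow> real \<Rightarrow> real \<Rightarrow> ennreal \<Rightarrow> real \<Rightarrow> real \<Rightarrow> ennreal" where
  "D4 _ \<omega> K \<tau> p lam \<mu> =
     (INF g \<in> {g \<in> (S_space \<omega> :: (real^'n \<Rightarrow> complex) set). g \<noteq> (\<lambda>_. 0)}.
        D2 \<omega> K p lam \<mu> g *
        ennreal (exp (2 * K * (K\<^sup>2 * lam + \<mu>))) *
        Lp_norm 1 (weighted \<omega> (2 * K * (K\<^sup>2 * lam + \<mu>)) (Wig (1 - \<tau>) (\<lambda>t. g (- t)))))"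

end

theory Submission
  imports Defs "HOL-Probability.Characteristic_Functions"
begin

text \<open>Both conditions bound an integral over \<open>E\<close> from below by \<open>1 - \<epsilon>\<close> times an upper bound for
  the integrand, so everything rests on pointwise estimates.

  For (a), bound \<open>Wig\<^sub>\<tau> f (x, \<xi>)\<close> once by an integral of \<open>\<bar>f(u)\<bar>\<bar>f(v)\<bar>\<close>, where \<open>x\<close> is a convex
  combination of \<open>u\<close> and \<open>v\<close>, and once by an integral of \<open>\<bar>f^(\<eta>)\<bar>\<bar>f^(\<zeta>)\<bar>\<close>, where \<open>\<xi>\<close> is a convex
  combination of \<open>\<eta>\<close> and \<open>\<zeta>\<close>. The product of the two integrals is \<open>\<integral> \<bar>Rf\<bar> \<bar>Rf \<circ> S\<bar>\<close> over phase
  space, with \<open>S\<close> affine and volume preserving, and a single application of Hoelder's inequality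
  finishes the estimate.

  For (b), \<open>f\<close> and \<open>f^\<close> are recovered from the short-time Fourier transform \<open>V\<^sub>g f\<close>, which bounds
  \<open>\<bar>Rf\<bar>\<close> by the square of a weighted \<open>L\<^sup>1\<close> norm of \<open>V\<^sub>g f\<close>. Since \<open>\<bar>V\<^sub>g f\<bar>\<^sup>2\<close> is dominated by the
  convolution of \<open>\<bar>Wig\<^sub>\<tau> f\<bar>\<close> with the modulus of the \<open>(1 - \<tau>)\<close>-Wigner transform of the reflected
  window, the inequalities of Hoelder and Young apply.\<close>

text \<open>In (a) a bound in time sees only \<open>f\<close> and a bound in frequency only its
  Fourier transform; \<open>Rihaczek f\<close> appears only in their product, hence the square roots
  of the constant and of the two norms. The dilations in \<open>S\<close> have the factors
  \<open>(1 - \<tau>) / \<tau>\<close> and its reciprocal, so their Jacobians cancel. Since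
  \<open>x\<close> and \<open>\<xi>\<close> are convex combinations, the weight at
  \<open>(x, \<xi>)\<close> is controlled by one doubling, with a constant independent of
  \<open>\<tau>\<close>. In (b) the square of \<open>V_g f\<close> is a marginal of the Wigner
  transform of \<open>f\<close> times the shifted conjugate window. A bound of the square in
  \<open>L^p\<close> is a bound of \<open>V_g f\<close> in \<open>L^(2p)\<close>, whose dual
  exponent \<open>(2p)'\<close> falls on \<open>e^(-\<mu>\<omega>)\<close>. Each passage of the
  weight through a sum costs one factor \<open>K\<close>: splitting \<open>(x, \<xi>)\<close>
  contributes \<open>K\<lambda>\<close>, the two recoveries \<open>K^2\<lambda>\<close> each,
  together \<open>K(1 + 2K)\<lambda>\<close>. The window is arbitrary, so the infimum over
  \<open>g\<close> may be taken at the end. All estimates are made in \<open>ennreal\<close>, where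
  a divergent integral makes an upper bound trivial.\<close>

lemma nn_integral_lborel_affine:
  fixes f :: "'a::euclidean_space \<Rightarrow> ennreal" and c :: real
  assumes [measurable]: "f \<in> borel_measurable borel" and c: "c \<noteq> 0"
  shows "(\<integral>\<^sup>+x. f x \<partial>lborel) = ennreal (\<bar>c\<bar> ^ DIM('a)) * (\<integral>\<^sup>+x. f (t + c *\<^sub>R x) \<partial>lborel)"
  by (subst lborel_affine[OF c, of t])
     (simp add: nn_integral_density nn_integral_distr nn_integral_cmult)

lemma integrable_lborel_affine:
  fixes f :: "'a::euclidean_space \<Rightarrow> 'b :: {banach, second_countable_topology}"
  assumes f: "integrable lborel f" and c: "c \<noteq> 0"
  shows "integrable lborel (\<lambda>x. f (t + c *\<^sub>R x))"
  using f f[THEN borel_measurable_integrable] c unfolding integrable_iff_bounded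
  by (subst (asm) nn_integral_lborel_affine[where c=c and t=t]) (auto simp: ennreal_mult_less_top)

lemma integral_lborel_affine:
  fixes f :: "'a::euclidean_space \<Rightarrow> 'b :: {banach, second_countable_topology}"
  assumes f[measurable]: "integrable lborel f" and c: "c \<noteq> 0"
  shows "(\<integral>x. f x \<partial>lborel) = \<bar>c\<bar> ^ DIM('a) *\<^sub>R (\<integral>x. f (t + c *\<^sub>R x) \<partial>lborel)"
  using c f[THEN borel_measurable_integrable] integrable_lborel_affine[OF f c, of t]
  by (subst lborel_affine[OF c, of t]) (simp add: integral_density integral_distr)

lemma nn_integral_lborel_reflect:
  fixes f :: "'a::euclidean_space \<Rightarrow> ennreal"
  assumes "f \<in> borel_measurable borel"
  shows "(\<integral>\<^sup>+x. f (t - x) \<partial>lborel) = (\<integral>\<^sup>+x. f x \<partial>lborel)"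
  using nn_integral_lborel_affine[OF assms, of "-1" t] by simp

lemma nn_integral_lborel_translate:
  fixes f :: "'a::euclidean_space \<Rightarrow> ennreal"
  assumes "f \<in> borel_measurable borel"
  shows "(\<integral>\<^sup>+x. f (t + x) \<partial>lborel) = (\<integral>\<^sup>+x. f x \<partial>lborel)"
  using nn_integral_lborel_affine[OF assms, of "1" t] by simp

text \<open>Provides the hypothesis of Fubini's theorem for a tensor product against a kernel
  \<open>k\<close> of modulus at most 1, which in the applications is a phase.\<close>

lemma integrable_pair_mult_bounded:
  fixes f :: "'a::euclidean_space \<Rightarrow> complex" and g :: "'b::euclidean_space \<Rightarrow> complex"
  assumes f: "integrable lborel f" and g: "integrable lborel g"
    and k[measurable]: "case_prod k \<in> borel_measurable (lborel \<Otimes>\<^sub>M lborel)"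
    and bound: "\<And>x y. norm (k x y) \<le> 1"
  shows "integrable (lborel \<Otimes>\<^sub>M lborel) (\<lambda>(x,y). k x y * (f x * g y))"
proof -
  note [measurable] = borel_measurable_integrable[OF f] borel_measurable_integrable[OF g]
  have "integrable (lborel \<Otimes>\<^sub>M lborel) (\<lambda>(x,y). f x * g y)"
  proof (subst integrable_iff_bounded, intro conjI)
    have "(\<integral>\<^sup>+ z. ennreal (norm (case z of (x, y) \<Rightarrow> f x * g y)) \<partial>(lborel \<Otimes>\<^sub>M lborel)) =
          (\<integral>\<^sup>+ x. \<integral>\<^sup>+ y. ennreal (norm (f x)) * ennreal (norm (g y)) \<partial>lborel \<partial>lborel)"
      by (subst lborel.nn_integral_fst[symmetric]) (auto simp: norm_mult ennreal_mult' split_beta')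
    also have "\<dots> = (\<integral>\<^sup>+ x. ennreal (norm (f x)) \<partial>lborel) * (\<integral>\<^sup>+ y. ennreal (norm (g y)) \<partial>lborel)"
      by (simp add: nn_integral_cmult nn_integral_multc)
    also have "\<dots> < \<infinity>"
      using f g by (auto simp: integrable_iff_bounded ennreal_mult_less_top)
    finally show "(\<integral>\<^sup>+ z. ennreal (norm (case z of (x, y) \<Rightarrow> f x * g y)) \<partial>(lborel \<Otimes>\<^sub>M lborel)) < \<infinity>" .
  qed measurable
  then show ?thesis
    by (rule Bochner_Integration.integrable_bound)
       (auto simp: norm_mult intro!: AE_I2 mult_left_le_one_le bound)
qed

section \<open>Fourier inversion\<close>

text \<open>\<open>std_normal_density\<close> is this Gaussian divided by
  \<open>sqrt (2 * pi)\<close>, so its integrability and the characteristic function of the standard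
  normal distribution give both claims.\<close>

lemma gaussian_1d:
  "integrable lborel (\<lambda>x::real. complex_of_real (exp (- x\<^sup>2 / 2)))"
  "(LINT x|lborel. iexp (s * x) * complex_of_real (exp (- x\<^sup>2 / 2))) = sqrt (2 * pi) * exp (- s\<^sup>2 / 2)"
proof -
  have "integrable lborel std_normal_density"
    by simp
  then have "integrable lborel (\<lambda>x::real. sqrt (2 * pi) * std_normal_density x)"
    by simp
  then have "integrable lborel (\<lambda>x::real. exp (- x\<^sup>2 / 2))"
    by (simp add: std_normal_density_def)
  then show "integrable lborel (\<lambda>x::real. complex_of_real (exp (- x\<^sup>2 / 2)))"
    by (rule integrable_of_real)
  have "char std_normal_distribution s = (LINT x|lborel. std_normal_density x *\<^sub>R iexp (s * x))"
    unfolding char_def by (subst integral_density) (auto simp: normal_density_nonneg)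
  also have "\<dots> = (LINT x|lborel. (1 / sqrt (2 * pi)) *\<^sub>R (iexp (s * x) * complex_of_real (exp (- x\<^sup>2 / 2))))"
    by (intro Bochner_Integration.integral_cong) (auto simp: std_normal_density_def scaleR_conv_of_real)
  also have "\<dots> = (1 / sqrt (2 * pi)) *\<^sub>R (LINT x|lborel. (iexp (s * x) * complex_of_real (exp (- x\<^sup>2 / 2))))"
    by (rule integral_scaleR_right)
  finally show "(LINT x|lborel. iexp (s * x) * complex_of_real (exp (- x\<^sup>2 / 2))) = sqrt (2 * pi) * exp (- s\<^sup>2 / 2)"
    by (simp add: char_std_normal_distribution scaleR_conv_of_real field_simps)
qed

text \<open>\<open>lborel\<close> on a Euclidean space is the image of the product of
  one-dimensional Lebesgue measures over \<open>Basis\<close>; this reduces Gaussian integrals to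
  dimension one.\<close>

lemma integral_lborel_prod:
  fixes f :: "'a::euclidean_space \<Rightarrow> real \<Rightarrow> complex"
  assumes f: "\<And>b. b \<in> Basis \<Longrightarrow> integrable lborel (f b)"
  shows "integrable lborel (\<lambda>x::'a. \<Prod>b\<in>Basis. f b (x \<bullet> b))"
    and "(LINT x|lborel. (\<Prod>b\<in>(Basis::'a set). f b (x \<bullet> b))) = (\<Prod>b\<in>Basis. LINT x|lborel. f b x)"
proof -
  interpret product_sigma_finite "\<lambda>_. lborel :: real measure" ..
  have [measurable]: "\<And>b. b \<in> Basis \<Longrightarrow> f b \<in> borel_measurable borel"
    using f by (simp add: integrable_iff_bounded)
  have *: "(\<Prod>b\<in>Basis. f b ((\<Sum>b\<in>Basis. g b *\<^sub>R b) \<bullet> b)) = (\<Prod>b\<in>(Basis::'a set). f b (g b))" for g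
    by (intro prod.cong) auto
  show "integrable lborel (\<lambda>x::'a. \<Prod>b\<in>Basis. f b (x \<bullet> b))"
    using product_integrable_prod[of "Basis::'a set" f, OF _ f]
    by (subst lborel_eq) (simp add: integrable_distr_eq *)
  show "(LINT x|lborel. (\<Prod>b\<in>(Basis::'a set). f b (x \<bullet> b))) = (\<Prod>b\<in>Basis. LINT x|lborel. f b x)"
    using product_integral_prod[of "Basis::'a set" f, OF _ f]
    by (subst lborel_eq) (simp add: integral_distr *)
qed

definition gaussian :: "'a::euclidean_space \<Rightarrow> complex" where
  "gaussian x = of_real (exp (- (norm x)\<^sup>2 / 2))"

lemma gaussian_prod: "gaussian x = (\<Prod>b\<in>Basis. of_real (exp (- (x \<bullet> b)\<^sup>2 / 2)))"
proof -
  have "exp (- (norm x)\<^sup>2 / 2) = (\<Prod>b\<in>Basis. exp (- (x \<bullet> b)\<^sup>2 / 2))"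
    by (simp add: norm_eq_sqrt_inner euclidean_inner[of x x] power2_eq_square sum_nonneg
                  exp_sum[symmetric] sum_negf sum_divide_distrib)
  then show ?thesis
    unfolding gaussian_def by (metis of_real_prod)
qed

lemma gaussian_measurable [measurable]: "gaussian \<in> borel_measurable borel"
  unfolding gaussian_def by measurable

lemma integrable_gaussian: "integrable lborel (gaussian :: 'a::euclidean_space \<Rightarrow> complex)"
  unfolding gaussian_prod[abs_def] by (intro integral_lborel_prod gaussian_1d)

text \<open>Phase and Gaussian both factor over \<open>Basis\<close>, where
  \<open>gaussian_1d\<close> applies. Up to the constant the Gaussian is its own Fourier
  transform.\<close>

lemma integral_gaussian_phase:
  fixes s :: "'a::euclidean_space"
  shows "(LINT x|lborel. exp (\<i> * of_real (s \<bullet> x)) * gaussian x) = sqrt (2 * pi) ^ DIM('a) * gaussian s"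
proof -
  have "(LINT x|lborel. exp (\<i> * of_real (s \<bullet> x)) * gaussian x) =
        (LINT x|lborel. (\<Prod>b\<in>(Basis::'a set). iexp (s \<bullet> b * (x \<bullet> b)) * of_real (exp (- (x \<bullet> b)\<^sup>2 / 2))))"
  proof (intro Bochner_Integration.integral_cong refl)
    fix x :: 'a
    have "\<i> * complex_of_real (s \<bullet> x) = (\<Sum>b\<in>Basis. \<i> * complex_of_real (s \<bullet> b * (x \<bullet> b)))"
      by (subst euclidean_inner) (simp add: sum_distrib_left)
    then show "exp (\<i> * of_real (s \<bullet> x)) * gaussian x =
        (\<Prod>b\<in>(Basis::'a set). iexp (s \<bullet> b * (x \<bullet> b)) * of_real (exp (- (x \<bullet> b)\<^sup>2 / 2)))"
      by (simp only: gaussian_prod prod.distrib exp_sum[OF finite_Basis])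
  qed
  also have "\<dots> = (\<Prod>b\<in>(Basis::'a set). LINT x|lborel. iexp (s \<bullet> b * x) * of_real (exp (- x\<^sup>2 / 2)))"
  proof (rule integral_lborel_prod)
    fix b
    show "integrable lborel (\<lambda>x. iexp (s \<bullet> b * x) * complex_of_real (exp (- x\<^sup>2 / 2)))"
      by (rule Bochner_Integration.integrable_bound[OF gaussian_1d(1)]) (auto simp: norm_mult)
  qed
  also have "\<dots> = sqrt (2 * pi) ^ DIM('a) * gaussian s"
    unfolding gaussian_1d(2) gaussian_prod by (simp add: prod.distrib)
  finally show ?thesis .
qed

abbreviation phase :: "'a::euclidean_space \<Rightarrow> 'a \<Rightarrow> complex" where
  "phase x y \<equiv> exp (\<i> * of_real (x \<bullet> y))"

lemma norm_phase [simp]: "norm (phase x y) = 1" "norm (exp (- (\<i> * of_real (x \<bullet> y)))) = 1"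
  by (simp_all)

lemma fourier_lborel:
  assumes "f \<in> borel_measurable borel"
  shows "fourier f \<xi> = (LINT x|lborel. exp (- \<i> * of_real (x \<bullet> \<xi>)) * f x)"
  unfolding fourier_def using assms by (intro integral_completion) simp

lemma fourier_measurable [measurable]:
  assumes [measurable]: "f \<in> borel_measurable borel"
  shows "fourier f \<in> borel_measurable borel"
proof -
  have "(\<lambda>\<xi>. LINT x|lborel. exp (- \<i> * of_real (x \<bullet> \<xi>)) * f x) \<in> borel_measurable lborel"
    by measurable
  then show ?thesis
    by (subst fourier_lborel[OF assms, abs_def]) simp
qed

lemma integrable_phase_mult:
  fixes f :: "'a::euclidean_space \<Rightarrow> complex"
  assumes "integrable lborel f" "c \<in> borel_measurable borel" "\<And>x. norm (c x) \<le> 1"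
  shows "integrable lborel (\<lambda>x. c x * f x)"
  using borel_measurable_integrable[OF assms(1)] assms(2)
  by (intro Bochner_Integration.integrable_bound[OF assms(1)])
     (auto simp: norm_mult intro!: AE_I2 mult_left_le_one_le assms(3))

text \<open>The Gaussian factor makes the inversion integral absolutely convergent jointly in
  \<open>t\<close> and \<open>\<xi>\<close>, so Fubini applies even when \<open>fourier h\<close> is
  not integrable. The outcome is an average of \<open>h\<close> near \<open>x\<close> at scale
  \<open>d\<close>.\<close>

lemma gaussian_regularised_inversion:
  fixes h :: "real^'n::finite \<Rightarrow> complex"
  assumes h: "integrable lborel h" and d: "0 < d"
  shows "(LINT \<xi>|lborel. fourier h \<xi> * phase x \<xi> * gaussian (d *\<^sub>R \<xi>)) =
         sqrt (2 * pi) ^ CARD('n) * (LINT u|lborel. h (x + d *\<^sub>R u) * gaussian u)"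
proof -
  note [measurable] = borel_measurable_integrable[OF h, simplified]
  have g: "integrable lborel (\<lambda>\<xi>::real^'n. gaussian (d *\<^sub>R \<xi>))"
    using integrable_lborel_affine[OF integrable_gaussian, of d 0] d by simp
  let ?k = "\<lambda>t \<xi>. phase (x - t) \<xi>"
  have "integrable (lborel \<Otimes>\<^sub>M lborel) (\<lambda>(t,\<xi>). ?k t \<xi> * (h t * gaussian (d *\<^sub>R \<xi>)))"
    by (rule integrable_pair_mult_bounded[OF h g]) auto
  then have "(LINT \<xi>|lborel. LINT t|lborel. ?k t \<xi> * (h t * gaussian (d *\<^sub>R \<xi>))) =
             (LINT t|lborel. LINT \<xi>|lborel. ?k t \<xi> * (h t * gaussian (d *\<^sub>R \<xi>)))"
    by (rule lborel_pair.Fubini_integral)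
  also have "(LINT \<xi>|lborel. LINT t|lborel. ?k t \<xi> * (h t * gaussian (d *\<^sub>R \<xi>))) =
             (LINT \<xi>|lborel. fourier h \<xi> * phase x \<xi> * gaussian (d *\<^sub>R \<xi>))"
  proof (intro Bochner_Integration.integral_cong refl)
    fix \<xi>
    have "(LINT t|lborel. ?k t \<xi> * (h t * gaussian (d *\<^sub>R \<xi>))) =
          (LINT t|lborel. (exp (- \<i> * of_real (t \<bullet> \<xi>)) * h t) * (phase x \<xi> * gaussian (d *\<^sub>R \<xi>)))"
      by (intro Bochner_Integration.integral_cong refl)
         (simp add: inner_diff_left right_diff_distrib exp_diff exp_minus field_simps)
    then show "(LINT t|lborel. ?k t \<xi> * (h t * gaussian (d *\<^sub>R \<xi>))) =
        fourier h \<xi> * phase x \<xi> * gaussian (d *\<^sub>R \<xi>)"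
      by (simp add: fourier_lborel)
  qed
  also have "(LINT t|lborel. LINT \<xi>|lborel. ?k t \<xi> * (h t * gaussian (d *\<^sub>R \<xi>))) =
        (LINT t|lborel. h t * (sqrt (2 * pi) ^ CARD('n) * gaussian ((1 / d) *\<^sub>R (x - t)) / d ^ CARD('n)))"
  proof (intro Bochner_Integration.integral_cong refl)
    fix t :: "real^'n"
    have i: "integrable lborel (\<lambda>\<xi>. phase ((1 / d) *\<^sub>R (x - t)) \<xi> * gaussian \<xi>)"
      by (rule integrable_phase_mult[OF integrable_gaussian]) auto
    have "sqrt (2 * pi) ^ CARD('n) * gaussian ((1 / d) *\<^sub>R (x - t)) =
          (LINT \<xi>|lborel. phase ((1 / d) *\<^sub>R (x - t)) \<xi> * gaussian \<xi>)"
      by (subst integral_gaussian_phase) simp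
    also have "\<dots> = d ^ CARD('n) * (LINT \<xi>|lborel. ?k t \<xi> * gaussian (d *\<^sub>R \<xi>))"
      using d by (subst integral_lborel_affine[OF i, of d 0]) (simp_all add: scaleR_conv_of_real[where 'a=complex])
    finally have *: "(LINT \<xi>|lborel. ?k t \<xi> * gaussian (d *\<^sub>R \<xi>)) =
        sqrt (2 * pi) ^ CARD('n) * gaussian ((1 / d) *\<^sub>R (x - t)) / d ^ CARD('n)"
      using d by (simp add: field_simps)
    have "(LINT \<xi>|lborel. ?k t \<xi> * (h t * gaussian (d *\<^sub>R \<xi>))) =
          (LINT \<xi>|lborel. h t * (?k t \<xi> * gaussian (d *\<^sub>R \<xi>)))"
      by (intro Bochner_Integration.integral_cong) auto
    then show "(LINT \<xi>|lborel. ?k t \<xi> * (h t * gaussian (d *\<^sub>R \<xi>))) =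
        h t * (sqrt (2 * pi) ^ CARD('n) * gaussian ((1 / d) *\<^sub>R (x - t)) / d ^ CARD('n))"
      by (simp add: *)
  qed
  \<comment> \<open>Substitution \<open>t = x + d *\<^sub>R u\<close>: the Jacobian cancels
    \<open>d ^ CARD('n)\<close>, and the scale \<open>d\<close> moves from the Gaussian into
    \<open>h\<close>, where continuity can act.\<close>
  also have "\<dots> = d ^ CARD('n) *\<^sub>R (LINT u|lborel. h (x + d *\<^sub>R u) *
        (sqrt (2 * pi) ^ CARD('n) * gaussian ((1 / d) *\<^sub>R (x - (x + d *\<^sub>R u))) / d ^ CARD('n)))"
  proof -
    have "integrable lborel (\<lambda>t. gaussian ((1 / d) *\<^sub>R (x - t)) * h t)"
      by (rule integrable_phase_mult[OF h]) (auto simp: gaussian_def)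
    then have "integrable lborel (\<lambda>t. (sqrt (2 * pi) ^ CARD('n) / d ^ CARD('n)) * (gaussian ((1 / d) *\<^sub>R (x - t)) * h t))"
      by (rule integrable_mult_right)
    then have "integrable lborel (\<lambda>t. h t * (sqrt (2 * pi) ^ CARD('n) * gaussian ((1 / d) *\<^sub>R (x - t)) / d ^ CARD('n)))"
      by (simp add: mult_ac)
    from integral_lborel_affine[OF this, of d x] d show ?thesis by simp
  qed
  also have "\<dots> = d ^ CARD('n) *\<^sub>R (LINT u|lborel. (sqrt (2 * pi) ^ CARD('n) / d ^ CARD('n)) * (h (x + d *\<^sub>R u) * gaussian u))"
    using d by (simp add: gaussian_def mult_ac)
  also have "\<dots> = sqrt (2 * pi) ^ CARD('n) * (LINT u|lborel. h (x + d *\<^sub>R u) * gaussian u)"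
    using d by (simp add: scaleR_conv_of_real[where 'a=complex])
  finally show ?thesis .
qed

text \<open>Let the scale tend to 0 in the regularised identity. Dominated convergence has the
  majorant \<open>norm (fourier h \<xi>)\<close> on the left and \<open>B\<close> times the Gaussian
  on the right, where continuity of \<open>h\<close> at \<open>x\<close> gives the limit. One half
  of the factor \<open>(2 * pi) ^ CARD('n)\<close> is already present in that identity, the other is
  the integral of the Gaussian.\<close>

theorem fourier_inversion:
  fixes h :: "real^'n::finite \<Rightarrow> complex"
  assumes h: "integrable lborel h" and cont: "continuous_on UNIV h"
    and bounded: "\<And>x. norm (h x) \<le> B" and fh: "integrable lborel (fourier h)"
  shows "(LINT \<xi>|lborel. phase x \<xi> * fourier h \<xi>) = (2 * pi) ^ CARD('n) * h x"
proof -
  note [measurable] = borel_measurable_integrable[OF h, simplified]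
  have "sqrt (2 * pi) ^ CARD('n) * sqrt (2 * pi) ^ CARD('n) = (2 * pi) ^ CARD('n)"
    unfolding power_mult_distrib[symmetric] by simp
  then have sqrt_sq: "complex_of_real (sqrt (2 * pi) ^ CARD('n)) * complex_of_real (sqrt (2 * pi) ^ CARD('n)) = complex_of_real ((2 * pi) ^ CARD('n))"
    by (metis of_real_mult)
  define d where "d n = 1 / real (Suc n)" for n
  have d0: "d n > 0" for n by (simp add: d_def)
  have d: "d \<longlonglongrightarrow> 0"
    unfolding d_def by (rule LIMSEQ_Suc[OF lim_1_over_n])
  have gauss_lim: "(\<lambda>n. gaussian (d n *\<^sub>R y)) \<longlonglongrightarrow> 1" for y :: "real^'n"
  proof -
    have "(\<lambda>n. gaussian (d n *\<^sub>R y)) \<longlonglongrightarrow> complex_of_real (exp (- (norm (0 *\<^sub>R y))\<^sup>2 / 2))"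
      unfolding gaussian_def by (intro tendsto_intros d) auto
    then show ?thesis by simp
  qed
  have "(\<lambda>n. LINT \<xi>|lborel. fourier h \<xi> * phase x \<xi> * gaussian (d n *\<^sub>R \<xi>))
      \<longlonglongrightarrow> (LINT \<xi>|lborel. phase x \<xi> * fourier h \<xi>)"
  proof (rule integral_dominated_convergence[where w = "\<lambda>\<xi>. norm (fourier h \<xi>)"])
    show "AE \<xi> in lborel. (\<lambda>n. fourier h \<xi> * phase x \<xi> * gaussian (d n *\<^sub>R \<xi>)) \<longlonglongrightarrow> phase x \<xi> * fourier h \<xi>"
    proof (rule AE_I2)
      fix \<xi> :: "real^'n"
      show "(\<lambda>n. fourier h \<xi> * phase x \<xi> * gaussian (d n *\<^sub>R \<xi>)) \<longlonglongrightarrow> phase x \<xi> * fourier h \<xi>"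
        using tendsto_mult[OF tendsto_const gauss_lim[of \<xi>], of "fourier h \<xi> * phase x \<xi>"] by (simp add: mult_ac)
    qed
  qed (use fh in \<open>auto simp: norm_mult gaussian_def intro!: AE_I2 mult_left_le\<close>)
  moreover have "(\<lambda>n. LINT u|lborel. h (x + d n *\<^sub>R u) * gaussian u) \<longlonglongrightarrow> (LINT u::real^'n|lborel. h x * gaussian u)"
  proof (rule integral_dominated_convergence[where w = "\<lambda>u::real^'n. B * norm (gaussian u :: complex)"])
    show "integrable lborel (\<lambda>u. B * norm (gaussian (u::real^'n)))"
      using integrable_gaussian by auto
    show "AE u in lborel. (\<lambda>n. h (x + d n *\<^sub>R u) * gaussian u) \<longlonglongrightarrow> h x * gaussian u"
    proof (rule AE_I2)
      fix u :: "real^'n"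
      have "(\<lambda>n. x + d n *\<^sub>R u) \<longlonglongrightarrow> x + 0 *\<^sub>R u" by (intro tendsto_intros d)
      moreover have "isCont h x" using cont by (simp add: continuous_on_eq_continuous_at)
      ultimately have "(\<lambda>n. h (x + d n *\<^sub>R u)) \<longlonglongrightarrow> h x"
        by (intro isCont_tendsto_compose[of x h]) auto
      then show "(\<lambda>n. h (x + d n *\<^sub>R u) * gaussian u) \<longlonglongrightarrow> h x * gaussian u"
        by (intro tendsto_intros)
    qed
  qed (auto simp: norm_mult intro!: AE_I2 mult_right_mono bounded)
  then have "(\<lambda>n. sqrt (2 * pi) ^ CARD('n) * (LINT u|lborel. h (x + d n *\<^sub>R u) * gaussian u))
     \<longlonglongrightarrow> sqrt (2 * pi) ^ CARD('n) * (LINT u::real^'n|lborel. h x * gaussian u)"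
    by (intro tendsto_intros)
  ultimately have "(LINT \<xi>|lborel. phase x \<xi> * fourier h \<xi>) =
      sqrt (2 * pi) ^ CARD('n) * (LINT u::real^'n|lborel. h x * gaussian u)"
    unfolding gaussian_regularised_inversion[OF h d0] by (rule LIMSEQ_unique)
  also have "(LINT u::real^'n|lborel. h x * gaussian u) = h x * sqrt (2 * pi) ^ CARD('n)"
    using integral_gaussian_phase[of "0::real^'n"] by (simp add: gaussian_def)
  also have "sqrt (2 * pi) ^ CARD('n) * (h x * sqrt (2 * pi) ^ CARD('n)) = (2 * pi) ^ CARD('n) * h x"
    unfolding sqrt_sq[symmetric] by (simp only: mult_ac)
  finally show ?thesis .
qed

text \<open>The convolution theorem: insert the inversion formula for \<open>G\<close> and exchange
  the integrals. The roles are asymmetric, since inversion is applied to \<open>G\<close> while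
  \<open>A\<close> is merely integrable.\<close>

lemma fourier_mult:
  fixes A G :: "real^'n::finite \<Rightarrow> complex"
  assumes A: "integrable lborel A"
    and G: "integrable lborel G" "continuous_on UNIV G" "\<And>x. norm (G x) \<le> B" "integrable lborel (fourier G)"
  shows "(2 * pi) ^ CARD('n) * fourier (\<lambda>t. A t * G t) \<xi> = (LINT \<eta>|lborel. fourier G \<eta> * fourier A (\<xi> - \<eta>))"
proof -
  note [measurable] = borel_measurable_integrable[OF A, simplified] borel_measurable_integrable[OF G(1), simplified]
  let ?k = "\<lambda>t \<eta>. exp (- \<i> * of_real (t \<bullet> (\<xi> - \<eta>)))"
  have "integrable (lborel \<Otimes>\<^sub>M lborel) (\<lambda>(t,\<eta>). ?k t \<eta> * (A t * fourier G \<eta>))"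
    by (rule integrable_pair_mult_bounded[OF A G(4)]) auto
  then have "(LINT \<eta>|lborel. LINT t|lborel. ?k t \<eta> * (A t * fourier G \<eta>)) =
             (LINT t|lborel. LINT \<eta>|lborel. ?k t \<eta> * (A t * fourier G \<eta>))"
    by (rule lborel_pair.Fubini_integral)
  also have "(LINT \<eta>|lborel. LINT t|lborel. ?k t \<eta> * (A t * fourier G \<eta>)) =
      (LINT \<eta>|lborel. fourier G \<eta> * fourier A (\<xi> - \<eta>))"
    by (simp add: fourier_lborel mult.assoc[symmetric],
        intro Bochner_Integration.integral_cong refl mult.commute)
  also have "(LINT t|lborel. LINT \<eta>|lborel. ?k t \<eta> * (A t * fourier G \<eta>)) =
      (LINT t|lborel. (2 * pi) ^ CARD('n) * (exp (- \<i> * of_real (t \<bullet> \<xi>)) * (A t * G t)))"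
  proof (intro Bochner_Integration.integral_cong refl)
    fix t :: "real^'n"
    have "(LINT \<eta>|lborel. ?k t \<eta> * (A t * fourier G \<eta>)) =
      (LINT \<eta>|lborel. (exp (- \<i> * of_real (t \<bullet> \<xi>)) * A t) * (phase t \<eta> * fourier G \<eta>))"
      by (intro Bochner_Integration.integral_cong refl)
         (simp add: inner_diff_right right_diff_distrib exp_diff exp_minus field_simps)
    also have "\<dots> = (exp (- \<i> * of_real (t \<bullet> \<xi>)) * A t) * ((2 * pi) ^ CARD('n) * G t)"
      by (simp only: integral_mult_right_zero fourier_inversion[OF G])
    finally show "(LINT \<eta>|lborel. ?k t \<eta> * (A t * fourier G \<eta>)) =
      (2 * pi) ^ CARD('n) * (exp (- \<i> * of_real (t \<bullet> \<xi>)) * (A t * G t))"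
      by (simp add: mult_ac)
  qed
  also have "\<dots> = (2 * pi) ^ CARD('n) * fourier (\<lambda>t. A t * G t) \<xi>"
    by (simp add: fourier_lborel)
  finally show ?thesis ..
qed

section \<open>Lebesgue norms\<close>

lemma ennreal_powr_one [simp]: "ennreal_powr x 1 = x"
  by (cases x) (auto simp: ennreal_powr_def)

lemma ennreal_powr_mono: "x \<le> y \<Longrightarrow> 0 \<le> r \<Longrightarrow> ennreal_powr x r \<le> ennreal_powr y r"
  by (cases x; cases y) (auto simp: ennreal_powr_def top_unique intro!: powr_mono2)

lemma ennreal_powr_eq_0_iff: "ennreal_powr x r = 0 \<longleftrightarrow> x = 0"
  by (cases x) (auto simp: ennreal_powr_def ennreal_eq_0_iff)

lemma ennreal_powr_less_top: "x < \<infinity> \<Longrightarrow> ennreal_powr x r < \<infinity>"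
  by (auto simp: ennreal_powr_def)

lemma ennreal_powr_cmult:
  assumes "0 \<le> c" "0 < r"
  shows "ennreal_powr (ennreal c * x) r = ennreal (c powr r) * ennreal_powr x r"
proof (cases x)
  case (real y)
  then show ?thesis
    using assms by (simp add: ennreal_mult[symmetric] ennreal_powr_simps powr_mult)
next
  case top
  then show ?thesis
    using assms by (cases "c = 0") (auto simp: ennreal_powr_def ennreal_mult_top)
qed

lemma ge_1_ennreal_cases:
  assumes "1 \<le> (p::ennreal)"
  obtains "p = 1" | "p = \<infinity>" | r where "1 < r" "p = ennreal r"
proof (cases p)
  case (real r)
  then show ?thesis
    using assms that(1,3) by (cases "r = 1") (auto simp: less_le)
qed (use that in auto)

lemma conj_exp_simps [simp]:
  "conj_exp 1 = \<infinity>"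
  "conj_exp top = 1"
  by (auto simp: conj_exp_def)

lemma conj_exp_real:
  assumes "1 < r"
  shows "conj_exp (ennreal r) = ennreal (r / (r - 1))"
proof -
  have "ennreal (r / (r - 1)) = conj_exp (ennreal r)"
    using assms
    by (subst conj_exp_iff) (auto simp: inverse_ennreal ennreal_plus[symmetric] field_simps simp del: ennreal_plus)
  then show ?thesis ..
qed

lemma conj_exp_ge_1: "1 \<le> p \<Longrightarrow> 1 \<le> conj_exp p"
  by (erule ge_1_ennreal_cases) (auto simp: conj_exp_real field_simps)

lemma Lp_norm_1: "Lp_norm 1 f = (\<integral>\<^sup>+x. ennreal (norm (f x)) \<partial>lborel)"
  by (simp add: Lp_norm_def nn_integral_completion)

lemma Lp_norm_real:
  "0 < r \<Longrightarrow> Lp_norm (ennreal r) f = ennreal_powr (\<integral>\<^sup>+x. ennreal (norm (f x) powr r) \<partial>lborel) (1 / r)"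
  by (simp add: Lp_norm_def nn_integral_completion)

lemma Lp_norm_inf_AE:
  fixes f :: "'a::euclidean_space \<Rightarrow> 'b::real_normed_vector"
  assumes [measurable]: "f \<in> borel_measurable borel"
  shows "AE x in lborel. ennreal (norm (f x)) \<le> Lp_norm \<infinity> f"
proof -
  have "AE x in lebesgue. ennreal (norm (f x)) \<le> Lp_norm \<infinity> f"
    using esssup_AE[where f = "\<lambda>x. ennreal (norm (f x))"] by (simp add: Lp_norm_def)
  then show ?thesis
    by (subst (asm) AE_completion_iff) auto
qed

lemma Lp_norm_inf_le:
  fixes f :: "'a::euclidean_space \<Rightarrow> 'b::real_normed_vector"
  assumes [measurable]: "f \<in> borel_measurable borel" and "AE x in lborel. ennreal (norm (f x)) \<le> c"
  shows "Lp_norm \<infinity> f \<le> c"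
proof -
  have "AE x in lebesgue. ennreal (norm (f x)) \<le> c"
    using assms(2) by (rule AE_completion)
  moreover have "(\<lambda>x. ennreal (norm (f x))) \<in> borel_measurable lebesgue"
    by (intro measurable_completion) measurable
  ultimately show ?thesis
    by (auto simp: Lp_norm_def)
qed

text \<open>The set where a continuous \<open>f\<close> exceeds its essential supremum is open, and
  a nonempty open set is not negligible. This turns essential bounds into pointwise ones.\<close>

lemma norm_le_Lp_norm_inf:
  fixes f :: "'a::euclidean_space \<Rightarrow> 'b::real_normed_vector"
  assumes cont: "continuous_on UNIV f"
  shows "ennreal (norm (f x)) \<le> Lp_norm \<infinity> f"
proof (rule ccontr)
  assume *: "\<not> ?thesis"
  let ?S = "{x. Lp_norm \<infinity> f < ennreal (norm (f x))}"
  have "continuous_on UNIV (\<lambda>x. ennreal (norm (f x)))"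
    by (intro continuous_intros continuous_on_ennreal cont)
  then have "open ?S"
    by (intro open_Collect_less continuous_intros)
  moreover have "?S \<noteq> {}" using * by (auto simp: not_le simp del: infinity_ennreal_def)
  ultimately have "\<not> negligible ?S" by (rule open_not_negligible)
  moreover have "AE x in lebesgue. x \<notin> ?S"
    using AE_completion[OF Lp_norm_inf_AE[OF borel_measurable_continuous_onI[OF cont]]]
    by eventually_elim auto
  then have "?S \<in> null_sets lebesgue"
    using \<open>open ?S\<close> by (subst AE_iff_null_sets) auto
  ultimately show False
    by (simp add: negligible_iff_null_sets)
qed

lemma Lp_norm_eq_0_AE:
  fixes f :: "'a::euclidean_space \<Rightarrow> 'b::real_normed_vector"
  assumes [measurable]: "f \<in> borel_measurable borel" and p: "1 \<le> p" and 0: "Lp_norm p f = 0"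
  shows "AE x in lborel. f x = 0"
proof (cases "p = \<infinity>")
  case True
  then show ?thesis
    using Lp_norm_inf_AE[OF assms(1)] 0 by (auto elim!: eventually_mono simp: ennreal_eq_0_iff)
next
  case False
  with p obtain r where r: "p = ennreal r" "1 \<le> r" by (cases p) auto
  then have "(\<integral>\<^sup>+x. ennreal (norm (f x) powr r) \<partial>lborel) = 0"
    using 0 by (simp add: Lp_norm_real ennreal_powr_eq_0_iff)
  then have "AE x in lborel. ennreal (norm (f x) powr r) = 0"
    by (subst (asm) nn_integral_0_iff_AE) auto
  then show ?thesis
    by eventually_elim (simp add: ennreal_eq_0_iff)
qed

section \<open>Hoelder, Young and scaling inequalities for Lebesgue norms\<close>

lemma Holder_inequality_1_inf:
  fixes f :: "'a::euclidean_space \<Rightarrow> 'b::real_normed_vector" and g :: "'a \<Rightarrow> 'c::real_normed_vector"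
  assumes [measurable]: "f \<in> borel_measurable borel" "g \<in> borel_measurable borel"
  shows "(\<integral>\<^sup>+x. ennreal (norm (f x)) * ennreal (norm (g x)) \<partial>lborel) \<le> Lp_norm 1 f * Lp_norm \<infinity> g"
proof -
  have "(\<integral>\<^sup>+x. ennreal (norm (f x)) * ennreal (norm (g x)) \<partial>lborel) \<le> (\<integral>\<^sup>+x. ennreal (norm (f x)) * Lp_norm \<infinity> g \<partial>lborel)"
    using Lp_norm_inf_AE[OF assms(2)] by (intro nn_integral_mono_AE) (auto elim!: eventually_mono intro!: mult_left_mono)
  also have "\<dots> = Lp_norm 1 f * Lp_norm \<infinity> g"
    by (simp add: Lp_norm_1 nn_integral_multc)
  finally show ?thesis .
qed

text \<open>For \<open>1 < r\<close> both functions are normalised by their norms and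
  \<open>Youngs_inequality\<close> is applied pointwise. Normalising requires positive finite norms,
  so the values 0 and infinity of \<open>P\<close> and \<open>Q\<close> are treated first.\<close>

lemma Holder_inequality:
  fixes f :: "'a::euclidean_space \<Rightarrow> 'b::real_normed_vector" and g :: "'a \<Rightarrow> 'c::real_normed_vector"
  assumes [measurable]: "f \<in> borel_measurable borel" "g \<in> borel_measurable borel"
    and p: "1 \<le> p"
  shows "(\<integral>\<^sup>+x. ennreal (norm (f x)) * ennreal (norm (g x)) \<partial>lborel) \<le> Lp_norm p f * Lp_norm (conj_exp p) g"
  using p
proof (cases rule: ge_1_ennreal_cases)
  case 1
  then show ?thesis using Holder_inequality_1_inf[OF assms(1,2)] by simp
next
  case 2
  then show ?thesis using Holder_inequality_1_inf[OF assms(2,1)] by (simp add: mult.commute)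
next
  case (3 r)
  define s where "s = r / (r - 1)"
  have s: "1 < s" "1 / r + 1 / s = 1" and r: "0 < r" using 3 by (auto simp: s_def field_simps)
  define P where "P = (\<integral>\<^sup>+x. ennreal (norm (f x) powr r) \<partial>lborel)"
  define Q where "Q = (\<integral>\<^sup>+x. ennreal (norm (g x) powr s) \<partial>lborel)"
  have norms: "Lp_norm p f = ennreal_powr P (1 / r)" "Lp_norm (conj_exp p) g = ennreal_powr Q (1 / s)"
    using 3 s by (auto simp: Lp_norm_real P_def Q_def conj_exp_real s_def[symmetric])
  consider "P = 0 \<or> Q = 0" | "P \<noteq> 0" "Q \<noteq> 0" "P = \<infinity> \<or> Q = \<infinity>" | "P \<noteq> 0" "Q \<noteq> 0" "P \<noteq> \<infinity>" "Q \<noteq> \<infinity>"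
    by blast
  then show ?thesis
  proof cases
    \<comment> \<open>This also covers norms 0 and infinity occurring together, where the right side
      is \<open>0 * \<infinity> = 0\<close>.\<close>
    case 1
    then have "(AE x in lborel. norm (f x) powr r = 0) \<or> (AE x in lborel. norm (g x) powr s = 0)"
      unfolding P_def Q_def by (subst (asm) (1 2) nn_integral_0_iff_AE) (auto simp: ennreal_eq_0_iff)
    then have "AE x in lborel. ennreal (norm (f x)) * ennreal (norm (g x)) = 0"
      by (auto elim: eventually_mono)
    then have "(\<integral>\<^sup>+x. ennreal (norm (f x)) * ennreal (norm (g x)) \<partial>lborel) = 0"
      by (subst nn_integral_0_iff_AE) auto
    then show ?thesis by simp
  next
    case 2
    then have "ennreal_powr P (1 / r) \<noteq> 0" "ennreal_powr Q (1 / s) \<noteq> 0"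
        "ennreal_powr P (1 / r) = \<infinity> \<or> ennreal_powr Q (1 / s) = \<infinity>"
      by (auto simp: ennreal_powr_eq_0_iff) (auto simp: ennreal_powr_def)
    then show ?thesis
      unfolding norms by (auto simp: ennreal_mult_top ennreal_top_mult)
  next
    case 3
    then obtain a b where a: "P = ennreal a" "0 < a" and b: "Q = ennreal b" "0 < b"
      by (cases P; cases Q) (auto simp: less_le)
    \<comment> \<open>\<open>A\<close> and \<open>B\<close> are the two norms. Young's inequality
      for \<open>f / A\<close> and \<open>g / B\<close>, multiplied by \<open>A * B\<close>, gets
      the coefficients \<open>A * B / (r * a)\<close> and \<open>A * B / (s * b)\<close> because
      \<open>A powr r = a\<close> and \<open>B powr s = b\<close>; after integration the two terms
      add up to \<open>A * B\<close>.\<close>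
    define A where "A = a powr (1 / r)"
    define B where "B = b powr (1 / s)"
    have AB: "0 < A" "0 < B" "A powr r = a" "B powr s = b"
      using a b r s by (auto simp: A_def B_def powr_powr)
    have "(\<integral>\<^sup>+x. ennreal (norm (f x)) * ennreal (norm (g x)) \<partial>lborel)
       \<le> (\<integral>\<^sup>+x. ennreal (A * B / (r * a)) * ennreal (norm (f x) powr r) + ennreal (A * B / (s * b)) * ennreal (norm (g x) powr s) \<partial>lborel)"
    proof (rule nn_integral_mono)
      fix x
      have "norm (f x) / A * (norm (g x) / B) \<le> (norm (f x) / A) powr r / r + (norm (g x) / B) powr s / s"
        using AB 3 \<open>1 < r\<close> s by (intro Youngs_inequality) auto
      then have "A * B * (norm (f x) / A * (norm (g x) / B)) \<le> A * B * ((norm (f x) / A) powr r / r + (norm (g x) / B) powr s / s)"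
        using AB by (intro mult_left_mono) auto
      also have "\<dots> = A * B / (r * a) * (norm (f x) powr r) + A * B / (s * b) * (norm (g x) powr s)"
        using AB by (simp add: powr_divide distrib_left mult_ac)
      finally have "norm (f x) * norm (g x) \<le> A * B / (r * a) * (norm (f x) powr r) + A * B / (s * b) * (norm (g x) powr s)"
        using AB by simp
      then show "ennreal (norm (f x)) * ennreal (norm (g x)) \<le>
          ennreal (A * B / (r * a)) * ennreal (norm (f x) powr r) + ennreal (A * B / (s * b)) * ennreal (norm (g x) powr s)"
        using AB a b r s
        by (simp add: ennreal_mult[symmetric] ennreal_plus[symmetric] ennreal_leI del: ennreal_plus)
    qed
    also have "\<dots> = ennreal (A * B / (r * a)) * P + ennreal (A * B / (s * b)) * Q"
      unfolding P_def Q_def by (simp add: nn_integral_add nn_integral_cmult)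
    also have "\<dots> = ennreal (A * B / (r * a) * a + A * B / (s * b) * b)"
      unfolding a(1) b(1) using AB a b r s
      by (subst ennreal_plus) (auto simp del: times_divide_eq_left times_divide_eq_right simp: ennreal_mult)
    also have "A * B / (r * a) * a + A * B / (s * b) * b = A * B * (1 / r + 1 / s)"
      using a b r s by (simp add: field_simps)
    also have "\<dots> = A * B" using s by simp
    also have "ennreal (A * B) = ennreal_powr P (1 / r) * ennreal_powr Q (1 / s)"
      using a b by (simp add: ennreal_powr_simps A_def B_def ennreal_mult)
    finally show ?thesis unfolding norms .
  qed
qed

lemma nn_integral_convolution:
  fixes f g :: "'a::euclidean_space \<Rightarrow> ennreal"
  assumes [measurable]: "f \<in> borel_measurable borel" "g \<in> borel_measurable borel"
  shows "(\<integral>\<^sup>+z. \<integral>\<^sup>+w. f (z - w) * g w \<partial>lborel \<partial>lborel) = (\<integral>\<^sup>+z. f z \<partial>lborel) * (\<integral>\<^sup>+w. g w \<partial>lborel)"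
proof -
  have "(\<integral>\<^sup>+z. \<integral>\<^sup>+w. f (z - w) * g w \<partial>lborel \<partial>lborel) = (\<integral>\<^sup>+w. \<integral>\<^sup>+z. f (z - w) * g w \<partial>lborel \<partial>lborel)"
    by (rule lborel_pair.Fubini') simp
  also have "\<dots> = (\<integral>\<^sup>+w. (\<integral>\<^sup>+z. f z \<partial>lborel) * g w \<partial>lborel)"
    using nn_integral_lborel_translate[OF assms(1)]
    by (intro nn_integral_cong) (simp add: nn_integral_multc, metis (no_types, lifting) add.commute diff_conv_add_uminus nn_integral_cong)
  finally show ?thesis by (simp add: nn_integral_cmult)
qed

text \<open>Stated for any \<open>h\<close> dominated by the convolution, so that a pointwise
  estimate can be fed in directly. For \<open>1 < r\<close>, splitting \<open>norm (g w)\<close>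
  into its powers \<open>1 / r\<close> and \<open>1 / s\<close> and applying Hoelder bounds
  \<open>norm (h z) powr r\<close> by \<open>c powr (r / s)\<close> times the convolution of
  \<open>norm (f z) powr r\<close> with \<open>norm (g w)\<close>. Integration adds one more factor
  \<open>c\<close>, and \<open>r / s + 1 = r\<close>.\<close>

lemma Young_convolution_inequality:
  fixes f :: "'a::euclidean_space \<Rightarrow> 'b::real_normed_vector" and g :: "'a \<Rightarrow> 'c::real_normed_vector"
    and h :: "'a \<Rightarrow> 'd::real_normed_vector"
  assumes [measurable]: "f \<in> borel_measurable borel" "g \<in> borel_measurable borel" "h \<in> borel_measurable borel"
    and p: "1 \<le> p" and g: "Lp_norm 1 g < \<infinity>"
    and h: "\<And>z. ennreal (norm (h z)) \<le> (\<integral>\<^sup>+w. ennreal (norm (f (z - w))) * ennreal (norm (g w)) \<partial>lborel)"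
  shows "Lp_norm p h \<le> Lp_norm p f * Lp_norm 1 g"
  using p
proof (cases rule: ge_1_ennreal_cases)
  case 1
  have "Lp_norm 1 h \<le> Lp_norm 1 f * Lp_norm 1 g"
    unfolding Lp_norm_1 by (subst nn_integral_convolution[symmetric]) (auto intro!: nn_integral_mono h)
  then show ?thesis using 1 by simp
next
  case 2
  have "ennreal (norm (h z)) \<le> Lp_norm \<infinity> f * Lp_norm 1 g" for z
  proof -
    have "ennreal (norm (h z)) \<le> (\<integral>\<^sup>+w. ennreal (norm (f (z - w))) * ennreal (norm (g (z - (z - w)))) \<partial>lborel)"
      using h[of z] by simp
    also have "\<dots> = (\<integral>\<^sup>+w. ennreal (norm (f w)) * ennreal (norm (g (z - w))) \<partial>lborel)"
      by (rule nn_integral_lborel_reflect[where f = "\<lambda>w. ennreal (norm (f w)) * ennreal (norm (g (z - w)))"]) measurable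
    also have "\<dots> \<le> (\<integral>\<^sup>+w. Lp_norm \<infinity> f * ennreal (norm (g (z - w))) \<partial>lborel)"
      using Lp_norm_inf_AE[OF assms(1)] by (intro nn_integral_mono_AE) (auto elim!: eventually_mono intro!: mult_right_mono)
    also have "\<dots> = Lp_norm \<infinity> f * (\<integral>\<^sup>+w. ennreal (norm (g (z - w))) \<partial>lborel)"
      by (simp add: nn_integral_cmult)
    also have "(\<integral>\<^sup>+w. ennreal (norm (g (z - w))) \<partial>lborel) = Lp_norm 1 g"
      unfolding Lp_norm_1 by (rule nn_integral_lborel_reflect) measurable
    finally show ?thesis .
  qed
  then show ?thesis
    unfolding 2 by (intro Lp_norm_inf_le) auto
next
  case (3 r)
  define s where "s = r / (r - 1)"
  have s: "1 < s" "1 / r + 1 / s = 1" and r: "0 < r" using 3 by (auto simp: s_def field_simps)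
  have conj: "conj_exp (ennreal r) = ennreal s" using 3 by (simp add: conj_exp_real s_def)
  obtain c where c: "Lp_norm 1 g = ennreal c" "0 \<le> c" using g by (cases "Lp_norm 1 g") auto
  define P where "P z = (\<integral>\<^sup>+w. ennreal (norm (f (z - w)) powr r) * ennreal (norm (g w)) \<partial>lborel)" for z
  have pointwise: "ennreal (norm (h z) powr r) \<le> ennreal (c powr (r / s)) * P z" for z
  proof -
    let ?u = "\<lambda>w. norm (f (z - w)) * norm (g w) powr (1 / r)" and ?v = "\<lambda>w. norm (g w) powr (1 / s)"
    have "ennreal (norm (h z)) \<le> (\<integral>\<^sup>+w. ennreal (norm (?u w)) * ennreal (norm (?v w)) \<partial>lborel)"
    proof (rule order_trans[OF h], rule nn_integral_mono)
      fix w
      have "norm (g w) = norm (g w) powr (1 / r) * norm (g w) powr (1 / s)"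
        using s by (simp add: powr_add[symmetric])
      then show "ennreal (norm (f (z - w))) * ennreal (norm (g w)) \<le> ennreal (norm (?u w)) * ennreal (norm (?v w))"
        by (simp add: ennreal_mult[symmetric] abs_mult mult.assoc)
    qed
    also have "\<dots> \<le> Lp_norm (ennreal r) ?u * Lp_norm (ennreal s) ?v"
      using Holder_inequality[of ?u ?v "ennreal r"] 3 by (simp add: conj)
    also have "Lp_norm (ennreal r) ?u = ennreal_powr (P z) (1 / r)"
      using r by (simp add: Lp_norm_real P_def powr_mult abs_mult powr_powr ennreal_mult)
    also have "Lp_norm (ennreal s) ?v = ennreal_powr (ennreal c) (1 / s)"
      using s by (simp add: Lp_norm_real powr_powr c(1)[symmetric] Lp_norm_1)
    finally have *: "ennreal (norm (h z)) \<le> ennreal_powr (P z) (1 / r) * ennreal (c powr (1 / s))"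
      using c by (simp add: ennreal_powr_simps)
    show ?thesis
    proof (cases "P z")
      case (real q)
      then have "norm (h z) \<le> q powr (1 / r) * c powr (1 / s)"
        using * c by (simp add: ennreal_powr_simps ennreal_mult[symmetric])
      then have "norm (h z) powr r \<le> (q powr (1 / r) * c powr (1 / s)) powr r"
        using r by (intro powr_mono2) auto
      also have "\<dots> = c powr (r / s) * q"
        using real r by (simp add: powr_mult powr_powr)
      finally show ?thesis
        using real c by (simp add: ennreal_mult[symmetric] ennreal_leI)
    next
      case top
      \<comment> \<open>For \<open>c = 0\<close> the right side would be
        \<open>0 * \<infinity>\<close>; but then \<open>g\<close> vanishes almost everywhere and
        \<open>P z\<close> cannot be infinite.\<close>
      have "c \<noteq> 0"
      proof
        assume "c = 0"
        then have "AE w in lborel. g w = 0"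
          using Lp_norm_eq_0_AE[of g 1] c by simp
        then have "P z = 0"
          unfolding P_def by (subst nn_integral_0_iff_AE) (auto elim!: eventually_mono)
        with top show False by simp
      qed
      then show ?thesis
        using top c by (simp add: ennreal_mult_top)
    qed
  qed
  have "(\<integral>\<^sup>+z. ennreal (norm (h z) powr r) \<partial>lborel) \<le> (\<integral>\<^sup>+z. ennreal (c powr (r / s)) * P z \<partial>lborel)"
    by (intro nn_integral_mono pointwise)
  also have "\<dots> = ennreal (c powr (r / s)) * (\<integral>\<^sup>+z. P z \<partial>lborel)"
    unfolding P_def by (subst nn_integral_cmult) auto
  also have "(\<integral>\<^sup>+z. P z \<partial>lborel) = (\<integral>\<^sup>+z. ennreal (norm (f z) powr r) \<partial>lborel) * ennreal c"
    unfolding P_def c(1)[symmetric] Lp_norm_1 by (rule nn_integral_convolution) measurable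
  also have "ennreal (c powr (r / s)) * ((\<integral>\<^sup>+z. ennreal (norm (f z) powr r) \<partial>lborel) * ennreal c) =
      ennreal (c powr (r / s) * c) * (\<integral>\<^sup>+z. ennreal (norm (f z) powr r) \<partial>lborel)"
    using c by (simp add: ennreal_mult mult_ac)
  also have "c powr (r / s) * c = c powr r"
  proof -
    have "r / s + 1 = r" using s r by (simp add: field_simps)
    then have "c powr r = c powr (r / s) * c powr 1" by (metis powr_add)
    then show ?thesis using c by simp
  qed
  finally have "ennreal_powr (\<integral>\<^sup>+z. ennreal (norm (h z) powr r) \<partial>lborel) (1 / r)
     \<le> ennreal_powr (ennreal (c powr r) * (\<integral>\<^sup>+z. ennreal (norm (f z) powr r) \<partial>lborel)) (1 / r)"
    using r by (intro ennreal_powr_mono) auto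
  also have "\<dots> = ennreal c * ennreal_powr (\<integral>\<^sup>+z. ennreal (norm (f z) powr r) \<partial>lborel) (1 / r)"
    using c r by (simp add: ennreal_powr_cmult powr_powr)
  finally show ?thesis
    using 3 r c by (simp add: Lp_norm_real mult.commute)
qed

lemma Lp_norm_cmult_le:
  fixes f :: "'a::euclidean_space \<Rightarrow> 'b::real_normed_vector" and h :: "'a \<Rightarrow> 'd::real_normed_vector"
  assumes [measurable]: "f \<in> borel_measurable borel" "h \<in> borel_measurable borel"
    and p: "1 \<le> p" and c: "0 \<le> c" and le: "\<And>x. norm (h x) \<le> c * norm (f x)"
  shows "Lp_norm p h \<le> ennreal c * Lp_norm p f"
proof (cases "p = \<infinity>")
  case True
  have "AE x in lborel. ennreal (norm (h x)) \<le> ennreal c * Lp_norm \<infinity> f"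
    using Lp_norm_inf_AE[OF assms(1)]
  proof eventually_elim
    case (elim x)
    have "ennreal (norm (h x)) \<le> ennreal c * ennreal (norm (f x))"
      using le[of x] c by (simp add: ennreal_mult[symmetric] ennreal_leI)
    also have "\<dots> \<le> ennreal c * Lp_norm \<infinity> f" using elim by (rule mult_left_mono) simp
    finally show ?case .
  qed
  then show ?thesis unfolding True by (intro Lp_norm_inf_le) auto
next
  case False
  with p obtain r where r: "p = ennreal r" "1 \<le> r" by (cases p) auto
  have "(\<integral>\<^sup>+z. ennreal (norm (h z) powr r) \<partial>lborel) \<le> (\<integral>\<^sup>+z. ennreal (c powr r) * ennreal (norm (f z) powr r) \<partial>lborel)"
  proof (rule nn_integral_mono)
    fix z
    have "norm (h z) powr r \<le> (c * norm (f z)) powr r"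
      using le r by (intro powr_mono2) auto
    then show "ennreal (norm (h z) powr r) \<le> ennreal (c powr r) * ennreal (norm (f z) powr r)"
      using c by (simp add: ennreal_mult[symmetric] powr_mult ennreal_leI)
  qed
  also have "\<dots> = ennreal (c powr r) * (\<integral>\<^sup>+z. ennreal (norm (f z) powr r) \<partial>lborel)"
    by (simp add: nn_integral_cmult)
  finally have "ennreal_powr (\<integral>\<^sup>+z. ennreal (norm (h z) powr r) \<partial>lborel) (1 / r)
     \<le> ennreal_powr (ennreal (c powr r) * (\<integral>\<^sup>+z. ennreal (norm (f z) powr r) \<partial>lborel)) (1 / r)"
    using r by (intro ennreal_powr_mono) auto
  then show ?thesis
    using r c by (simp add: Lp_norm_real ennreal_powr_cmult powr_powr)
qed

text \<open>Converts a bound for a square in \<open>L\<^sup>p\<close> into one for the function with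
  exponent \<open>2 * p\<close>; the Wigner transform controls the short-time Fourier transform only
  through its square.\<close>

lemma Lp_norm_square_le:
  fixes f :: "'a::euclidean_space \<Rightarrow> 'b::real_normed_vector"
  assumes [measurable]: "f \<in> borel_measurable borel" and p: "1 \<le> p"
  shows "(Lp_norm (2 * p) f)\<^sup>2 \<le> Lp_norm p (\<lambda>x. (norm (f x))\<^sup>2)"
proof (cases "p = \<infinity>")
  case True
  have m: "(\<lambda>x. (norm (f x))\<^sup>2) \<in> borel_measurable borel" by measurable
  let ?s = "Lp_norm \<infinity> (\<lambda>x. (norm (f x))\<^sup>2)"
  have "Lp_norm \<infinity> f \<le> ennreal_powr ?s (1/2)"
  proof (rule Lp_norm_inf_le)
    show "AE x in lborel. ennreal (norm (f x)) \<le> ennreal_powr ?s (1/2)"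
      using Lp_norm_inf_AE[OF m]
    proof eventually_elim
      case (elim x)
      have "ennreal (norm (f x)) = ennreal_powr (ennreal (norm ((norm (f x))\<^sup>2))) (1/2)"
        by (simp add: ennreal_powr_simps powr_half_sqrt)
      also have "\<dots> \<le> ennreal_powr ?s (1/2)"
        using elim by (intro ennreal_powr_mono) auto
      finally show ?case .
    qed
  qed simp
  then have "(Lp_norm \<infinity> f)\<^sup>2 \<le> (ennreal_powr ?s (1/2))\<^sup>2"
    by (simp add: power_mono)
  also have "\<dots> = ?s"
    by (cases ?s) (auto simp: ennreal_powr_def powr_half_sqrt ennreal_power power2_eq_square ennreal_mult[symmetric])
  finally show ?thesis using True by (simp add: ennreal_mult_top)
next
  case False
  with p obtain r where r: "p = ennreal r" "1 \<le> r" by (cases p) auto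
  have 2: "2 * p = ennreal (2 * r)" using r by (simp add: ennreal_mult)
  have "(ennreal_powr x (1 / (2 * r)))\<^sup>2 = ennreal_powr x (1 / r)" for x
    using r by (cases x) (auto simp: ennreal_powr_def power2_eq_square ennreal_mult[symmetric] powr_add[symmetric])
  moreover have "(norm (f x))\<^sup>2 powr r = norm (f x) powr (2 * r)" for x
    by (metis norm_ge_zero powr_numeral powr_powr powr_zero_eq_one power_zero_numeral powr_0 less_eq_real_def)
  ultimately show ?thesis
    using r unfolding 2 unfolding r(1) by (simp add: Lp_norm_real)
qed

section \<open>Integrals over products and integrability of power decay\<close>

lemma nn_integral_lborel_pair:
  fixes F :: "'a::euclidean_space \<times> 'b::euclidean_space \<Rightarrow> ennreal"
  assumes "F \<in> borel_measurable borel"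
  shows "(\<integral>\<^sup>+z. F z \<partial>lborel) = (\<integral>\<^sup>+x. \<integral>\<^sup>+y. F (x, y) \<partial>lborel \<partial>lborel)"
proof -
  have "F \<in> borel_measurable (lborel \<Otimes>\<^sub>M lborel)"
    using assms by (simp add: lborel_prod)
  from lborel.nn_integral_fst[OF this] show ?thesis
    by (simp add: lborel_prod)
qed

lemma nn_integral_inverse_one_plus_square_finite: "(\<integral>\<^sup>+x. ennreal (1 / (1 + x\<^sup>2)) \<partial>(lborel::real measure)) < \<infinity>"
proof -
  have pos: "(\<integral>\<^sup>+x. ennreal (1 / (1 + x\<^sup>2)) * indicator {0..} x \<partial>(lborel::real measure)) = ennreal (pi / 2 - arctan 0)"
  proof (rule nn_integral_FTC_atLeast)
    show "DERIV arctan x :> 1 / (1 + x\<^sup>2)" for x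
      using DERIV_arctan[of x] by (simp add: inverse_eq_divide)
    show "(arctan \<longlongrightarrow> pi / 2) at_top" by (rule tendsto_arctan_at_top)
  qed auto
  \<comment> \<open>The two half-lines overlap at 0, so the sum only dominates the
    integrand.\<close>
  have "(\<integral>\<^sup>+x. ennreal (1 / (1 + x\<^sup>2)) \<partial>(lborel::real measure)) \<le>
     (\<integral>\<^sup>+x. ennreal (1 / (1 + x\<^sup>2)) * indicator {0..} x + ennreal (1 / (1 + (0 - x)\<^sup>2)) * indicator {0..} (0 - x) \<partial>(lborel::real measure))"
    by (intro nn_integral_mono) (auto simp: indicator_def)
  also have "\<dots> = (\<integral>\<^sup>+x. ennreal (1 / (1 + x\<^sup>2)) * indicator {0..} x \<partial>(lborel::real measure)) +
     (\<integral>\<^sup>+x. ennreal (1 / (1 + (0 - x)\<^sup>2)) * indicator {0..} (0 - x) \<partial>(lborel::real measure))"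
    by (rule nn_integral_add) auto
  also have "(\<integral>\<^sup>+x. ennreal (1 / (1 + (0 - x)\<^sup>2)) * indicator {0..} (0 - x) \<partial>(lborel::real measure)) =
      (\<integral>\<^sup>+x. ennreal (1 / (1 + x\<^sup>2)) * indicator {0..} x \<partial>(lborel::real measure))"
    by (rule nn_integral_lborel_reflect[where f = "\<lambda>x::real. ennreal (1 / (1 + x\<^sup>2)) * indicator {0..} x"]) auto
  finally show ?thesis unfolding pos by (auto simp: less_top[symmetric] top_unique)
qed

text \<open>Each factor \<open>1 + (x \<bullet> b)\<^sup>2\<close> is at most
  \<open>(1 + norm x)\<^sup>2\<close>, so the exponent \<open>2 * DIM('a)\<close> permits comparison
  with a product of functions of one coordinate, whose integral factorises.\<close>

lemma integrable_power_decay: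
  "integrable lborel (\<lambda>x::'a::euclidean_space. 1 / (1 + norm x) ^ (2 * DIM('a)))"
proof (subst integrable_iff_bounded, intro conjI)
  have "(\<integral>\<^sup>+x. ennreal (norm (1 / (1 + norm (x::'a)) ^ (2 * DIM('a)))) \<partial>lborel) \<le>
        (\<integral>\<^sup>+x. (\<Prod>b\<in>(Basis::'a set). ennreal (1 / (1 + (x \<bullet> b)\<^sup>2))) \<partial>lborel)"
  proof (rule nn_integral_mono)
    fix x :: 'a
    have "(\<Prod>b\<in>(Basis::'a set). 1 + (x \<bullet> b)\<^sup>2) \<le> (\<Prod>b\<in>(Basis::'a set). (1 + norm x)\<^sup>2)"
    proof (rule prod_mono, intro conjI)
      fix b :: 'a assume "b \<in> Basis"
      then have "\<bar>x \<bullet> b\<bar>\<^sup>2 \<le> (norm x)\<^sup>2"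
        by (intro power_mono Basis_le_norm) auto
      then show "1 + (x \<bullet> b)\<^sup>2 \<le> (1 + norm x)\<^sup>2"
        by (simp add: power2_eq_square algebra_simps) (use norm_ge_zero[of x] in linarith)
    qed simp
    then have "(\<Prod>b\<in>(Basis::'a set). 1 + (x \<bullet> b)\<^sup>2) \<le> (1 + norm x) ^ (2 * DIM('a))"
      by (simp add: power_mult)
    moreover have "0 < (\<Prod>b\<in>(Basis::'a set). 1 + (x \<bullet> b)\<^sup>2)"
      by (intro prod_pos ballI add_pos_nonneg) auto
    ultimately have "1 / (1 + norm x) ^ (2 * DIM('a)) \<le> 1 / (\<Prod>b\<in>(Basis::'a set). 1 + (x \<bullet> b)\<^sup>2)"
      by (intro divide_left_mono mult_pos_pos) auto
    then show "ennreal (norm (1 / (1 + norm x) ^ (2 * DIM('a)))) \<le> (\<Prod>b\<in>(Basis::'a set). ennreal (1 / (1 + (x \<bullet> b)\<^sup>2)))"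
      by (subst prod_ennreal) (auto simp: prod_dividef intro!: ennreal_leI)
  qed
  also have "\<dots> = (\<Prod>b\<in>(Basis::'a set). \<integral>\<^sup>+x. ennreal (1 / (1 + x\<^sup>2)) \<partial>lborel)"
    by (rule nn_integral_lborel_prod) auto
  also have "\<dots> < \<infinity>"
    using nn_integral_inverse_one_plus_square_finite
    by (auto simp: less_top[symmetric] power_eq_top_ennreal)
  finally show "(\<integral>\<^sup>+x. ennreal (norm (1 / (1 + norm (x::'a)) ^ (2 * DIM('a)))) \<partial>lborel) < \<infinity>" .
qed measurable

section \<open>Weights and rapidly decaying functions\<close>

locale weight =
  fixes \<omega> :: "real \<Rightarrow> real" and K b :: real
  assumes weight: "weight_function \<omega> K b"
begin

lemma K_ge_1: "1 \<le> K" and b_pos: "0 < b"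
  using weight by (auto simp: weight_function_def)

lemma omega_nonneg [simp]: "0 \<le> \<omega> (norm z)"
  using weight by (auto simp: weight_function_def)

lemma omega_mono: "0 \<le> s \<Longrightarrow> s \<le> t \<Longrightarrow> \<omega> s \<le> \<omega> t"
  using weight by (auto simp: weight_function_def mono_on_def)

lemma omega_double:
  assumes "0 \<le> r" "0 \<le> s" "r \<le> 2 * s"
  shows "\<omega> r \<le> K * (1 + \<omega> s)"
proof -
  have "\<omega> r \<le> \<omega> (2 * s)" using assms by (intro omega_mono) auto
  also have "\<dots> \<le> K * (1 + \<omega> s)" using weight assms by (auto simp: weight_function_def)
  finally show ?thesis .
qed

text \<open>The substitute for subadditivity: \<open>norm z\<close> is at most twice the larger of
  the two norms, and \<open>\<omega>\<close> of the larger is at most the sum. Every use costs a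
  factor \<open>K\<close> in the exponent of the weight and a constant factor outside.\<close>

lemma omega_norm_add:
  assumes "norm z \<le> norm u + norm v"
  shows "\<omega> (norm z) \<le> K * (1 + \<omega> (norm u) + \<omega> (norm v))"
proof -
  have "\<omega> (norm z) \<le> K * (1 + \<omega> (max (norm u) (norm v)))"
    using assms by (intro omega_double) (auto simp: max_def)
  also have "\<dots> \<le> K * (1 + \<omega> (norm u) + \<omega> (norm v))"
    using K_ge_1 omega_nonneg[of u] omega_nonneg[of v] by (intro mult_left_mono) (auto simp: max_def)
  finally show ?thesis .
qed

lemma continuous_on_omega_norm: "continuous_on UNIV (\<lambda>z::'a::real_normed_vector. \<omega> (norm z))"
proof -
  have "continuous_on {0..} \<omega>" using weight by (simp add: weight_function_def)
  then show ?thesis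
    by (rule continuous_on_compose2) (auto intro: continuous_intros)
qed

lemma omega_norm_measurable [measurable]:
  "(\<lambda>z::'a::euclidean_space. \<omega> (norm z)) \<in> borel_measurable borel"
  by (rule borel_measurable_continuous_onI[OF continuous_on_omega_norm])

lemma norm_weighted: "norm (weighted \<omega> c F z) = exp (c * \<omega> (norm z)) * norm (F z)"
  by (simp add: weighted_def norm_mult)

lemma weighted_measurable [measurable]:
  assumes [measurable]: "F \<in> borel_measurable (borel::'a::euclidean_space measure)"
  shows "weighted \<omega> c F \<in> borel_measurable borel"
  unfolding weighted_def[abs_def] by measurable

lemma continuous_on_weighted: "continuous_on UNIV F \<Longrightarrow> continuous_on UNIV (weighted \<omega> c F)"
  unfolding weighted_def[abs_def] by (intro continuous_intros continuous_on_omega_norm)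

text \<open>Condition (\<gamma>) bounds the exponential by a multiple of \<open>1 + norm z\<close>
  to the power \<open>- m * b\<close>; \<open>m\<close> is chosen so that \<open>m * b\<close> is
  the exponent of \<open>integrable_power_decay\<close>.\<close>

lemma exists_integrable_exp:
  "\<exists>m>0. integrable lborel (\<lambda>z::'a::euclidean_space. exp (- m * \<omega> (norm z)))"
proof -
  obtain a where a: "\<And>t. 0 \<le> t \<Longrightarrow> a + b * ln (1 + t) \<le> \<omega> t"
    using weight by (auto simp: weight_function_def)
  define m where "m = real (2 * DIM('a)) / b"
  have m: "m > 0" "m * b = real (2 * DIM('a))" using b_pos by (auto simp: m_def)
  have "integrable lborel (\<lambda>z::'a. exp (- m * \<omega> (norm z)))"
  proof (rule Bochner_Integration.integrable_bound)
    show "integrable lborel (\<lambda>z::'a. exp (- m * a) * (1 / (1 + norm z) ^ (2 * DIM('a))))"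
      by (intro integrable_mult_right integrable_power_decay)
    show "AE z::'a in lborel. norm (exp (- m * \<omega> (norm z))) \<le> norm (exp (- m * a) * (1 / (1 + norm z) ^ (2 * DIM('a))))"
    proof (rule AE_I2)
      fix z :: 'a
      have pos: "0 < 1 + norm z" by (simp add: add_pos_nonneg)
      have "m * (a + b * ln (1 + norm z)) \<le> m * \<omega> (norm z)"
        using m a[of "norm z"] by (intro mult_left_mono) auto
      then have "- m * \<omega> (norm z) \<le> - m * a - real (2 * DIM('a)) * ln (1 + norm z)"
        by (simp only: m(2)[symmetric]) (simp add: algebra_simps)
      then have "exp (- m * \<omega> (norm z)) \<le> exp (- m * a - real (2 * DIM('a)) * ln (1 + norm z))"
        by simp
      also have "\<dots> = exp (- m * a) * (1 / (1 + norm z) ^ (2 * DIM('a)))"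
        unfolding exp_diff exp_of_nat_mult exp_ln[OF pos] by simp
      finally show "norm (exp (- m * \<omega> (norm z))) \<le> norm (exp (- m * a) * (1 / (1 + norm z) ^ (2 * DIM('a))))"
        using pos by (simp add: abs_mult)
    qed
  qed measurable
  with m show ?thesis by blast
qed

text \<open>Pointwise bounds rather than essential ones, so that they pass to reflections and to
  sections in one variable. \<open>m\<close> ranges over all reals: \<open>m = 0\<close> gives
  boundedness, and multiplying by a weight only shifts \<open>m\<close>.\<close>

definition rapid :: "('a::euclidean_space \<Rightarrow> complex) \<Rightarrow> bool" where
  "rapid F \<longleftrightarrow> F \<in> borel_measurable borel \<and> (\<forall>m. \<exists>C. \<forall>z. exp (m * \<omega> (norm z)) * norm (F z) \<le> C)"

lemma rapid_measurable: "rapid F \<Longrightarrow> F \<in> borel_measurable borel"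
  by (simp add: rapid_def)

lemma rapidE:
  assumes "rapid F"
  obtains C where "0 \<le> C" "\<And>z. norm (F z) \<le> C * exp (- m * \<omega> (norm z))"
proof -
  obtain C where C: "\<And>z. exp (m * \<omega> (norm z)) * norm (F z) \<le> C"
    using assms unfolding rapid_def by blast
  have "0 \<le> exp (m * \<omega> (norm (0::'a))) * norm (F 0)" by simp
  also have "\<dots> \<le> C" by (rule C)
  finally have "0 \<le> C" .
  moreover have "norm (F z) \<le> C * exp (- m * \<omega> (norm z))" for z
    using C[of z] by (simp add: exp_minus field_simps)
  ultimately show ?thesis using that by blast
qed

lemma rapidI:
  assumes "F \<in> borel_measurable borel" "\<And>m. 0 < m \<Longrightarrow> \<exists>C. \<forall>z. exp (m * \<omega> (norm z)) * norm (F z) \<le> C"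
  shows "rapid F"
  unfolding rapid_def
proof (intro conjI allI assms(1))
  fix m
  obtain C where C: "\<And>z. exp (max m 1 * \<omega> (norm z)) * norm (F z) \<le> C"
    using assms(2)[of "max m 1"] less_max_iff_disj[of 0 m 1] by auto
  have "exp (m * \<omega> (norm z)) * norm (F z) \<le> C" for z
    by (rule order_trans[OF mult_right_mono C]) (auto intro: mult_right_mono)
  then show "\<exists>C. \<forall>z. exp (m * \<omega> (norm z)) * norm (F z) \<le> C" by blast
qed

lemma rapid_bounded:
  assumes "rapid F"
  obtains C where "0 \<le> C" "\<And>z. norm (F z) \<le> C"
  using rapidE[OF assms, of 0] by auto

lemma rapid_weighted:
  assumes "rapid F"
  shows "rapid (weighted \<omega> c F)"
proof (rule rapidI)
  show "weighted \<omega> c F \<in> borel_measurable borel"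
    using rapid_measurable[OF assms] by measurable
  fix m
  obtain C where "\<And>z. exp ((m + c) * \<omega> (norm z)) * norm (F z) \<le> C"
    using assms unfolding rapid_def by blast
  then have "exp (m * \<omega> (norm z)) * norm (weighted \<omega> c F z) \<le> C" for z
    by (simp add: norm_weighted mult.assoc[symmetric] exp_add[symmetric] distrib_right)
  then show "\<exists>C. \<forall>z. exp (m * \<omega> (norm z)) * norm (weighted \<omega> c F z) \<le> C" by blast
qed

lemma rapid_integrable:
  assumes "rapid F"
  shows "integrable lborel F"
proof -
  obtain m where m: "integrable lborel (\<lambda>z::'a. exp (- m * \<omega> (norm z)))"
    using exists_integrable_exp by blast
  obtain C where C: "0 \<le> C" "\<And>z. norm (F z) \<le> C * exp (- m * \<omega> (norm z))"
    using rapidE[OF assms] by blast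
  show ?thesis
  proof (rule Bochner_Integration.integrable_bound)
    show "integrable lborel (\<lambda>z::'a. C * exp (- m * \<omega> (norm z)))" using m by simp
    show "AE z in lborel. norm (F z) \<le> norm (C * exp (- m * \<omega> (norm z)))"
      using C by (intro AE_I2) (simp add: abs_mult)
  qed (use rapid_measurable[OF assms] in simp)
qed

text \<open>A bound \<open>C\<close> and integrability suffice, since
  \<open>norm (F z) powr r\<close> is at most \<open>C powr (r - 1)\<close> times
  \<open>norm (F z)\<close>.\<close>

lemma rapid_Lp_norm_finite:
  assumes F: "rapid F" and p: "1 \<le> p"
  shows "Lp_norm p F < \<infinity>"
proof -
  note [measurable] = rapid_measurable[OF F]
  obtain C where C: "0 \<le> C" "\<And>z. norm (F z) \<le> C" using rapid_bounded[OF F] by blast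
  show ?thesis
  proof (cases "p = \<infinity>")
    case True
    have "Lp_norm \<infinity> F \<le> ennreal C"
      using C by (intro Lp_norm_inf_le AE_I2) (auto intro: ennreal_leI)
    also have "\<dots> < \<infinity>" by simp
    finally show ?thesis unfolding True .
  next
    case False
    with p obtain r where r: "p = ennreal r" "1 \<le> r" by (cases p) auto
    have "(\<integral>\<^sup>+z. ennreal (norm (F z) powr r) \<partial>lborel) \<le> (\<integral>\<^sup>+z. ennreal (C powr (r - 1)) * ennreal (norm (F z)) \<partial>lborel)"
    proof (rule nn_integral_mono)
      fix z
      have "norm (F z) powr r = norm (F z) powr ((r - 1) + 1)" by simp
      also have "\<dots> = norm (F z) powr (r - 1) * norm (F z)"
        unfolding powr_add by simp
      also have "\<dots> \<le> C powr (r - 1) * norm (F z)"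
        using C r by (intro mult_right_mono powr_mono2) auto
      finally show "ennreal (norm (F z) powr r) \<le> ennreal (C powr (r - 1)) * ennreal (norm (F z))"
        by (simp add: ennreal_mult[symmetric] ennreal_leI)
    qed
    also have "\<dots> = ennreal (C powr (r - 1)) * (\<integral>\<^sup>+z. ennreal (norm (F z)) \<partial>lborel)"
      by (simp add: nn_integral_cmult)
    also have "\<dots> < \<infinity>"
      using rapid_integrable[OF F] by (simp add: integrable_iff_bounded ennreal_mult_less_top)
    finally show ?thesis
      using r by (simp add: Lp_norm_real ennreal_powr_less_top[simplified])
  qed
qed

text \<open>The form in which membership in \<open>S_space\<close> enters the estimates. Continuity
  serves Fourier inversion and the passage from essential suprema to values; decay gives boundedness
  and integrability on both sides of the Fourier transform.\<close>

definition test_function :: "(real^'n::finite \<Rightarrow> complex) \<Rightarrow> bool" where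
  "test_function f \<longleftrightarrow> continuous_on UNIV f \<and> rapid f \<and> continuous_on UNIV (fourier f) \<and> rapid (fourier f)"

lemma rapid_of_Lp_norm:
  assumes cont: "continuous_on UNIV F" and "\<And>m. 0 < m \<Longrightarrow> Lp_norm \<infinity> (weighted \<omega> m F) < \<infinity>"
  shows "rapid F"
proof (rule rapidI)
  show "F \<in> borel_measurable borel" by (rule borel_measurable_continuous_onI[OF cont])
  fix m :: real assume "0 < m"
  then obtain c where c: "Lp_norm \<infinity> (weighted \<omega> m F) = ennreal c" "0 \<le> c"
    using assms(2)[of m] by (cases "Lp_norm \<infinity> (weighted \<omega> m F)") auto
  have "norm (weighted \<omega> m F z) \<le> c" for z
    using norm_le_Lp_norm_inf[OF continuous_on_weighted[OF cont, of m], of z] c by simp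
  then show "\<exists>C. \<forall>z. exp (m * \<omega> (norm z)) * norm (F z) \<le> C"
    by (auto simp: norm_weighted)
qed

lemma S_space_test_function:
  assumes "f \<in> S_space \<omega>"
  shows "test_function f"
proof -
  have cont: "continuous_on UNIV (iter_partial [] f)" "continuous_on UNIV (iter_partial [] (fourier f))"
    using assms unfolding S_space_def smooth_def by blast+
  have fin: "Lp_norm \<infinity> (weighted \<omega> m (iter_partial [] f)) < \<infinity>"
     "Lp_norm \<infinity> (weighted \<omega> m (iter_partial [] (fourier f))) < \<infinity>" if "0 < m" for m
    using assms that unfolding S_space_def by blast+
  show ?thesis
    using cont fin unfolding test_function_def iter_partial.simps by (intro conjI rapid_of_Lp_norm) auto
qed

end

section \<open>The Wigner transform\<close>

lemma borel_measurable_cnj [measurable (raw)]: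
  "f \<in> borel_measurable M \<Longrightarrow> (\<lambda>x. cnj (f x)) \<in> borel_measurable M"
  by (rule measurable_compose[OF _ borel_measurable_continuous_onI]) (auto intro: continuous_intros)

lemma fourier_affine:
  fixes f :: "real^'n::finite \<Rightarrow> complex"
  assumes f: "integrable lborel f" and c: "c \<noteq> 0"
  shows "fourier (\<lambda>t. f (x + c *\<^sub>R t)) \<zeta> = phase x ((1 / c) *\<^sub>R \<zeta>) * fourier f ((1 / c) *\<^sub>R \<zeta>) / \<bar>c\<bar> ^ CARD('n)"
proof -
  have m[measurable]: "f \<in> borel_measurable borel"
    using borel_measurable_integrable[OF f] by simp
  let ?g = "\<lambda>u. phase (x - u) ((1 / c) *\<^sub>R \<zeta>) * f u"
  have i: "integrable lborel ?g"
    by (rule integrable_phase_mult[OF f]) auto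
  have "phase x ((1 / c) *\<^sub>R \<zeta>) * fourier f ((1 / c) *\<^sub>R \<zeta>) = (LINT u|lborel. ?g u)"
    unfolding fourier_lborel[OF m] integral_mult_right_zero[symmetric]
    by (intro Bochner_Integration.integral_cong refl)
       (simp add: inner_diff_left right_diff_distrib exp_diff exp_minus field_simps)
  also have "\<dots> = \<bar>c\<bar> ^ CARD('n) *\<^sub>R (LINT t|lborel. exp (- \<i> * of_real (t \<bullet> \<zeta>)) * f (x + c *\<^sub>R t))"
    using c by (subst integral_lborel_affine[OF i c, of x]) simp
  also have "\<dots> = \<bar>c\<bar> ^ CARD('n) *\<^sub>R fourier (\<lambda>t. f (x + c *\<^sub>R t)) \<zeta>"
    by (simp add: fourier_lborel)
  finally show ?thesis
    using c by (simp add: scaleR_conv_of_real[where 'a=complex])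
qed

lemma fourier_cnj:
  assumes "f \<in> borel_measurable borel"
  shows "fourier (\<lambda>t. cnj (f t)) \<zeta> = cnj (fourier f (- \<zeta>))"
proof -
  have [measurable]: "f \<in> borel_measurable borel" by fact
  have "fourier (\<lambda>t. cnj (f t)) \<zeta> = (LINT t|lborel. cnj (exp (- \<i> * of_real (t \<bullet> - \<zeta>)) * f t))"
    by (simp add: fourier_lborel exp_cnj)
  also have "\<dots> = cnj (fourier f (- \<zeta>))"
    unfolding fourier_lborel[OF assms] by (rule Bochner_Integration.integral_cnj)
  finally show ?thesis .
qed

text \<open>Integrability is not assumed: if the integrand is not integrable, the Bochner integral
  is 0 by convention and the bound is trivial.\<close>

lemma norm_fourier_le:
  assumes "f \<in> borel_measurable borel"
  shows "ennreal (norm (fourier f \<xi>)) \<le> (\<integral>\<^sup>+t. ennreal (norm (f t)) \<partial>lborel)"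
proof (cases "integrable lborel (\<lambda>t. exp (- \<i> * of_real (t \<bullet> \<xi>)) * f t)")
  case True
  from integral_norm_bound_ennreal[OF this] show ?thesis
    by (simp add: fourier_lborel[OF assms] norm_mult)
next
  case False
  then have "fourier f \<xi> = 0"
    by (simp add: fourier_lborel[OF assms] not_integrable_integral_eq)
  then show ?thesis by simp
qed

lemma Wig_eq_fourier: "Wig \<tau> f (x, \<xi>) = fourier (\<lambda>t. f (x + \<tau> *\<^sub>R t) * cnj (f (x - (1 - \<tau>) *\<^sub>R t))) \<xi>"
  by (simp add: Wig_def fourier_def mult.assoc)

lemma Wig_measurable [measurable]:
  fixes f :: "real^'n::finite \<Rightarrow> complex"
  assumes [measurable]: "f \<in> borel_measurable borel"
  shows "Wig \<tau> f \<in> borel_measurable borel"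
proof -
  have "(\<lambda>z. LINT t|lborel. exp (- \<i> * of_real (t \<bullet> snd z)) * (f (fst z + \<tau> *\<^sub>R t) * cnj (f (fst z - (1 - \<tau>) *\<^sub>R t))))
      \<in> borel_measurable (borel \<Otimes>\<^sub>M borel)"
    by measurable
  also have "(\<lambda>z. LINT t|lborel. exp (- \<i> * of_real (t \<bullet> snd z)) * (f (fst z + \<tau> *\<^sub>R t) * cnj (f (fst z - (1 - \<tau>) *\<^sub>R t)))) = Wig \<tau> f"
    by (auto simp: Wig_eq_fourier fourier_lborel fun_eq_iff)
  finally show ?thesis by (simp add: borel_prod)
qed

section \<open>Pointwise bounds for the Wigner transform in time and in frequency\<close>

lemma nn_integral_cong_affine:
  fixes f :: "'a::euclidean_space \<Rightarrow> ennreal"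
  assumes "f \<in> borel_measurable borel" "c \<noteq> 0" "\<And>x. f (t + c *\<^sub>R x) = g x"
  shows "(\<integral>\<^sup>+x. g x \<partial>lborel) = ennreal (1 / \<bar>c\<bar> ^ DIM('a)) * (\<integral>\<^sup>+x. f x \<partial>lborel)"
  using assms(2)
  by (simp add: nn_integral_lborel_affine[OF assms(1,2), of t] assms(3) mult.assoc[symmetric] ennreal_mult[symmetric])

text \<open>Taking the modulus inside and substituting \<open>u = x + \<tau> *\<^sub>R t\<close>
  turns the other argument into a \<open>v\<close> with
  \<open>x = (1 - \<tau>) *\<^sub>R u + \<tau> *\<^sub>R v\<close>, a convex combination.\<close>

lemma Wig_bound_time:
  fixes f :: "real^'n::finite \<Rightarrow> complex"
  assumes [measurable]: "f \<in> borel_measurable borel" and \<tau>: "0 < \<tau>" "\<tau> < 1"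
  shows "ennreal (norm (Wig \<tau> f (x, \<xi>))) \<le> ennreal (1 / \<tau> ^ CARD('n)) *
     (\<integral>\<^sup>+u. ennreal (norm (f u) * norm (f ((1 / \<tau>) *\<^sub>R x - ((1 - \<tau>) / \<tau>) *\<^sub>R u))) \<partial>lborel)"
proof -
  have "ennreal (norm (Wig \<tau> f (x, \<xi>))) \<le> (\<integral>\<^sup>+t. ennreal (norm (f (x + \<tau> *\<^sub>R t) * cnj (f (x - (1 - \<tau>) *\<^sub>R t)))) \<partial>lborel)"
    unfolding Wig_eq_fourier by (rule norm_fourier_le) measurable
  also have "\<dots> = ennreal (1 / \<bar>\<tau>\<bar> ^ DIM(real^'n)) *
     (\<integral>\<^sup>+u. ennreal (norm (f u) * norm (f ((1 / \<tau>) *\<^sub>R x - ((1 - \<tau>) / \<tau>) *\<^sub>R u))) \<partial>lborel)"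
  proof (rule nn_integral_cong_affine[where t = x])
    fix t
    have "(1 / \<tau>) *\<^sub>R x - ((1 - \<tau>) / \<tau>) *\<^sub>R (x + \<tau> *\<^sub>R t) = x - (1 - \<tau>) *\<^sub>R t"
      using \<tau> by (simp add: vec_eq_iff field_simps)
    then show "ennreal (norm (f (x + \<tau> *\<^sub>R t)) * norm (f ((1 / \<tau>) *\<^sub>R x - ((1 - \<tau>) / \<tau>) *\<^sub>R (x + \<tau> *\<^sub>R t)))) =
        ennreal (norm (f (x + \<tau> *\<^sub>R t) * cnj (f (x - (1 - \<tau>) *\<^sub>R t))))"
      by (simp only: norm_mult complex_mod_cnj)
  qed (use \<tau> in auto)
  finally show ?thesis using \<tau> by simp
qed

lemma fourier_mult_bound:
  fixes A G :: "real^'n::finite \<Rightarrow> complex"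
  assumes "integrable lborel A" "integrable lborel G" "continuous_on UNIV G" "\<And>x. norm (G x) \<le> B"
    "integrable lborel (fourier G)"
  shows "ennreal (norm (fourier (\<lambda>t. A t * G t) \<xi>)) \<le> ennreal (1 / (2 * pi) ^ CARD('n)) *
    (\<integral>\<^sup>+\<eta>. ennreal (norm (fourier A (\<xi> - \<eta>)) * norm (fourier G \<eta>)) \<partial>lborel)"
proof -
  note [measurable] = borel_measurable_integrable[OF assms(1), simplified] borel_measurable_integrable[OF assms(2), simplified]
  have "integrable lborel (\<lambda>\<eta>. fourier G \<eta> * fourier A (\<xi> - \<eta>))"
  proof (rule Bochner_Integration.integrable_bound)
    show "integrable lborel (\<lambda>\<eta>. norm (fourier G \<eta>) * (LINT t|lborel. norm (A t)))"
      using assms(5) by simp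
    have "norm (fourier A \<zeta>) \<le> (LINT t|lborel. norm (A t))" for \<zeta>
      using integral_norm_bound[of lborel "\<lambda>t. exp (- \<i> * of_real (t \<bullet> \<zeta>)) * A t"]
      by (simp add: fourier_lborel norm_mult)
    then show "AE \<eta> in lborel. norm (fourier G \<eta> * fourier A (\<xi> - \<eta>)) \<le> norm (norm (fourier G \<eta>) * (LINT t|lborel. norm (A t)))"
      by (intro AE_I2) (auto simp: norm_mult intro!: mult_left_mono order_trans[OF _ abs_ge_self])
  qed measurable
  then have "ennreal (norm (LINT \<eta>|lborel. fourier G \<eta> * fourier A (\<xi> - \<eta>))) \<le>
     (\<integral>\<^sup>+\<eta>. ennreal (norm (fourier G \<eta> * fourier A (\<xi> - \<eta>))) \<partial>lborel)"
    by (rule integral_norm_bound_ennreal)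
  then have *: "ennreal (norm ((2 * pi) ^ CARD('n) * fourier (\<lambda>t. A t * G t) \<xi>)) \<le>
     (\<integral>\<^sup>+\<eta>. ennreal (norm (fourier A (\<xi> - \<eta>)) * norm (fourier G \<eta>)) \<partial>lborel)"
    unfolding fourier_mult[OF assms, symmetric] by (simp add: norm_mult mult.commute)
  have "norm (fourier (\<lambda>t. A t * G t) \<xi>) =
     1 / (2 * pi) ^ CARD('n) * norm ((2 * pi) ^ CARD('n) * fourier (\<lambda>t. A t * G t) \<xi>)"
    by (simp add: norm_mult norm_power)
  then have "ennreal (norm (fourier (\<lambda>t. A t * G t) \<xi>)) =
     ennreal (1 / (2 * pi) ^ CARD('n)) * ennreal (norm ((2 * pi) ^ CARD('n) * fourier (\<lambda>t. A t * G t) \<xi>))"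
    by (simp add: ennreal_mult[symmetric])
  also have "\<dots> \<le> ennreal (1 / (2 * pi) ^ CARD('n)) *
    (\<integral>\<^sup>+\<eta>. ennreal (norm (fourier A (\<xi> - \<eta>)) * norm (fourier G \<eta>)) \<partial>lborel)"
    by (rule mult_left_mono[OF *]) simp
  finally show ?thesis .
qed

lemma Rihaczek_apply: "Rihaczek f (x, \<xi>) = exp (- (\<i> * of_real (x \<bullet> \<xi>))) * f x * cnj (fourier f \<xi>)"
  by (simp add: Rihaczek_def)

lemma norm_Rihaczek: "norm (Rihaczek f (x, \<xi>)) = norm (f x) * norm (fourier f \<xi>)"
  by (simp add: Rihaczek_apply norm_mult)

text \<open>The Jacobians of the two blocks are \<open>c ^ DIM('a)\<close> and its reciprocal and
  cancel; reflections and translations leave the integral unchanged.\<close>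

lemma nn_integral_dilate_pair:
  fixes F :: "'a::euclidean_space \<times> 'a \<Rightarrow> ennreal"
  assumes [measurable]: "F \<in> borel_measurable borel" and c: "0 < c"
  shows "(\<integral>\<^sup>+w. F (x - c *\<^sub>R fst w, y - (1 / c) *\<^sub>R snd w) \<partial>lborel) = (\<integral>\<^sup>+w. F w \<partial>lborel)"
proof -
  have F: "F \<in> borel_measurable (borel \<Otimes>\<^sub>M borel)" using assms by (simp add: borel_prod)
  note [measurable] = F
  have m: "(\<lambda>w. F (x - c *\<^sub>R fst w, y - (1 / c) *\<^sub>R snd w)) \<in> borel_measurable borel"
    unfolding borel_prod[symmetric] by measurable
  have "(\<integral>\<^sup>+w. F (x - c *\<^sub>R fst w, y - (1 / c) *\<^sub>R snd w) \<partial>lborel) =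
    (\<integral>\<^sup>+u. \<integral>\<^sup>+v. F (x - c *\<^sub>R u, y - (1 / c) *\<^sub>R v) \<partial>lborel \<partial>lborel)"
    by (subst nn_integral_lborel_pair[OF m]) simp
  also have "\<dots> = (\<integral>\<^sup>+u. ennreal (c ^ DIM('a)) * (\<integral>\<^sup>+v. F (x - c *\<^sub>R u, v) \<partial>lborel) \<partial>lborel)"
  proof (rule nn_integral_cong)
    fix u
    have "(\<integral>\<^sup>+v. F (x - c *\<^sub>R u, y - (1 / c) *\<^sub>R v) \<partial>lborel) =
       ennreal (1 / \<bar>- 1 / c\<bar> ^ DIM('a)) * (\<integral>\<^sup>+v. F (x - c *\<^sub>R u, v) \<partial>lborel)"
      using c by (intro nn_integral_cong_affine[where t = y]) auto
    then show "(\<integral>\<^sup>+v. F (x - c *\<^sub>R u, y - (1 / c) *\<^sub>R v) \<partial>lborel) =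
       ennreal (c ^ DIM('a)) * (\<integral>\<^sup>+v. F (x - c *\<^sub>R u, v) \<partial>lborel)"
      using c by (simp add: power_divide)
  qed
  also have "\<dots> = ennreal (c ^ DIM('a)) * (\<integral>\<^sup>+u. \<integral>\<^sup>+v. F (x - c *\<^sub>R u, v) \<partial>lborel \<partial>lborel)"
    by (rule nn_integral_cmult) measurable
  also have "(\<integral>\<^sup>+u. \<integral>\<^sup>+v. F (x - c *\<^sub>R u, v) \<partial>lborel \<partial>lborel) =
      ennreal (1 / \<bar>- c\<bar> ^ DIM('a)) * (\<integral>\<^sup>+u. \<integral>\<^sup>+v. F (u, v) \<partial>lborel \<partial>lborel)"
    using c by (intro nn_integral_cong_affine[where t = x]) auto
  also have "(\<integral>\<^sup>+u. \<integral>\<^sup>+v. F (u, v) \<partial>lborel \<partial>lborel) = (\<integral>\<^sup>+w. F w \<partial>lborel)"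
    by (rule nn_integral_lborel_pair[symmetric]) fact
  finally show ?thesis
    using c by (simp add: mult.assoc[symmetric] ennreal_mult[symmetric])
qed

text \<open>For finite \<open>q\<close> this is the change of variables above. For
  \<open>q = \<infinity>\<close> continuity takes its place: the essential supremum bounds every
  value of \<open>R\<close>, in particular those at the transformed points.\<close>

lemma Lp_norm_dilate_pair_le:
  fixes R :: "'a::euclidean_space \<times> 'a \<Rightarrow> complex"
  assumes R: "continuous_on UNIV R" and c: "0 < c" and q: "1 \<le> q"
  shows "Lp_norm q (\<lambda>w. R (x - c *\<^sub>R fst w, y - (1 / c) *\<^sub>R snd w)) \<le> Lp_norm q R"
proof (cases "q = \<infinity>")
  case True
  have "continuous_on UNIV (\<lambda>w. R (x - c *\<^sub>R fst w, y - (1 / c) *\<^sub>R snd w))"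
    by (intro continuous_on_compose2[OF R] continuous_intros) auto
  then show ?thesis
    unfolding True using norm_le_Lp_norm_inf[OF R]
    by (intro Lp_norm_inf_le AE_I2 borel_measurable_continuous_onI) auto
next
  case False
  with q obtain r where r: "q = ennreal r" "1 \<le> r" by (cases q) auto
  have "(\<lambda>w. ennreal (norm (R w) powr r)) \<in> borel_measurable borel"
    using borel_measurable_continuous_onI[OF R] by measurable
  from nn_integral_dilate_pair[OF this c] show ?thesis
    using r by (simp add: Lp_norm_real)
qed

context weight
begin

lemma test_functionD:
  assumes "test_function f"
  shows "f \<in> borel_measurable borel" "continuous_on UNIV f" "rapid f" "integrable lborel f"
    "fourier f \<in> borel_measurable borel" "continuous_on UNIV (fourier f)" "rapid (fourier f)" "integrable lborel (fourier f)"
  using assms unfolding test_function_def by (auto dest: rapid_measurable rapid_integrable)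

text \<open>The integrand of \<open>Wig\<close> is a product, so its Fourier transform is a
  convolution of the transforms of the factors. Up to phases and conjugation, which the modulus
  removes, these are dilates of \<open>fourier f\<close> by \<open>1 / \<tau>\<close> and
  \<open>1 / (1 - \<tau>)\<close>.\<close>

lemma Wig_bound_frequency:
  fixes f :: "real^'n::finite \<Rightarrow> complex"
  assumes f: "test_function f" and \<tau>: "0 < \<tau>" "\<tau> < 1"
  shows "ennreal (norm (Wig \<tau> f (x, \<xi>))) \<le> ennreal (1 / ((2 * pi) ^ CARD('n) * (1 - \<tau>) ^ CARD('n))) *
     (\<integral>\<^sup>+\<eta>. ennreal (norm (fourier f \<eta>) * norm (fourier f ((1 / (1 - \<tau>)) *\<^sub>R \<xi> - (\<tau> / (1 - \<tau>)) *\<^sub>R \<eta>))) \<partial>lborel)"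
proof -
  note [measurable] = test_functionD(1,5)[OF f]
  let ?A = "\<lambda>t. f (x + \<tau> *\<^sub>R t)" and ?G = "\<lambda>t. cnj (f (x - (1 - \<tau>) *\<^sub>R t))"
  let ?H = "\<lambda>t. f (x + (- (1 - \<tau>)) *\<^sub>R t)"
  have G0: "?G = (\<lambda>t. cnj (?H t))" by (simp add: algebra_simps)
  have intA: "integrable lborel ?A"
    using \<tau> by (intro integrable_lborel_affine test_functionD(4)[OF f]) auto
  have intG: "integrable lborel ?G"
    unfolding G0 using \<tau> by (intro integrable_cnj integrable_lborel_affine test_functionD(4)[OF f]) auto
  have contG: "continuous_on UNIV ?G"
    by (intro continuous_intros continuous_on_compose2[OF test_functionD(2)[OF f]]) auto
  obtain B where B: "\<And>x. norm (f x) \<le> B" using rapid_bounded[OF test_functionD(3)[OF f]] by blast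
  have fG: "fourier ?G \<eta> = cnj (phase x ((1 / (1 - \<tau>)) *\<^sub>R \<eta>)) * cnj (fourier f (0 + (1 / (1 - \<tau>)) *\<^sub>R \<eta>)) / (1 - \<tau>) ^ CARD('n)" for \<eta>
  proof -
    have "fourier ?G \<eta> = cnj (fourier ?H (- \<eta>))"
      unfolding G0 by (rule fourier_cnj) measurable
    also have "fourier ?H (- \<eta>) = phase x ((1 / - (1 - \<tau>)) *\<^sub>R - \<eta>) * fourier f ((1 / - (1 - \<tau>)) *\<^sub>R - \<eta>) / \<bar>- (1 - \<tau>)\<bar> ^ CARD('n)"
      using \<tau> by (intro fourier_affine test_functionD(4)[OF f]) auto
    also have "(1 / - (1 - \<tau>)) *\<^sub>R - \<eta> = (1 / (1 - \<tau>)) *\<^sub>R \<eta>"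
      using \<tau> by (simp add: vec_eq_iff field_simps)
    finally show ?thesis using \<tau> by simp
  qed
  have "integrable lborel (\<lambda>\<eta>. cnj (phase x ((1 / (1 - \<tau>)) *\<^sub>R \<eta>)) * cnj (fourier f (0 + (1 / (1 - \<tau>)) *\<^sub>R \<eta>)))"
  proof (rule integrable_phase_mult)
    show "integrable lborel (\<lambda>\<eta>. cnj (fourier f (0 + (1 / (1 - \<tau>)) *\<^sub>R \<eta>)))"
      using \<tau> by (intro integrable_cnj integrable_lborel_affine test_functionD(8)[OF f]) auto
  qed auto
  then have intfG: "integrable lborel (fourier ?G)"
    unfolding fG by (rule integrable_divide_zero)
  have nG: "norm (fourier ?G \<eta>) = norm (fourier f ((1 / (1 - \<tau>)) *\<^sub>R \<eta>)) / (1 - \<tau>) ^ CARD('n)" for \<eta>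
  proof -
    have "norm (1 - complex_of_real \<tau>) = 1 - \<tau>"
      using \<tau> by (metis abs_of_pos diff_gt_0_iff_gt norm_of_real of_real_1 of_real_diff)
    then show ?thesis by (simp add: fG norm_mult norm_divide norm_power)
  qed
  have nA: "norm (fourier ?A \<eta>) = norm (fourier f ((1 / \<tau>) *\<^sub>R \<eta>)) / \<tau> ^ CARD('n)" for \<eta>
    using \<tau> by (subst fourier_affine[OF test_functionD(4)[OF f]]) (auto simp: norm_mult norm_divide norm_power)
  let ?c = "1 / (\<tau> ^ CARD('n) * (1 - \<tau>) ^ CARD('n))"
  have c: "0 \<le> ?c" using \<tau> by simp
  have "ennreal (norm (Wig \<tau> f (x, \<xi>))) \<le> ennreal (1 / (2 * pi) ^ CARD('n)) *
    (\<integral>\<^sup>+\<eta>. ennreal (norm (fourier ?A (\<xi> - \<eta>)) * norm (fourier ?G \<eta>)) \<partial>lborel)"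
    unfolding Wig_eq_fourier
    by (rule fourier_mult_bound[OF intA intG contG _ intfG, of B]) (simp add: B)
  also have "(\<integral>\<^sup>+\<eta>. ennreal (norm (fourier ?A (\<xi> - \<eta>)) * norm (fourier ?G \<eta>)) \<partial>lborel) =
     (\<integral>\<^sup>+\<eta>. ennreal ?c * ennreal (norm (fourier f ((1 / \<tau>) *\<^sub>R (\<xi> - \<eta>))) * norm (fourier f ((1 / (1 - \<tau>)) *\<^sub>R \<eta>))) \<partial>lborel)"
    unfolding nA nG using c by (intro nn_integral_cong) (simp add: ennreal_mult[symmetric])
  also have "\<dots> = ennreal ?c *
     (\<integral>\<^sup>+\<eta>. ennreal (norm (fourier f ((1 / \<tau>) *\<^sub>R (\<xi> - \<eta>))) * norm (fourier f ((1 / (1 - \<tau>)) *\<^sub>R \<eta>))) \<partial>lborel)"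
    by (rule nn_integral_cmult) measurable
  \<comment> \<open>Replacing \<open>\<eta>\<close> by
    \<open>\<xi> - \<tau> *\<^sub>R \<eta>\<close> cancels \<open>\<tau> ^ CARD('n)\<close> and
    leaves the coefficient \<open>\<tau> / (1 - \<tau>)\<close>, the reciprocal of the one in
    \<open>Wig_bound_time\<close>. This is what makes the combined map on phase space volume
    preserving.\<close>
  also have "(\<integral>\<^sup>+\<eta>. ennreal (norm (fourier f ((1 / \<tau>) *\<^sub>R (\<xi> - \<eta>))) * norm (fourier f ((1 / (1 - \<tau>)) *\<^sub>R \<eta>))) \<partial>lborel) =
     ennreal (\<bar>- \<tau>\<bar> ^ DIM(real^'n)) *
     (\<integral>\<^sup>+\<eta>. ennreal (norm (fourier f ((1 / \<tau>) *\<^sub>R (\<xi> - (\<xi> + (- \<tau>) *\<^sub>R \<eta>)))) * norm (fourier f ((1 / (1 - \<tau>)) *\<^sub>R (\<xi> + (- \<tau>) *\<^sub>R \<eta>)))) \<partial>lborel)"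
    using \<tau> by (intro nn_integral_lborel_affine) auto
  also have "(\<lambda>\<eta>. (1 / \<tau>) *\<^sub>R (\<xi> - (\<xi> + (- \<tau>) *\<^sub>R \<eta>))) = (\<lambda>\<eta>. \<eta>)"
    using \<tau> by (simp add: vec_eq_iff fun_eq_iff)
  also have "(\<lambda>\<eta>. (1 / (1 - \<tau>)) *\<^sub>R (\<xi> + (- \<tau>) *\<^sub>R \<eta>)) = (\<lambda>\<eta>. (1 / (1 - \<tau>)) *\<^sub>R \<xi> - (\<tau> / (1 - \<tau>)) *\<^sub>R \<eta>)"
    by (simp add: algebra_simps)
  finally have "ennreal (norm (Wig \<tau> f (x, \<xi>))) \<le> ennreal (1 / (2 * pi) ^ CARD('n)) * (ennreal ?c * (ennreal (\<bar>- \<tau>\<bar> ^ DIM(real^'n)) *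
     (\<integral>\<^sup>+\<eta>. ennreal (norm (fourier f \<eta>) * norm (fourier f ((1 / (1 - \<tau>)) *\<^sub>R \<xi> - (\<tau> / (1 - \<tau>)) *\<^sub>R \<eta>))) \<partial>lborel)))" .
  also have "ennreal (1 / (2 * pi) ^ CARD('n)) * (ennreal ?c * (ennreal (\<bar>- \<tau>\<bar> ^ DIM(real^'n)) * I)) =
     ennreal (1 / ((2 * pi) ^ CARD('n) * (1 - \<tau>) ^ CARD('n))) * I" for I
    using \<tau> by (simp add: mult.assoc[symmetric] ennreal_mult[symmetric])
  finally show ?thesis .
qed

lemma continuous_Rihaczek:
  assumes "test_function f"
  shows "continuous_on UNIV (Rihaczek f)"
proof -
  have "Rihaczek f = (\<lambda>z. exp (- (\<i> * of_real (fst z \<bullet> snd z))) * f (fst z) * cnj (fourier f (snd z)))"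
    by (auto simp: Rihaczek_apply)
  moreover have "continuous_on UNIV \<dots>"
    by (intro continuous_intros continuous_on_compose2[OF test_functionD(2)[OF assms]]
          continuous_on_compose2[OF test_functionD(6)[OF assms]]) auto
  ultimately show ?thesis by simp
qed

text \<open>Decay of the two factors at rate \<open>m * K\<close> pays for the \<open>K\<close> lost
  when \<open>omega_norm_add\<close> splits the weight at \<open>(x, \<xi>)\<close>.\<close>

lemma rapid_Rihaczek:
  fixes f :: "real^'n::finite \<Rightarrow> complex"
  assumes f: "test_function f"
  shows "rapid (Rihaczek f)"
proof (rule rapidI)
  show "Rihaczek f \<in> borel_measurable borel"
    by (rule borel_measurable_continuous_onI[OF continuous_Rihaczek[OF f]])
  fix m :: real assume m: "0 < m"
  obtain C1 where C1: "0 \<le> C1" "\<And>z. norm (f z) \<le> C1 * exp (- (m * K) * \<omega> (norm z))"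
    using rapidE[OF test_functionD(3)[OF f], of "m * K"] by blast
  obtain C2 where C2: "0 \<le> C2" "\<And>z. norm (fourier f z) \<le> C2 * exp (- (m * K) * \<omega> (norm z))"
    using rapidE[OF test_functionD(7)[OF f], of "m * K"] by blast
  have "exp (m * \<omega> (norm z)) * norm (Rihaczek f z) \<le> exp (m * K) * C1 * C2" for z
  proof -
    obtain x \<xi> where z: "z = (x, \<xi>)" by (cases z)
    have "m * \<omega> (norm z) \<le> m * (K * (1 + \<omega> (norm x) + \<omega> (norm \<xi>)))"
      unfolding z using m by (intro mult_left_mono omega_norm_add norm_Pair_le) auto
    then have "exp (m * \<omega> (norm z)) \<le> exp (m * K + m * K * \<omega> (norm x) + m * K * \<omega> (norm \<xi>))"
      by (simp add: algebra_simps)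
    then have "exp (m * \<omega> (norm z)) * (norm (f x) * norm (fourier f \<xi>)) \<le>
       exp (m * K + m * K * \<omega> (norm x) + m * K * \<omega> (norm \<xi>)) *
       (C1 * exp (- (m * K) * \<omega> (norm x)) * (C2 * exp (- (m * K) * \<omega> (norm \<xi>))))"
      using C1 C2 by (intro mult_mono) auto
    also have "\<dots> = exp (m * K) * C1 * C2"
      by (simp add: exp_add exp_minus field_simps)
    finally show ?thesis unfolding z norm_Rihaczek .
  qed
  then show "\<exists>C. \<forall>z. exp (m * \<omega> (norm z)) * norm (Rihaczek f z) \<le> C" by blast
qed

text \<open>Bounding one factor \<open>norm (Wig \<tau> f z)\<close> in time and the other in
  frequency gives an integral over phase space to which Hoelder applies. The constants
  \<open>1 / \<tau> ^ N\<close> and \<open>1 / ((2 * pi) ^ N * (1 - \<tau>) ^ N)\<close> multiply to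
  the reciprocal of the denominator of \<open>D3\<close>, because
  \<open>\<tau> - \<tau>\<^sup>2 = \<tau> * (1 - \<tau>)\<close>.\<close>

lemma Wig_square_bound:
  fixes f :: "real^'n::finite \<Rightarrow> complex"
  assumes f: "test_function f" and \<tau>: "0 < \<tau>" "\<tau> < 1" and lam: "0 \<le> lam" and p: "1 \<le> p"
  shows "ennreal ((exp (lam * \<omega> (norm z)) * norm (Wig \<tau> f z))\<^sup>2) \<le> ennreal (D3 CARD('n) K \<tau> lam) *
    (Lp_norm p (weighted \<omega> (4 * K\<^sup>2 * lam) (Rihaczek f)) * Lp_norm (conj_exp p) (weighted \<omega> (4 * K\<^sup>2 * lam) (Rihaczek f)))"
proof -
  obtain x \<xi> where z: "z = (x, \<xi>)" by (cases z)
  define c where "c = (1 - \<tau>) / \<tau>"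
  have c: "0 < c" "1 / c = \<tau> / (1 - \<tau>)" using \<tau> by (auto simp: c_def)
  define S where "S w = ((1 / \<tau>) *\<^sub>R x - c *\<^sub>R fst w, (1 / (1 - \<tau>)) *\<^sub>R \<xi> - (1 / c) *\<^sub>R snd w)" for w
  define R where "R = weighted \<omega> (4 * K\<^sup>2 * lam) (Rihaczek f)"
  have contR: "continuous_on UNIV R"
    unfolding R_def by (intro continuous_on_weighted continuous_Rihaczek f)
  note [measurable] = test_functionD(1,5)[OF f]
  let ?k1 = "\<lambda>u. ennreal (norm (f u) * norm (f ((1 / \<tau>) *\<^sub>R x - c *\<^sub>R u)))"
  let ?k2 = "\<lambda>\<eta>. ennreal (norm (fourier f \<eta>) * norm (fourier f ((1 / (1 - \<tau>)) *\<^sub>R \<xi> - (1 / c) *\<^sub>R \<eta>)))"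
  let ?c1 = "1 / \<tau> ^ CARD('n)" and ?c2 = "1 / ((2 * pi) ^ CARD('n) * (1 - \<tau>) ^ CARD('n))"
  let ?e = "exp (2 * lam * \<omega> (norm z))"
  have time: "ennreal (norm (Wig \<tau> f z)) \<le> ennreal ?c1 * (\<integral>\<^sup>+u. ?k1 u \<partial>lborel)"
    using Wig_bound_time[OF test_functionD(1)[OF f] \<tau>] by (simp add: z c_def)
  have freq: "ennreal (norm (Wig \<tau> f z)) \<le> ennreal ?c2 * (\<integral>\<^sup>+\<eta>. ?k2 \<eta> \<partial>lborel)"
    using Wig_bound_frequency[OF f \<tau>] by (simp add: z c)
  have cc: "0 \<le> ?c1" "0 \<le> ?c2" using \<tau> by auto
  have "ennreal ((exp (lam * \<omega> (norm z)) * norm (Wig \<tau> f z))\<^sup>2) =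
     ennreal ?e * (ennreal (norm (Wig \<tau> f z)) * ennreal (norm (Wig \<tau> f z)))"
    by (simp add: ennreal_mult[symmetric] power_mult_distrib power2_eq_square exp_add[symmetric])
  also have "\<dots> \<le> ennreal ?e * (ennreal ?c1 * (\<integral>\<^sup>+u. ?k1 u \<partial>lborel) * (ennreal ?c2 * (\<integral>\<^sup>+\<eta>. ?k2 \<eta> \<partial>lborel)))"
    by (intro mult_mono time freq) auto
  also have "\<dots> = ennreal (?c1 * ?c2) * (ennreal ?e * ((\<integral>\<^sup>+u. ?k1 u \<partial>lborel) * (\<integral>\<^sup>+\<eta>. ?k2 \<eta> \<partial>lborel)))"
    unfolding ennreal_mult[OF cc] by (simp only: mult_ac)
  also have "ennreal ?e * ((\<integral>\<^sup>+u. ?k1 u \<partial>lborel) * (\<integral>\<^sup>+\<eta>. ?k2 \<eta> \<partial>lborel)) =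
     (\<integral>\<^sup>+w. ennreal ?e * (?k1 (fst w) * ?k2 (snd w)) \<partial>lborel)"
  proof -
    have "(\<lambda>w. ennreal ?e * (?k1 (fst w) * ?k2 (snd w))) \<in> borel_measurable (borel \<Otimes>\<^sub>M borel)" by measurable
    then show ?thesis
      by (subst nn_integral_lborel_pair) (simp_all add: borel_prod nn_integral_cmult nn_integral_multc)
  qed
  also have "\<dots> \<le> (\<integral>\<^sup>+w. ennreal (exp (2 * lam * K)) * (ennreal (norm (R w)) * ennreal (norm (R (S w)))) \<partial>lborel)"
  proof (rule nn_integral_mono)
    fix w :: "(real^'n) \<times> (real^'n)"
    obtain u \<eta> where w: "w = (u, \<eta>)" by (cases w)
    obtain v \<zeta> where v: "S w = (v, \<zeta>)" by (cases "S w")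
    have v1: "v = (1 / \<tau>) *\<^sub>R x - c *\<^sub>R u" "\<zeta> = (1 / (1 - \<tau>)) *\<^sub>R \<xi> - (1 / c) *\<^sub>R \<eta>"
      using v by (auto simp: S_def w)
    \<comment> \<open>Both \<open>x\<close> and \<open>\<xi>\<close> are convex combinations of
      vectors of norm at most \<open>M\<close>, so \<open>norm z \<le> 2 * M\<close> and a single
      use of the doubling condition suffices.\<close>
    define M where "M = max (norm w) (norm (S w))"
    have "norm w \<le> M" "norm (S w) \<le> M" by (auto simp: M_def)
    then have le_M: "norm u \<le> M" "norm \<eta> \<le> M" "norm v \<le> M" "norm \<zeta> \<le> M"
      unfolding v unfolding w by (blast intro: order_trans norm_fst_le norm_snd_le)+
    have "x = (1 - \<tau>) *\<^sub>R u + \<tau> *\<^sub>R v"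
      using \<tau> by (simp add: v1 c_def scaleR_diff_right)
    then have "norm x \<le> (1 - \<tau>) * norm u + \<tau> * norm v"
      using \<tau> norm_triangle_ineq[of "(1 - \<tau>) *\<^sub>R u" "\<tau> *\<^sub>R v"] by simp
    also have "\<dots> \<le> (1 - \<tau>) * M + \<tau> * M"
      using \<tau> le_M by (intro add_mono mult_left_mono) auto
    finally have x: "norm x \<le> M" by (simp add: algebra_simps)
    have "\<xi> = \<tau> *\<^sub>R \<eta> + (1 - \<tau>) *\<^sub>R \<zeta>"
      using \<tau> by (simp add: v1 c scaleR_diff_right)
    then have "norm \<xi> \<le> \<tau> * norm \<eta> + (1 - \<tau>) * norm \<zeta>"
      using \<tau> norm_triangle_ineq[of "\<tau> *\<^sub>R \<eta>" "(1 - \<tau>) *\<^sub>R \<zeta>"] by simp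
    also have "\<dots> \<le> \<tau> * M + (1 - \<tau>) * M"
      using \<tau> le_M by (intro add_mono mult_left_mono) auto
    finally have \<xi>: "norm \<xi> \<le> M" by (simp add: algebra_simps)
    have "\<omega> (norm z) \<le> K * (1 + \<omega> M)"
      using x \<xi> norm_Pair_le[of x \<xi>] norm_ge_zero[of x] unfolding z by (intro omega_double norm_ge_zero) linarith+
    also have "\<dots> \<le> K * (1 + (\<omega> (norm w) + \<omega> (norm (S w))))"
      using K_ge_1 omega_nonneg[of w] omega_nonneg[of "S w"]
      by (intro mult_left_mono) (auto simp: M_def max_def)
    finally have "2 * lam * \<omega> (norm z) \<le> 2 * lam * (K * (1 + (\<omega> (norm w) + \<omega> (norm (S w)))))"
      using lam by (intro mult_left_mono) auto
    also have "\<dots> = 2 * lam * K + 2 * K * lam * (\<omega> (norm w) + \<omega> (norm (S w)))"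
      by (simp add: algebra_simps)
    also have "\<dots> \<le> 2 * lam * K + 4 * K\<^sup>2 * lam * (\<omega> (norm w) + \<omega> (norm (S w)))"
    proof -
      \<comment> \<open>The estimate produces the weight exponent \<open>2 * K * lam\<close>, which
        is enlarged here to the one in the statement.\<close>
      have "2 * K \<le> 4 * K\<^sup>2" using K_ge_1 by (simp add: power2_eq_square)
      then show ?thesis using lam by (intro add_left_mono mult_right_mono) auto
    qed
    finally have "?e \<le> exp (2 * lam * K) * (exp (4 * K\<^sup>2 * lam * \<omega> (norm w)) * exp (4 * K\<^sup>2 * lam * \<omega> (norm (S w))))"
      by (simp add: exp_add[symmetric] distrib_left add.assoc)
    then have "?e * (norm (f u) * norm (f v) * (norm (fourier f \<eta>) * norm (fourier f \<zeta>))) \<le>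
       exp (2 * lam * K) * (exp (4 * K\<^sup>2 * lam * \<omega> (norm w)) * exp (4 * K\<^sup>2 * lam * \<omega> (norm (S w)))) *
       (norm (f u) * norm (f v) * (norm (fourier f \<eta>) * norm (fourier f \<zeta>)))"
      by (rule mult_right_mono) auto
    also have "\<dots> = exp (2 * lam * K) * (norm (R w) * norm (R (S w)))"
      unfolding R_def norm_weighted v unfolding w norm_Rihaczek by (simp add: mult_ac)
    finally have "ennreal (?e * (norm (f u) * norm (f v) * (norm (fourier f \<eta>) * norm (fourier f \<zeta>)))) \<le>
        ennreal (exp (2 * lam * K) * (norm (R w) * norm (R (S w))))"
      by (rule ennreal_leI)
    then show "ennreal ?e * (?k1 (fst w) * ?k2 (snd w)) \<le> ennreal (exp (2 * lam * K)) * (ennreal (norm (R w)) * ennreal (norm (R (S w))))"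
      unfolding w fst_conv snd_conv v1[symmetric] by (simp add: ennreal_mult mult.assoc)
  qed
  also have "\<dots> = ennreal (exp (2 * lam * K)) * (\<integral>\<^sup>+w. ennreal (norm (R w)) * ennreal (norm (R (S w))) \<partial>lborel)"
  proof -
    have [measurable]: "R \<in> borel_measurable borel" "(\<lambda>w. R (S w)) \<in> borel_measurable borel"
      unfolding S_def by (auto intro!: borel_measurable_continuous_onI continuous_on_compose2[OF contR] continuous_intros contR)
    show ?thesis by (rule nn_integral_cmult) measurable
  qed
  also have "(\<integral>\<^sup>+w. ennreal (norm (R w)) * ennreal (norm (R (S w))) \<partial>lborel) \<le> Lp_norm p R * Lp_norm (conj_exp p) (\<lambda>w. R (S w))"
    unfolding S_def
    by (intro Holder_inequality p) (auto intro!: borel_measurable_continuous_onI continuous_on_compose2[OF contR] continuous_intros contR)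
  also have "Lp_norm (conj_exp p) (\<lambda>w. R (S w)) \<le> Lp_norm (conj_exp p) R"
    unfolding S_def using c p by (intro Lp_norm_dilate_pair_le contR conj_exp_ge_1)
  finally have "ennreal ((exp (lam * \<omega> (norm z)) * norm (Wig \<tau> f z))\<^sup>2) \<le>
     ennreal (?c1 * ?c2) * (ennreal (exp (2 * lam * K)) * (Lp_norm p R * Lp_norm (conj_exp p) R))"
    by (simp add: mult_left_mono)
  also have "\<dots> = ennreal (?c1 * ?c2 * exp (2 * lam * K)) * (Lp_norm p R * Lp_norm (conj_exp p) R)"
    using \<tau> by (subst ennreal_mult) (auto simp: mult.assoc)
  also have "\<dots> \<le> ennreal (D3 CARD('n) K \<tau> lam) * (Lp_norm p R * Lp_norm (conj_exp p) R)"
  proof (intro mult_right_mono ennreal_leI)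
    \<comment> \<open>Likewise the constant \<open>exp (2 * lam * K)\<close> is enlarged to the
      exponential in \<open>D3\<close>.\<close>
    have "(2 * K) * lam \<le> (K * (1 + 2 * K)) * lam"
      using K_ge_1 lam by (intro mult_right_mono) (auto simp: algebra_simps)
    then have "exp (2 * lam * K) \<le> exp (K * (1 + 2 * K) * lam)"
      by (simp add: mult_ac)
    then have "?c1 * ?c2 * exp (2 * lam * K) \<le> ?c1 * ?c2 * exp (K * (1 + 2 * K) * lam)"
      using cc by (intro mult_left_mono) auto
    also have "\<dots> = D3 CARD('n) K \<tau> lam"
    proof -
      have "\<tau> - \<tau>\<^sup>2 = \<tau> * (1 - \<tau>)" by (simp add: power2_eq_square algebra_simps)
      then show ?thesis by (simp add: D3_def power_mult_distrib)
    qed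
    finally show "?c1 * ?c2 * exp (2 * lam * K) \<le> D3 CARD('n) K \<tau> lam" .
  qed simp
  finally show ?thesis unfolding R_def .
qed

text \<open>\<open>Wig_square_bound\<close> with \<open>p = 1\<close> has a right side independent
  of the point, finite because the weighted Rihaczek form is again rapidly decaying; this is
  available for every weight \<open>m\<close>.\<close>

lemma rapid_Wig:
  fixes f :: "real^'n::finite \<Rightarrow> complex"
  assumes f: "test_function f" and \<tau>: "0 < \<tau>" "\<tau> < 1"
  shows "rapid (Wig \<tau> f)"
proof (rule rapidI)
  show "Wig \<tau> f \<in> borel_measurable borel"
    using test_functionD(1)[OF f] by measurable
  fix m :: real assume m: "0 < m"
  let ?R = "weighted \<omega> (4 * K\<^sup>2 * m) (Rihaczek f)"
  have R: "rapid ?R" by (intro rapid_weighted rapid_Rihaczek f)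
  have "ennreal (D3 CARD('n) K \<tau> m) * (Lp_norm 1 ?R * Lp_norm (conj_exp 1) ?R) < \<infinity>"
    using rapid_Lp_norm_finite[OF R, of 1] rapid_Lp_norm_finite[OF R, of \<infinity>]
    by (auto simp: ennreal_mult_less_top)
  then obtain c where c: "ennreal (D3 CARD('n) K \<tau> m) * (Lp_norm 1 ?R * Lp_norm (conj_exp 1) ?R) = ennreal c" "0 \<le> c"
    by (cases "ennreal (D3 CARD('n) K \<tau> m) * (Lp_norm 1 ?R * Lp_norm (conj_exp 1) ?R)") auto
  have "exp (m * \<omega> (norm z)) * norm (Wig \<tau> f z) \<le> sqrt c" for z
    using Wig_square_bound[OF f \<tau>, of m 1 z] m c
    by (intro real_le_rsqrt) simp
  then show "\<exists>C. \<forall>z. exp (m * \<omega> (norm z)) * norm (Wig \<tau> f z) \<le> C" by blast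
qed

end

section \<open>Frequency marginal of the Wigner transform\<close>

lemma integrable_pair_convolution:
  fixes f g :: "'a::euclidean_space \<Rightarrow> complex"
  assumes f: "integrable lborel f" and g: "integrable lborel g"
    and k[measurable]: "case_prod k \<in> borel_measurable (lborel \<Otimes>\<^sub>M lborel)"
    and bound: "\<And>x y. norm (k x y) \<le> 1"
  shows "integrable (lborel \<Otimes>\<^sub>M lborel) (\<lambda>(t,y). k t y * (f t * g (t - y)))"
proof (subst integrable_iff_bounded, intro conjI)
  have [measurable]: "f \<in> borel_measurable borel" "g \<in> borel_measurable borel"
    using f g by (auto simp: integrable_iff_bounded)
  show "(\<lambda>(t,y). k t y * (f t * g (t - y))) \<in> borel_measurable (lborel \<Otimes>\<^sub>M lborel)"
    by measurable
  have "(\<integral>\<^sup>+ z. ennreal (norm (case z of (t, y) \<Rightarrow> k t y * (f t * g (t - y)))) \<partial>(lborel \<Otimes>\<^sub>M lborel)) \<le>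
        (\<integral>\<^sup>+ z. (case z of (t, y) \<Rightarrow> ennreal (norm (f t)) * ennreal (norm (g (t - y)))) \<partial>(lborel \<Otimes>\<^sub>M lborel))"
    by (intro nn_integral_mono)
       (auto simp: norm_mult ennreal_mult[symmetric] intro!: ennreal_leI mult_left_le_one_le bound)
  also have "\<dots> = (\<integral>\<^sup>+ t. \<integral>\<^sup>+ y. ennreal (norm (f t)) * ennreal (norm (g (t - y))) \<partial>lborel \<partial>lborel)"
    by (subst lborel.nn_integral_fst[symmetric]) auto
  also have "\<dots> = (\<integral>\<^sup>+ t. ennreal (norm (f t)) * (\<integral>\<^sup>+ y. ennreal (norm (g y)) \<partial>lborel) \<partial>lborel)"
    using nn_integral_lborel_reflect[of "\<lambda>y. ennreal (norm (g y))"]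
    by (intro nn_integral_cong) (simp add: nn_integral_cmult)
  also have "\<dots> = (\<integral>\<^sup>+ t. ennreal (norm (f t)) \<partial>lborel) * (\<integral>\<^sup>+ y. ennreal (norm (g y)) \<partial>lborel)"
    by (simp add: nn_integral_multc)
  also have "\<dots> < \<infinity>"
    using f g by (auto simp: integrable_iff_bounded ennreal_mult_less_top)
  finally show "(\<integral>\<^sup>+ z. ennreal (norm (case z of (t, y) \<Rightarrow> k t y * (f t * g (t - y)))) \<partial>(lborel \<Otimes>\<^sub>M lborel)) < \<infinity>" .
qed

text \<open>For fixed \<open>r\<close> the translation \<open>t = y + \<tau> *\<^sub>R r\<close>
  removes \<open>\<tau>\<close>, and then \<open>s = t - r\<close> separates the variables. Hence
  the marginal is the same for every \<open>\<tau>\<close>.\<close>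

lemma Wig_marginal:
  fixes h :: "real^'n::finite \<Rightarrow> complex"
  assumes h: "integrable lborel h"
  shows "integrable lborel (\<lambda>y. Wig \<tau> h (y, \<xi>))"
    and "(LINT y|lborel. Wig \<tau> h (y, \<xi>)) = fourier h \<xi> * cnj (fourier h \<xi>)"
proof -
  have [measurable]: "h \<in> borel_measurable borel" using h by (auto simp: integrable_iff_bounded)
  let ?e = "\<lambda>r. exp (- \<i> * of_real (r \<bullet> \<xi>))"
  let ?P = "\<lambda>y r. ?e r * (h (y + \<tau> *\<^sub>R r) * cnj (h (y - (1 - \<tau>) *\<^sub>R r)))"
  let ?Q = "\<lambda>t r. ?e r * (h t * cnj (h (t - r)))"
  have shift: "(y + \<tau> *\<^sub>R r) - r = y - (1 - \<tau>) *\<^sub>R r" for y r :: "real^'n"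
    by (simp add: algebra_simps)
  have intQ: "integrable (lborel \<Otimes>\<^sub>M lborel) (\<lambda>(t,r). ?Q t r)"
    using integrable_pair_convolution[OF h integrable_cnj[OF h], of "\<lambda>t r. ?e r"] by simp
  have intP: "integrable (lborel \<Otimes>\<^sub>M lborel) (\<lambda>(y,r). ?P y r)"
  proof (subst integrable_iff_bounded, intro conjI)
    have "(\<integral>\<^sup>+ z. ennreal (norm (case z of (y, r) \<Rightarrow> ?P y r)) \<partial>(lborel \<Otimes>\<^sub>M lborel)) =
        (\<integral>\<^sup>+ r. \<integral>\<^sup>+ y. ennreal (norm (?P y r)) \<partial>lborel \<partial>lborel)"
      by (subst lborel_pair.nn_integral_snd[symmetric]) auto
    also have "\<dots> = (\<integral>\<^sup>+ r. \<integral>\<^sup>+ t. ennreal (norm (?Q t r)) \<partial>lborel \<partial>lborel)"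
    proof (rule nn_integral_cong)
      fix r :: "real^'n"
      have "(\<integral>\<^sup>+ t. ennreal (norm (?Q (\<tau> *\<^sub>R r + t) r)) \<partial>lborel) = (\<integral>\<^sup>+ t. ennreal (norm (?Q t r)) \<partial>lborel)"
        by (rule nn_integral_lborel_translate) measurable
      then show "(\<integral>\<^sup>+ y. ennreal (norm (?P y r)) \<partial>lborel) = (\<integral>\<^sup>+ t. ennreal (norm (?Q t r)) \<partial>lborel)"
        unfolding shift[symmetric] by (simp only: add.commute)
    qed
    also have "\<dots> = (\<integral>\<^sup>+ z. ennreal (norm (case z of (t, r) \<Rightarrow> ?Q t r)) \<partial>(lborel \<Otimes>\<^sub>M lborel))"
      by (subst lborel_pair.nn_integral_snd[symmetric]) auto
    also have "\<dots> < \<infinity>" using intQ by (simp add: integrable_iff_bounded)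
    finally show "(\<integral>\<^sup>+ z. ennreal (norm (case z of (y, r) \<Rightarrow> ?P y r)) \<partial>(lborel \<Otimes>\<^sub>M lborel)) < \<infinity>" .
  qed measurable
  have W: "Wig \<tau> h (y, \<xi>) = (LINT r|lborel. ?P y r)" for y
    unfolding Wig_eq_fourier by (rule fourier_lborel) measurable
  show "integrable lborel (\<lambda>y. Wig \<tau> h (y, \<xi>))"
    unfolding W using lborel_pair.integrable_fst[OF intP] by simp
  have "(LINT y|lborel. Wig \<tau> h (y, \<xi>)) = (LINT r|lborel. LINT y|lborel. ?P y r)"
    unfolding W by (rule lborel_pair.Fubini_integral[OF intP, symmetric])
  also have "\<dots> = (LINT r|lborel. LINT t|lborel. ?Q t r)"
  proof (rule Bochner_Integration.integral_cong_AE)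
    \<comment> \<open>Only for almost every \<open>r\<close>: the translation needs integrability of
      the section of \<open>?Q\<close>, which Fubini provides almost everywhere.\<close>
    show "AE r in lborel. (LINT y|lborel. ?P y r) = (LINT t|lborel. ?Q t r)"
      using lborel_pair.AE_integrable_snd[OF intQ]
    proof eventually_elim
      case (elim r)
      from integral_lborel_affine[OF elim, of 1 "\<tau> *\<^sub>R r"]
      have "(LINT t|lborel. ?Q t r) = (LINT y|lborel. ?Q (\<tau> *\<^sub>R r + y) r)" by simp
      then show ?case
        unfolding shift[symmetric] by (simp only: add.commute)
    qed
  qed measurable
  also have "\<dots> = (LINT t|lborel. LINT r|lborel. ?Q t r)"
    by (rule lborel_pair.Fubini_integral[OF intQ])
  also have "\<dots> = (LINT t|lborel. ?e t * h t * cnj (fourier h \<xi>))"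
  proof (intro Bochner_Integration.integral_cong refl)
    fix t :: "real^'n"
    have "cnj (fourier h \<xi>) = (LINT s|lborel. cnj (?e s * h s))"
      unfolding fourier_lborel[OF \<open>h \<in> borel_measurable borel\<close>] by (rule Bochner_Integration.integral_cnj[symmetric])
    also have "\<dots> = \<bar>- 1\<bar> ^ DIM(real^'n) *\<^sub>R (LINT r|lborel. cnj (?e (t + (- 1) *\<^sub>R r) * h (t + (- 1) *\<^sub>R r)))"
      by (intro integral_lborel_affine integrable_cnj integrable_phase_mult[OF h]) auto
    finally have "cnj (fourier h \<xi>) = (LINT r|lborel. cnj (?e (t - r) * h (t - r)))"
      by simp
    then have "?e t * h t * cnj (fourier h \<xi>) = (LINT r|lborel. ?e t * h t * cnj (?e (t - r) * h (t - r)))"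
      by (simp only: integral_mult_right_zero)
    also have "\<dots> = (LINT r|lborel. ?Q t r)"
      by (intro Bochner_Integration.integral_cong refl)
         (simp add: exp_cnj inner_diff_left right_diff_distrib exp_diff exp_minus field_simps)
    finally show "(LINT r|lborel. ?Q t r) = ?e t * h t * cnj (fourier h \<xi>)" ..
  qed
  also have "\<dots> = fourier h \<xi> * cnj (fourier h \<xi>)"
    by (simp only: integral_mult_left_zero fourier_lborel[OF \<open>h \<in> borel_measurable borel\<close>])
  finally show "(LINT y|lborel. Wig \<tau> h (y, \<xi>)) = fourier h \<xi> * cnj (fourier h \<xi>)" .
qed

section \<open>The short-time Fourier transform\<close>

definition stft :: "(real^'n::finite \<Rightarrow> complex) \<Rightarrow> (real^'n \<Rightarrow> complex) \<Rightarrow> real^'n \<Rightarrow> real^'n \<Rightarrow> complex" where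
  "stft g f y \<eta> = fourier (\<lambda>t. f t * cnj (g (t - y))) \<eta>"

lemma stft_measurable:
  fixes f g :: "real^'n::finite \<Rightarrow> complex"
  assumes [measurable]: "f \<in> borel_measurable borel" "g \<in> borel_measurable borel"
  shows "(\<lambda>z. stft g f (fst z) (snd z)) \<in> borel_measurable (borel \<Otimes>\<^sub>M borel)"
proof -
  have "(\<lambda>z. LINT t|lborel. exp (- \<i> * of_real (t \<bullet> snd z)) * (f t * cnj (g (t - fst z))))
      \<in> borel_measurable (borel \<Otimes>\<^sub>M borel)"
    by measurable
  also have "(\<lambda>z. LINT t|lborel. exp (- \<i> * of_real (t \<bullet> snd z)) * (f t * cnj (g (t - fst z)))) =
      (\<lambda>z. stft g f (fst z) (snd z))"
    by (simp add: stft_def fourier_lborel)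
  finally show ?thesis .
qed

context weight
begin

lemma test_function_bounded:
  assumes "test_function f"
  obtains C where "0 \<le> C" "\<And>x. norm (f x) \<le> C"
  using rapid_bounded[OF test_functionD(3)[OF assms]] by blast

lemma integrable_mult_test:
  assumes A: "integrable lborel A" and f: "test_function f"
    and T: "T \<in> borel_measurable borel"
  shows "integrable lborel (\<lambda>t. A t * f (T t))" "integrable lborel (\<lambda>t. A t * cnj (f (T t)))"
proof -
  note [measurable] = test_functionD(1)[OF f] T borel_measurable_integrable[OF A, simplified]
  obtain C where C: "0 \<le> C" "\<And>x. norm (f x) \<le> C" using test_function_bounded[OF f] by blast
  have i: "integrable lborel (\<lambda>t. of_real C * A t)" using A by simp
  show "integrable lborel (\<lambda>t. A t * f (T t))" "integrable lborel (\<lambda>t. A t * cnj (f (T t)))"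
    using C by (auto intro!: Bochner_Integration.integrable_bound[OF i] AE_I2 mult_right_mono
        simp: norm_mult mult.commute[of "norm (A _)"])
qed

lemma test_function_reflect:
  assumes f: "test_function (f :: real^'n::finite \<Rightarrow> complex)"
  shows "test_function (\<lambda>t. f (- t))"
proof -
  have r: "rapid (\<lambda>t. F (- t))" if "rapid F" for F :: "real^'n \<Rightarrow> complex"
  proof (rule rapidI)
    show "(\<lambda>t. F (- t)) \<in> borel_measurable borel" using rapid_measurable[OF that] by measurable
    show "\<exists>C. \<forall>z. exp (m * \<omega> (norm z)) * norm (F (- z)) \<le> C" for m
      using that unfolding rapid_def by (metis norm_minus_cancel)
  qed
  have ff: "fourier (\<lambda>t. f (- t)) = (\<lambda>\<zeta>. fourier f (- \<zeta>))"
    using fourier_affine[OF test_functionD(4)[OF f], of "-1" 0] by auto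
  show ?thesis
    unfolding test_function_def ff
    by (intro conjI r test_functionD(3,7)[OF f] continuous_on_compose2[OF test_functionD(2)[OF f]]
          continuous_on_compose2[OF test_functionD(6)[OF f]] continuous_intros) auto
qed

text \<open>The weight at \<open>\<eta>\<close> is at most the weight at \<open>(x, \<eta>)\<close>.
  This makes the frequency sections of a Wigner transform integrable, as Fourier inversion
  requires.\<close>

lemma rapid_section:
  fixes F :: "'a::euclidean_space \<times> 'b::euclidean_space \<Rightarrow> complex"
  assumes F: "rapid F"
  shows "rapid (\<lambda>\<eta>. F (x, \<eta>))"
proof (rule rapidI)
  have "F \<in> borel_measurable (borel \<Otimes>\<^sub>M borel)"
    using rapid_measurable[OF F] by (simp add: borel_prod)
  then show "(\<lambda>\<eta>. F (x, \<eta>)) \<in> borel_measurable borel" by measurable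
  fix m :: real assume m: "0 < m"
  obtain C where C: "\<And>z. exp (m * \<omega> (norm z)) * norm (F z) \<le> C"
    using F unfolding rapid_def by blast
  have "exp (m * \<omega> (norm \<eta>)) * norm (F (x, \<eta>)) \<le> C" for \<eta>
    using m by (intro order_trans[OF mult_right_mono C[of "(x, \<eta>)"]]) (auto intro!: mult_left_mono omega_mono norm_snd_le)
  then show "\<exists>C. \<forall>\<eta>. exp (m * \<omega> (norm \<eta>)) * norm (F (x, \<eta>)) \<le> C" by blast
qed

lemma integrable_norm_square:
  assumes "rapid F"
  shows "integrable lborel (\<lambda>x. (norm (F x))\<^sup>2)"
proof -
  obtain C where C: "0 \<le> C" "\<And>x. norm (F x) \<le> C" using rapid_bounded[OF assms] by blast
  note [measurable] = rapid_measurable[OF assms]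
  show ?thesis
  proof (rule Bochner_Integration.integrable_bound)
    show "integrable lborel (\<lambda>x. C * norm (F x))" using rapid_integrable[OF assms] by simp
    show "AE x in lborel. norm ((norm (F x))\<^sup>2) \<le> norm (C * norm (F x))"
      using C by (auto simp: power2_eq_square abs_mult intro!: AE_I2 mult_right_mono)
  qed measurable
qed

text \<open>This is \<open>fourier_mult\<close> at frequency 0 for the conjugate of \<open>g\<close>
  and \<open>g\<close> itself.\<close>

lemma Plancherel:
  fixes g :: "real^'n::finite \<Rightarrow> complex"
  assumes g: "test_function g"
  shows "(LINT \<eta>|lborel. (norm (fourier g \<eta>))\<^sup>2) = (2 * pi) ^ CARD('n) * (LINT t|lborel. (norm (g t))\<^sup>2)"
proof -
  note [measurable] = test_functionD(1,5)[OF g]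
  obtain C where C: "\<And>x. norm (g x) \<le> C" using test_function_bounded[OF g] by blast
  have "(2 * pi) ^ CARD('n) * fourier (\<lambda>t. cnj (g t) * g t) 0 = (LINT \<eta>|lborel. fourier g \<eta> * fourier (\<lambda>t. cnj (g t)) (0 - \<eta>))"
    by (rule fourier_mult[OF integrable_cnj test_functionD(4)[OF g] test_functionD(2)[OF g] C test_functionD(8)[OF g]])
       (rule test_functionD(4)[OF g])
  also have "\<dots> = (LINT \<eta>|lborel. complex_of_real ((norm (fourier g \<eta>))\<^sup>2))"
    by (simp add: fourier_cnj complex_norm_square del: of_real_power)
  also have "fourier (\<lambda>t. cnj (g t) * g t) 0 = (LINT t|lborel. complex_of_real ((norm (g t))\<^sup>2))"
    by (simp add: fourier_lborel complex_norm_square mult.commute del: of_real_power)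
  finally have "complex_of_real ((2 * pi) ^ CARD('n) * (LINT t|lborel. (norm (g t))\<^sup>2)) =
      complex_of_real (LINT \<eta>|lborel. (norm (fourier g \<eta>))\<^sup>2)"
    by (simp only: integral_complex_of_real of_real_mult)
  then show ?thesis by (simp only: of_real_eq_iff)
qed

text \<open>For fixed \<open>y\<close> the short-time Fourier transform is the Fourier transform of
  \<open>f\<close> times the shifted conjugate window; inversion at \<open>x\<close> recovers that
  product, and the modulus goes inside the integral.\<close>

lemma stft_recovers_time:
  fixes f g :: "real^'n::finite \<Rightarrow> complex"
  assumes f: "test_function f" and g: "test_function g"
  shows "ennreal (norm (f x) * norm (g (x - y))) \<le>
     ennreal (1 / (2 * pi) ^ CARD('n)) * (\<integral>\<^sup>+\<eta>. ennreal (norm (stft g f y \<eta>)) \<partial>lborel)"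
proof -
  note [measurable] = test_functionD(1)[OF f] test_functionD(1)[OF g]
  let ?h = "\<lambda>t. f t * cnj (g (t - y))"
  have h: "integrable lborel ?h"
    by (intro integrable_mult_test test_functionD(4)[OF f] g) measurable
  have hm: "?h \<in> borel_measurable borel" by measurable
  obtain C where C: "0 \<le> C" "\<And>x. norm (f x) \<le> C" using test_function_bounded[OF f] by blast
  obtain D where D: "0 \<le> D" "\<And>x. norm (g x) \<le> D" using test_function_bounded[OF g] by blast
  have cont: "continuous_on UNIV ?h"
    by (intro continuous_intros continuous_on_compose2[OF test_functionD(2)[OF f]]
          continuous_on_compose2[OF test_functionD(2)[OF g]]) auto
  have bd: "norm (?h t) \<le> C * D" for t
    using C D by (auto simp: norm_mult intro!: mult_mono)
  show ?thesis
  proof (cases "integrable lborel (fourier ?h)")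
    case True
    have "(2 * pi) ^ CARD('n) * ?h x = (LINT \<xi>|lborel. phase x \<xi> * fourier ?h \<xi>)"
      by (rule fourier_inversion[OF h cont bd True, symmetric])
    then have "ennreal (norm ((2 * pi) ^ CARD('n) * ?h x)) = ennreal (norm (LINT \<xi>|lborel. phase x \<xi> * fourier ?h \<xi>))"
      by simp
    also have "\<dots> \<le> (\<integral>\<^sup>+\<xi>. ennreal (norm (phase x \<xi> * fourier ?h \<xi>)) \<partial>lborel)"
      by (intro integral_norm_bound_ennreal integrable_phase_mult True) auto
    also have "\<dots> = (\<integral>\<^sup>+\<eta>. ennreal (norm (stft g f y \<eta>)) \<partial>lborel)"
      by (simp add: stft_def norm_mult)
    finally have *: "ennreal (norm ((2 * pi) ^ CARD('n) * ?h x)) \<le> (\<integral>\<^sup>+\<eta>. ennreal (norm (stft g f y \<eta>)) \<partial>lborel)" .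
    have "norm (f x) * norm (g (x - y)) = 1 / (2 * pi) ^ CARD('n) * norm ((2 * pi) ^ CARD('n) * ?h x)"
      by (simp add: norm_mult norm_power)
    then have "ennreal (norm (f x) * norm (g (x - y))) =
        ennreal (1 / (2 * pi) ^ CARD('n)) * ennreal (norm ((2 * pi) ^ CARD('n) * ?h x))"
      by (simp add: ennreal_mult[symmetric])
    also have "\<dots> \<le> ennreal (1 / (2 * pi) ^ CARD('n)) * (\<integral>\<^sup>+\<eta>. ennreal (norm (stft g f y \<eta>)) \<partial>lborel)"
      by (rule mult_left_mono[OF *]) simp
    finally show ?thesis .
  next
    \<comment> \<open>Without integrability in \<open>\<eta>\<close> inversion fails, but then the
      right side is infinite.\<close>
    case False
    then have "(\<integral>\<^sup>+\<eta>. ennreal (norm (stft g f y \<eta>)) \<partial>lborel) = \<infinity>"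
      using fourier_measurable[OF hm] by (auto simp: integrable_iff_bounded stft_def[abs_def] less_top[symmetric])
    then show ?thesis by (simp add: ennreal_mult_top)
  qed
qed

text \<open>Transforming in \<open>y\<close> at the frequency
  \<open>\<zeta> = \<xi> - \<eta>\<close> and exchanging the integrals separates the variables into
  \<open>fourier f \<xi>\<close> and \<open>cnj (fourier g \<zeta>)\<close>. No inversion is
  involved, hence no power of \<open>2 * pi\<close>; it enters later through
  \<open>Plancherel\<close>.\<close>

lemma stft_recovers_frequency:
  fixes f g :: "real^'n::finite \<Rightarrow> complex"
  assumes f: "test_function f" and g: "test_function g"
  shows "ennreal (norm (fourier f \<xi>) * norm (fourier g (\<xi> - \<eta>))) \<le> (\<integral>\<^sup>+y. ennreal (norm (stft g f y \<eta>)) \<partial>lborel)"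
proof -
  note [measurable] = test_functionD(1)[OF f] test_functionD(1)[OF g]
  define \<zeta> where "\<zeta> = \<xi> - \<eta>"
  let ?e = "\<lambda>t \<eta>. exp (- \<i> * of_real (t \<bullet> \<eta>))"
  let ?k = "\<lambda>t y. ?e t \<eta> * ?e y \<zeta>"
  let ?F = "\<lambda>t y. ?k t y * (f t * cnj (g (t - y)))"
  have int: "integrable (lborel \<Otimes>\<^sub>M lborel) (\<lambda>(t,y). ?F t y)"
    by (rule integrable_pair_convolution[OF test_functionD(4)[OF f] integrable_cnj[OF test_functionD(4)[OF g]]])
       (auto simp: norm_mult)
  have inner: "(LINT t|lborel. ?F t y) = ?e y \<zeta> * stft g f y \<eta>" for y
  proof -
    have "(LINT t|lborel. ?F t y) = (LINT t|lborel. ?e y \<zeta> * (?e t \<eta> * (f t * cnj (g (t - y)))))"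
      by (intro Bochner_Integration.integral_cong refl) (simp add: mult_ac)
    then show ?thesis by (simp add: stft_def fourier_lborel)
  qed
  have "(LINT y|lborel. ?e y \<zeta> * stft g f y \<eta>) = (LINT y|lborel. LINT t|lborel. ?F t y)"
    by (simp only: inner)
  also have "\<dots> = (LINT t|lborel. LINT y|lborel. ?F t y)"
    by (rule lborel_pair.Fubini_integral[OF int])
  also have "\<dots> = (LINT t|lborel. ?e t \<xi> * f t * cnj (fourier g \<zeta>))"
  proof (intro Bochner_Integration.integral_cong refl)
    fix t :: "real^'n"
    have "cnj (fourier g \<zeta>) = (LINT s|lborel. cnj (?e s \<zeta> * g s))"
      unfolding fourier_lborel[OF test_functionD(1)[OF g]] by (rule Bochner_Integration.integral_cnj[symmetric])
    also have "\<dots> = \<bar>- 1\<bar> ^ DIM(real^'n) *\<^sub>R (LINT r|lborel. cnj (?e (t + (- 1) *\<^sub>R r) \<zeta> * g (t + (- 1) *\<^sub>R r)))"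
      by (intro integral_lborel_affine integrable_cnj integrable_phase_mult[OF test_functionD(4)[OF g]]) auto
    finally have "cnj (fourier g \<zeta>) = (LINT r|lborel. cnj (?e (t - r) \<zeta> * g (t - r)))"
      by simp
    then have "?e t \<xi> * f t * cnj (fourier g \<zeta>) = (LINT r|lborel. ?e t \<xi> * f t * cnj (?e (t - r) \<zeta> * g (t - r)))"
      by (simp only: integral_mult_right_zero)
    also have "\<dots> = (LINT y|lborel. ?F t y)"
    proof (intro Bochner_Integration.integral_cong refl)
      fix y
      have "?e t \<xi> * cnj (?e (t - y) \<zeta>) = ?k t y"
        by (simp add: \<zeta>_def exp_cnj exp_add[symmetric] inner_diff_left inner_diff_right algebra_simps)
      moreover have "?e t \<xi> * f t * cnj (?e (t - y) \<zeta> * g (t - y)) =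
          (?e t \<xi> * cnj (?e (t - y) \<zeta>)) * (f t * cnj (g (t - y)))"
        by (simp only: complex_cnj_mult mult_ac)
      ultimately show "?e t \<xi> * f t * cnj (?e (t - y) \<zeta> * g (t - y)) = ?F t y"
        by simp
    qed
    finally show "(LINT y|lborel. ?F t y) = ?e t \<xi> * f t * cnj (fourier g \<zeta>)" ..
  qed
  also have "\<dots> = fourier f \<xi> * cnj (fourier g \<zeta>)"
    by (simp only: integral_mult_left_zero fourier_lborel[OF test_functionD(1)[OF f]])
  finally have "norm (fourier f \<xi>) * norm (fourier g \<zeta>) = norm (LINT y|lborel. ?e y \<zeta> * stft g f y \<eta>)"
    by (simp add: norm_mult)
  also have "ennreal \<dots> \<le> (\<integral>\<^sup>+y. ennreal (norm (?e y \<zeta> * stft g f y \<eta>)) \<partial>lborel)"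
    using lborel_pair.integrable_snd[OF int] unfolding inner by (rule integral_norm_bound_ennreal)
  also have "\<dots> = (\<integral>\<^sup>+y. ennreal (norm (stft g f y \<eta>)) \<partial>lborel)"
    by (simp add: norm_mult)
  finally show ?thesis by (simp add: \<zeta>_def)
qed

end

text \<open>If \<open>M\<close> is finite, it cancels from
  \<open>\<delta> * M \<le> M * emeasure lebesgue E\<close>. If \<open>M\<close> is infinite, so is
  the integral over \<open>E\<close>, and the finite bound \<open>C\<close> forces \<open>E\<close>
  to have infinite measure. The second bound is there for an \<open>M\<close> not known to be
  finite.\<close>

lemma measure_ge_of_concentration:
  fixes W :: "'a::euclidean_space \<Rightarrow> ennreal"
  assumes E: "E \<in> sets lebesgue"
    and M: "\<And>z. W z \<le> M" "M \<noteq> 0" and C: "\<And>z. W z \<le> C" "C < \<infinity>"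
    and \<delta>: "0 < \<delta>" "\<delta> * M \<le> (\<integral>\<^sup>+z\<in>E. W z \<partial>lebesgue)"
  shows "\<delta> \<le> emeasure lebesgue E"
proof -
  have le: "(\<integral>\<^sup>+z\<in>E. W z \<partial>lebesgue) \<le> c * emeasure lebesgue E" if "\<And>z. W z \<le> c" for c
  proof -
    have "(\<integral>\<^sup>+z\<in>E. W z \<partial>lebesgue) \<le> (\<integral>\<^sup>+z. c * indicator E z \<partial>lebesgue)"
      by (intro nn_integral_mono mult_right_mono that) auto
    then show ?thesis using E by (simp add: nn_integral_cmult_indicator)
  qed
  show ?thesis
  proof (cases "M = \<infinity>")
    case True
    then have "\<delta> * M = \<infinity>" using \<delta>(1) by (simp add: ennreal_mult_top)
    with \<delta>(2) le[OF C(1)] have "C * emeasure lebesgue E = \<infinity>"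
      by (simp add: top_unique)
    then have "emeasure lebesgue E = \<infinity>"
      using C(2) by (auto simp: ennreal_mult_eq_top_iff)
    then show ?thesis by simp
  next
    case False
    have "M * \<delta> \<le> M * emeasure lebesgue E"
      using \<delta>(2) le[OF M(1)] by (simp add: mult.commute)
    then show ?thesis
      using M(2) False by (subst (asm) ennreal_mult_le_mult_iff) auto
  qed
qed

text \<open>Division by \<open>L\<close> moves it past the infimum; for \<open>L = 0\<close> one
  element of \<open>S\<close> is enough. Infinite \<open>L\<close> has to be excluded: if positive
  values \<open>D g\<close> have infimum 0, the right side becomes
  \<open>0 * \<infinity> = 0\<close>.\<close>

lemma le_INF_mult_ennreal:
  fixes D :: "'a \<Rightarrow> ennreal"
  assumes "S \<noteq> {}" and L: "L < \<infinity>" and le: "\<And>g. g \<in> S \<Longrightarrow> W \<le> D g * L"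
  shows "W \<le> (INF g\<in>S. D g) * L"
proof (cases "L = 0")
  case True
  obtain g where "g \<in> S" using assms(1) by blast
  from le[OF this] True show ?thesis by simp
next
  case False
  then obtain l where l: "L = ennreal l" "0 < l" using L by (cases L) (auto simp: less_le)
  have inv: "ennreal l * ennreal (1 / l) = 1" using l by (simp add: ennreal_mult[symmetric])
  have "W * ennreal (1 / l) \<le> (INF g\<in>S. D g)"
  proof (rule INF_greatest)
    fix g assume "g \<in> S"
    then have "W * ennreal (1 / l) \<le> D g * L * ennreal (1 / l)" by (intro mult_right_mono le) auto
    also have "\<dots> = D g" by (simp add: l(1) mult.assoc inv)
    finally show "W * ennreal (1 / l) \<le> D g" .
  qed
  then have "W * ennreal (1 / l) * L \<le> (INF g\<in>S. D g) * L" by (intro mult_right_mono) auto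
  then show ?thesis using inv by (simp add: l(1) mult.assoc mult.commute[of "ennreal (1 / l)"])
qed

section \<open>Pointwise bound for the Rihaczek form by way of the spectrogram\<close>

context weight
begin

text \<open>By \<open>Wig_marginal\<close> the squared modulus is the integral over time of the
  Wigner transform of \<open>f\<close> times the shifted conjugate window. At a fixed time that
  Wigner transform is the Fourier transform of a product, hence a convolution in frequency of the
  Wigner transforms of \<open>f\<close> and of the window; the integral over time makes it a
  convolution in both variables.\<close>

lemma spectrogram_bound:
  fixes f g :: "real^'n::finite \<Rightarrow> complex"
  assumes f: "test_function f" and g: "test_function g" and \<tau>: "0 < \<tau>" "\<tau> < 1"
  shows "ennreal ((norm (stft g f (fst z) (snd z)))\<^sup>2) \<le>
    (\<integral>\<^sup>+w. ennreal (norm (Wig \<tau> f (z - w))) * ennreal (norm (Wig (1 - \<tau>) (\<lambda>t. g (- t)) w)) \<partial>lborel)"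
proof -
  obtain x \<xi> where z: "z = (x, \<xi>)" by (cases z)
  define g' where "g' = (\<lambda>t. g (- t))"
  have g': "test_function g'" unfolding g'_def by (rule test_function_reflect[OF g])
  note [measurable] = test_functionD(1)[OF f] test_functionD(1)[OF g'] test_functionD(1)[OF g]
  let ?h = "\<lambda>t. f t * cnj (g (t - x))"
  have h: "integrable lborel ?h"
    by (intro integrable_mult_test test_functionD(4)[OF f] g) measurable
  let ?W = "Wig \<tau> f" and ?W' = "Wig (1 - \<tau>) g'"
  have W': "rapid ?W'" using \<tau> by (intro rapid_Wig[OF g']) auto
  have [measurable]: "?W \<in> borel_measurable (borel \<Otimes>\<^sub>M borel)" "?W' \<in> borel_measurable (borel \<Otimes>\<^sub>M borel)"
    using Wig_measurable[OF test_functionD(1)[OF f]] Wig_measurable[OF test_functionD(1)[OF g']] by (auto simp: borel_prod)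
  obtain C where C: "0 \<le> C" "\<And>t. norm (g' t) \<le> C" using test_function_bounded[OF g'] by blast
  have Wh: "ennreal (norm (Wig \<tau> ?h (y, \<xi>))) \<le>
     (\<integral>\<^sup>+\<eta>. ennreal (norm (?W (y, \<xi> - \<eta>))) * ennreal (norm (?W' (x - y, \<eta>))) \<partial>lborel)" for y
  proof -
    let ?A = "\<lambda>r. f (y + \<tau> *\<^sub>R r) * cnj (f (y - (1 - \<tau>) *\<^sub>R r))"
    let ?G = "\<lambda>r. g' ((x - y) + (1 - \<tau>) *\<^sub>R r) * cnj (g' ((x - y) - (1 - (1 - \<tau>)) *\<^sub>R r))"
    have A: "integrable lborel ?A"
      using \<tau> by (intro integrable_mult_test[OF _ f] integrable_lborel_affine test_functionD(4)[OF f]) auto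
    have G: "integrable lborel ?G"
      using \<tau> by (intro integrable_mult_test[OF _ g'] integrable_lborel_affine test_functionD(4)[OF g']) auto
    have cG: "continuous_on UNIV ?G"
      by (intro continuous_intros continuous_on_compose2[OF test_functionD(2)[OF g']]) auto
    have bG: "norm (?G r) \<le> C * C" for r
      using C by (auto simp: norm_mult intro!: mult_mono)
    have FG: "fourier ?G = (\<lambda>\<eta>. ?W' (x - y, \<eta>))"
      by (simp only: Wig_eq_fourier)
    have FA: "fourier ?A \<eta> = ?W (y, \<eta>)" for \<eta>
      by (simp only: Wig_eq_fourier)
    have iG: "integrable lborel (fourier ?G)"
      unfolding FG by (intro rapid_integrable rapid_section W')
    have "?h (y + \<tau> *\<^sub>R r) * cnj (?h (y - (1 - \<tau>) *\<^sub>R r)) = ?A r * ?G r" for r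
    proof -
      \<comment> \<open>In terms of the reflected window the offsets \<open>\<tau>\<close> and
        \<open>1 - \<tau>\<close> change places; this is the origin of the parameter
        \<open>1 - \<tau>\<close>.\<close>
      have "g (y + \<tau> *\<^sub>R r - x) = g' ((x - y) - (1 - (1 - \<tau>)) *\<^sub>R r)"
        "g (y - (1 - \<tau>) *\<^sub>R r - x) = g' ((x - y) + (1 - \<tau>) *\<^sub>R r)"
        unfolding g'_def by (rule arg_cong[where f = g], simp add: algebra_simps)+
      then show ?thesis by (simp only: complex_cnj_mult complex_cnj_cnj mult_ac)
    qed
    then have "Wig \<tau> ?h (y, \<xi>) = fourier (\<lambda>r. ?A r * ?G r) \<xi>"
      by (simp only: Wig_eq_fourier)
    then have "ennreal (norm (Wig \<tau> ?h (y, \<xi>))) \<le> ennreal (1 / (2 * pi) ^ CARD('n)) *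
       (\<integral>\<^sup>+\<eta>. ennreal (norm (fourier ?A (\<xi> - \<eta>)) * norm (fourier ?G \<eta>)) \<partial>lborel)"
      using fourier_mult_bound[OF A G cG bG iG, of \<xi>] by simp
    \<comment> \<open>Only domination is claimed, so the factor, which is at most 1, is
      dropped.\<close>
    also have "\<dots> \<le> 1 * (\<integral>\<^sup>+\<eta>. ennreal (norm (fourier ?A (\<xi> - \<eta>)) * norm (fourier ?G \<eta>)) \<partial>lborel)"
    proof (rule mult_right_mono)
      have "1 \<le> (2 * pi) ^ CARD('n)" using pi_ge_two by (intro one_le_power) linarith
      then have "1 / (2 * pi) ^ CARD('n) \<le> 1" by (simp add: divide_le_eq_1)
      from ennreal_leI[OF this] show "ennreal (1 / (2 * pi) ^ CARD('n)) \<le> 1" by simp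
    qed simp
    finally show ?thesis
      unfolding FA FG by (simp add: ennreal_mult)
  qed
  have "(norm (stft g f x \<xi>))\<^sup>2 = norm (LINT y|lborel. Wig \<tau> ?h (y, \<xi>))"
    unfolding Wig_marginal(2)[OF h] stft_def by (simp add: norm_mult power2_eq_square)
  also have "ennreal \<dots> \<le> (\<integral>\<^sup>+y. ennreal (norm (Wig \<tau> ?h (y, \<xi>))) \<partial>lborel)"
    by (rule integral_norm_bound_ennreal[OF Wig_marginal(1)[OF h]])
  also have "\<dots> \<le> (\<integral>\<^sup>+y. \<integral>\<^sup>+\<eta>. ennreal (norm (?W (y, \<xi> - \<eta>))) * ennreal (norm (?W' (x - y, \<eta>))) \<partial>lborel \<partial>lborel)"
    by (intro nn_integral_mono Wh)
  \<comment> \<open>Substituting \<open>y = x - u\<close> exhibits the convolution at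
    \<open>z = (x, \<xi>)\<close>.\<close>
  also have "\<dots> = (\<integral>\<^sup>+u. \<integral>\<^sup>+\<eta>. ennreal (norm (?W (x - u, \<xi> - \<eta>))) * ennreal (norm (?W' (x - (x - u), \<eta>))) \<partial>lborel \<partial>lborel)"
    by (rule nn_integral_lborel_reflect[symmetric]) measurable
  also have "\<dots> = (\<integral>\<^sup>+w. ennreal (norm (?W (z - w))) * ennreal (norm (?W' w)) \<partial>lborel)"
  proof -
    have "(\<lambda>w. ennreal (norm (?W ((x, \<xi>) - w))) * ennreal (norm (?W' w))) \<in> borel_measurable borel"
      using Wig_measurable[OF test_functionD(1)[OF f]] Wig_measurable[OF test_functionD(1)[OF g']] by measurable
    from nn_integral_lborel_pair[OF this] show ?thesis unfolding z by simp
  qed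
  finally show ?thesis by (simp add: z g'_def)
qed

text \<open>The common core of the reconstruction of \<open>f\<close> and of its Fourier transform from the
  short-time Fourier transform, with \<open>I\<close> a marginal of the latter.\<close>

lemma weighted_recovery:
  fixes \<phi> \<gamma> :: "real^'n::finite \<Rightarrow> complex"
  assumes \<gamma>: "continuous_on UNIV \<gamma>" "rapid \<gamma>" and lam: "0 \<le> lam"
    and I[measurable]: "I \<in> borel_measurable borel"
    and le: "\<And>y. ennreal (norm (\<phi> x) * norm (\<gamma> (x - y))) \<le> I y"
  shows "ennreal (exp (lam * K * \<omega> (norm x)) * norm (\<phi> x)) * ennreal (LINT t|lborel. (norm (\<gamma> t))\<^sup>2) \<le>
    ennreal (exp (lam * K\<^sup>2)) * Lp_norm \<infinity> (weighted \<omega> (K\<^sup>2 * lam) \<gamma>) *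
    (\<integral>\<^sup>+y. I y * ennreal (exp (K\<^sup>2 * lam * \<omega> (norm y))) \<partial>lborel)"
proof -
  note [measurable] = rapid_measurable[OF \<gamma>(2)]
  let ?e = "ennreal (exp (lam * K * \<omega> (norm x)) * norm (\<phi> x))"
  let ?G = "Lp_norm \<infinity> (weighted \<omega> (K\<^sup>2 * lam) \<gamma>)"
  \<comment> \<open>The squared norm of the window is written as an integral over \<open>y\<close>.
    Of the two factors \<open>norm (\<gamma> (x - y))\<close> one goes into \<open>le\<close>, the
    other with its weight into the supremum norm.\<close>
  have "ennreal (LINT t|lborel. (norm (\<gamma> t))\<^sup>2) = (\<integral>\<^sup>+t. ennreal ((norm (\<gamma> t))\<^sup>2) \<partial>lborel)"
    by (rule nn_integral_eq_integral[symmetric]) (auto intro: integrable_norm_square \<gamma>(2))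
  also have "\<dots> = (\<integral>\<^sup>+y. ennreal ((norm (\<gamma> (x - y)))\<^sup>2) \<partial>lborel)"
    by (rule nn_integral_lborel_reflect[symmetric]) measurable
  finally have "?e * ennreal (LINT t|lborel. (norm (\<gamma> t))\<^sup>2) = (\<integral>\<^sup>+y. ?e * ennreal ((norm (\<gamma> (x - y)))\<^sup>2) \<partial>lborel)"
    by (simp add: nn_integral_cmult)
  also have "\<dots> \<le> (\<integral>\<^sup>+y. ennreal (exp (lam * K\<^sup>2)) * ?G * (I y * ennreal (exp (K\<^sup>2 * lam * \<omega> (norm y)))) \<partial>lborel)"
  proof (rule nn_integral_mono)
    fix y
    have "norm x \<le> norm (x - y) + norm y" using norm_triangle_ineq[of "x - y" y] by simp
    then have "lam * K * \<omega> (norm x) \<le> lam * K * (K * (1 + \<omega> (norm (x - y)) + \<omega> (norm y)))"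
      using lam K_ge_1 by (intro mult_left_mono omega_norm_add) auto
    also have "\<dots> = lam * K\<^sup>2 + K\<^sup>2 * lam * \<omega> (norm (x - y)) + K\<^sup>2 * lam * \<omega> (norm y)"
      by (simp add: algebra_simps power2_eq_square)
    finally have "exp (lam * K * \<omega> (norm x)) \<le>
        exp (lam * K\<^sup>2) * exp (K\<^sup>2 * lam * \<omega> (norm (x - y))) * exp (K\<^sup>2 * lam * \<omega> (norm y))"
      by (simp add: exp_add[symmetric])
    then have "exp (lam * K * \<omega> (norm x)) * (norm (\<phi> x) * (norm (\<gamma> (x - y)))\<^sup>2) \<le>
        exp (lam * K\<^sup>2) * exp (K\<^sup>2 * lam * \<omega> (norm (x - y))) * exp (K\<^sup>2 * lam * \<omega> (norm y)) * (norm (\<phi> x) * (norm (\<gamma> (x - y)))\<^sup>2)"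
      by (rule mult_right_mono) auto
    also have "\<dots> = exp (lam * K\<^sup>2) * norm (weighted \<omega> (K\<^sup>2 * lam) \<gamma> (x - y)) *
        ((norm (\<phi> x) * norm (\<gamma> (x - y))) * exp (K\<^sup>2 * lam * \<omega> (norm y)))"
      by (simp add: norm_weighted power2_eq_square mult_ac)
    finally have "?e * ennreal ((norm (\<gamma> (x - y)))\<^sup>2) \<le>
        ennreal (exp (lam * K\<^sup>2)) * ennreal (norm (weighted \<omega> (K\<^sup>2 * lam) \<gamma> (x - y))) *
        (ennreal (norm (\<phi> x) * norm (\<gamma> (x - y))) * ennreal (exp (K\<^sup>2 * lam * \<omega> (norm y))))"
      by (simp add: ennreal_mult[symmetric] ennreal_leI mult.assoc)
    also have "\<dots> \<le> ennreal (exp (lam * K\<^sup>2)) * ?G * (I y * ennreal (exp (K\<^sup>2 * lam * \<omega> (norm y))))"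
      by (intro mult_mono norm_le_Lp_norm_inf continuous_on_weighted \<gamma> le) auto
    finally show "?e * ennreal ((norm (\<gamma> (x - y)))\<^sup>2) \<le> ennreal (exp (lam * K\<^sup>2)) * ?G * (I y * ennreal (exp (K\<^sup>2 * lam * \<omega> (norm y))))" .
  qed
  also have "\<dots> = ennreal (exp (lam * K\<^sup>2)) * ?G * (\<integral>\<^sup>+y. I y * ennreal (exp (K\<^sup>2 * lam * \<omega> (norm y))) \<partial>lborel)"
    by (rule nn_integral_cmult) measurable
  finally show ?thesis .
qed

text \<open>The first claim permits division by the norm of the window; the second keeps
  \<open>Rihaczek f\<close> from vanishing identically.\<close>

lemma test_function_nonzero:
  assumes g: "test_function g" and "g \<noteq> (\<lambda>_. 0)"
  shows "0 < (LINT t|lborel. (norm (g t))\<^sup>2)" "fourier g \<noteq> (\<lambda>_. 0)"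
proof -
  note [measurable] = test_functionD(1)[OF g]
  show pos: "0 < (LINT t|lborel. (norm (g t))\<^sup>2)"
  proof (rule ccontr)
    assume "\<not> ?thesis"
    moreover have "0 \<le> (LINT t|lborel. (norm (g t))\<^sup>2)" by simp
    ultimately have "(LINT t|lborel. (norm (g t))\<^sup>2) = 0" by linarith
    then have "AE t in lborel. (norm (g t))\<^sup>2 = 0"
      by (subst (asm) integral_nonneg_eq_0_iff_AE) (auto intro: integrable_norm_square test_functionD(3)[OF g])
    then have "Lp_norm \<infinity> g \<le> 0"
      by (intro Lp_norm_inf_le) (auto elim!: eventually_mono)
    then have "ennreal (norm (g t)) \<le> 0" for t
      using norm_le_Lp_norm_inf[OF test_functionD(2)[OF g], of t] by simp
    then show False using assms(2) by auto
  qed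
  show "fourier g \<noteq> (\<lambda>_. 0)"
    using Plancherel[OF g] pos by auto
qed

lemma Rihaczek_nonzero:
  assumes f: "test_function f" and "f \<noteq> (\<lambda>_. 0)"
  obtains z where "Rihaczek f z \<noteq> 0"
proof -
  obtain x \<xi> where "f x \<noteq> 0" "fourier f \<xi> \<noteq> 0"
    using assms(2) test_function_nonzero(2)[OF assms] by (auto simp: fun_eq_iff)
  then have "norm (Rihaczek f (x, \<xi>)) \<noteq> 0" by (simp add: norm_Rihaczek)
  then show ?thesis using that by fastforce
qed

text \<open>Write the weight as \<open>exp (c * \<omega> (norm z))\<close> times
  \<open>exp (- \<mu> * \<omega> (norm z))\<close> with \<open>c = K\<^sup>2 * lam + \<mu>\<close>.
  Hoelder with exponent \<open>2 * p\<close> leaves the norm of the weighted transform, whose square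
  is controlled by an \<open>L\<^sup>p\<close> norm to which \<open>spectrogram_bound\<close> and
  Young's inequality apply. Splitting the doubled weight \<open>2 * c\<close> over the convolution
  multiplies it by \<open>K\<close>, which gives \<open>m\<close> and the constant
  \<open>exp m\<close>.\<close>

lemma stft_weighted_L1_bound:
  fixes f g :: "real^'n::finite \<Rightarrow> complex"
  assumes f: "test_function f" and g: "test_function g" and \<tau>: "0 < \<tau>" "\<tau> < 1"
    and lam: "0 \<le> lam" and mu: "0 \<le> \<mu>" and p: "1 \<le> p"
  defines "m \<equiv> 2 * K * (K\<^sup>2 * lam + \<mu>)"
  shows "(\<integral>\<^sup>+z. ennreal (norm (stft g f (fst z) (snd z)) * exp (K\<^sup>2 * lam * \<omega> (norm z))) \<partial>lborel)\<^sup>2 \<le>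
    ennreal (exp m) * (Lp_norm p (weighted \<omega> m (Wig \<tau> f)) * Lp_norm 1 (weighted \<omega> m (Wig (1 - \<tau>) (\<lambda>t. g (- t))))) *
    (Lp_norm (conj_exp (2 * p)) (\<lambda>z::(real^'n) \<times> (real^'n). exp (- \<mu> * \<omega> (norm z))))\<^sup>2"
proof -
  define c where "c = K\<^sup>2 * lam + \<mu>"
  have c: "0 \<le> c" "m = 2 * K * c" using lam mu K_ge_1 by (auto simp: c_def m_def)
  define V where "V z = stft g f (fst z) (snd z)" for z
  have [measurable]: "V \<in> borel_measurable borel"
    using stft_measurable[OF test_functionD(1)[OF f] test_functionD(1)[OF g]] by (simp add: V_def[abs_def] borel_prod)
  let ?W' = "Wig (1 - \<tau>) (\<lambda>t. g (- t))"
  let ?F = "weighted \<omega> m (Wig \<tau> f)" and ?G = "weighted \<omega> m ?W'"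
  have g': "test_function (\<lambda>t. g (- t))" by (rule test_function_reflect[OF g])
  have rG: "rapid ?G" using \<tau> by (intro rapid_weighted rapid_Wig g') auto
  have [measurable]: "Wig \<tau> f \<in> borel_measurable borel" "?W' \<in> borel_measurable borel"
    using test_functionD(1)[OF f] test_functionD(1)[OF g'] by (auto intro: Wig_measurable)
  define u where "u z = exp (c * \<omega> (norm z)) * norm (V z)" for z
  have [measurable]: "u \<in> borel_measurable borel" unfolding u_def[abs_def] by measurable
  \<comment> \<open>Division by \<open>exp m\<close> absorbs the constant of
    \<open>omega_norm_add\<close>, so that Young's inequality applies without a factor;
    \<open>exp m\<close> returns through \<open>Lp_norm_cmult_le\<close>.\<close>
  define h where "h z = (u z)\<^sup>2 / exp m" for z
  have [measurable]: "h \<in> borel_measurable borel" unfolding h_def[abs_def] by measurable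
  have h: "ennreal (norm (h z)) \<le> (\<integral>\<^sup>+w. ennreal (norm (?F (z - w))) * ennreal (norm (?G w)) \<partial>lborel)" for z
  proof -
    have "ennreal (norm (h z)) = ennreal (exp (2 * c * \<omega> (norm z) - m)) * ennreal ((norm (V z))\<^sup>2)"
      by (simp add: h_def u_def ennreal_mult[symmetric] power_mult_distrib exp_diff power2_eq_square exp_add[symmetric])
    also have "\<dots> \<le> ennreal (exp (2 * c * \<omega> (norm z) - m)) *
       (\<integral>\<^sup>+w. ennreal (norm (Wig \<tau> f (z - w))) * ennreal (norm (?W' w)) \<partial>lborel)"
      unfolding V_def by (intro mult_left_mono spectrogram_bound f g \<tau>) auto
    also have "\<dots> = (\<integral>\<^sup>+w. ennreal (exp (2 * c * \<omega> (norm z) - m)) * (ennreal (norm (Wig \<tau> f (z - w))) * ennreal (norm (?W' w))) \<partial>lborel)"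
      by (rule nn_integral_cmult[symmetric]) measurable
    also have "\<dots> \<le> (\<integral>\<^sup>+w. ennreal (norm (?F (z - w))) * ennreal (norm (?G w)) \<partial>lborel)"
    proof (rule nn_integral_mono)
      fix w
      have "norm z \<le> norm (z - w) + norm w" using norm_triangle_ineq[of "z - w" w] by simp
      then have "2 * c * \<omega> (norm z) \<le> 2 * c * (K * (1 + \<omega> (norm (z - w)) + \<omega> (norm w)))"
        using c by (intro mult_left_mono omega_norm_add) auto
      then have "exp (2 * c * \<omega> (norm z) - m) \<le> exp (m * \<omega> (norm (z - w))) * exp (m * \<omega> (norm w))"
        unfolding c(2) by (simp add: exp_add[symmetric] algebra_simps)
      then have "exp (2 * c * \<omega> (norm z) - m) * (norm (Wig \<tau> f (z - w)) * norm (?W' w)) \<le>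
         exp (m * \<omega> (norm (z - w))) * exp (m * \<omega> (norm w)) * (norm (Wig \<tau> f (z - w)) * norm (?W' w))"
        by (rule mult_right_mono) auto
      also have "\<dots> = norm (?F (z - w)) * norm (?G w)"
        by (simp add: norm_weighted mult_ac)
      finally show "ennreal (exp (2 * c * \<omega> (norm z) - m)) * (ennreal (norm (Wig \<tau> f (z - w))) * ennreal (norm (?W' w))) \<le>
         ennreal (norm (?F (z - w))) * ennreal (norm (?G w))"
        by (simp add: ennreal_mult[symmetric] ennreal_leI)
    qed
    finally show ?thesis .
  qed
  have "(Lp_norm (2 * p) u)\<^sup>2 \<le> Lp_norm p (\<lambda>z. (norm (u z))\<^sup>2)"
    by (rule Lp_norm_square_le[OF _ p]) measurable
  also have "\<dots> \<le> ennreal (exp m) * Lp_norm p h"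
    by (rule Lp_norm_cmult_le[OF _ _ p]) (auto simp: h_def)
  also have "Lp_norm p h \<le> Lp_norm p ?F * Lp_norm 1 ?G"
    by (rule Young_convolution_inequality[OF _ _ _ p rapid_Lp_norm_finite[OF rG] h]) auto
  finally have u: "(Lp_norm (2 * p) u)\<^sup>2 \<le> ennreal (exp m) * (Lp_norm p ?F * Lp_norm 1 ?G)"
    by (simp add: mult_left_mono)
  let ?M = "Lp_norm (conj_exp (2 * p)) (\<lambda>z::(real^'n) \<times> (real^'n). exp (- \<mu> * \<omega> (norm z)))"
  have "1 \<le> 2 * p" using p mult_mono[of 1 2 1 p] by simp
  have "(\<integral>\<^sup>+z. ennreal (norm (V z) * exp (K\<^sup>2 * lam * \<omega> (norm z))) \<partial>lborel) =
    (\<integral>\<^sup>+z. ennreal (norm (u z)) * ennreal (norm (exp (- \<mu> * \<omega> (norm z)))) \<partial>lborel)"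
  proof (rule nn_integral_cong)
    fix z :: "(real^'n) \<times> (real^'n)"
    have "exp (K\<^sup>2 * lam * \<omega> (norm z)) = exp (c * \<omega> (norm z)) * exp (- \<mu> * \<omega> (norm z))"
      by (simp add: c_def exp_add[symmetric] algebra_simps)
    then show "ennreal (norm (V z) * exp (K\<^sup>2 * lam * \<omega> (norm z))) = ennreal (norm (u z)) * ennreal (norm (exp (- \<mu> * \<omega> (norm z))))"
      by (simp add: u_def ennreal_mult[symmetric] mult_ac)
  qed
  also have "\<dots> \<le> Lp_norm (2 * p) u * ?M"
    by (rule Holder_inequality) (use \<open>1 \<le> 2 * p\<close> in auto)
  finally have "(\<integral>\<^sup>+z. ennreal (norm (V z) * exp (K\<^sup>2 * lam * \<omega> (norm z))) \<partial>lborel)\<^sup>2 \<le> (Lp_norm (2 * p) u * ?M)\<^sup>2"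
    by (rule power_mono) simp
  also have "\<dots> = (Lp_norm (2 * p) u)\<^sup>2 * ?M\<^sup>2" by (rule power_mult_distrib)
  also have "\<dots> \<le> ennreal (exp m) * (Lp_norm p ?F * Lp_norm 1 ?G) * ?M\<^sup>2"
    by (rule mult_right_mono[OF u]) simp
  finally show ?thesis unfolding V_def .
qed

text \<open>Both recoveries bound their weighted function by the same integral \<open>J\<close>, so
  the product is bounded by \<open>J\<^sup>2\<close>, to which \<open>stft_weighted_L1_bound\<close>
  applies. With \<open>n2\<close> the squared norm of \<open>g\<close> and
  \<open>q = (2 * pi) ^ N\<close>, each recovery costs \<open>1 / (q * n2)\<close>: in time
  \<open>q\<close> comes from inversion, in frequency from \<open>Plancherel\<close>. Hence the
  denominator of \<open>D2\<close>.\<close>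

lemma Rihaczek_bound:
  fixes f g :: "real^'n::finite \<Rightarrow> complex"
  assumes f: "test_function f" and g: "test_function g" "g \<noteq> (\<lambda>_. 0)" and \<tau>: "0 < \<tau>" "\<tau> < 1"
    and lam: "0 \<le> lam" and mu: "0 \<le> \<mu>" and p: "1 \<le> p"
  defines "m \<equiv> 2 * K * (K\<^sup>2 * lam + \<mu>)"
  shows "ennreal (exp (lam * \<omega> (norm z)) * norm (Rihaczek f z)) \<le>
    D2 \<omega> K p lam \<mu> g * ennreal (exp m) * Lp_norm 1 (weighted \<omega> m (Wig (1 - \<tau>) (\<lambda>t. g (- t)))) *
    Lp_norm p (weighted \<omega> m (Wig \<tau> f))"
proof -
  obtain x \<xi> where z: "z = (x, \<xi>)" by (cases z)
  note [measurable] = test_functionD(1)[OF f] test_functionD(1)[OF g(1)]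
  have [measurable]: "(\<lambda>z. stft g f (fst z) (snd z)) \<in> borel_measurable (borel \<Otimes>\<^sub>M borel)"
    by (rule stft_measurable) measurable
  have V1: "(\<lambda>(y,\<eta>). stft g f y \<eta>) \<in> borel_measurable (borel \<Otimes>\<^sub>M borel)"
    using stft_measurable[OF test_functionD(1)[OF f] test_functionD(1)[OF g(1)]] by (simp add: split_beta')
  note [measurable] = V1
  define n2 where "n2 = (LINT t|lborel. (norm (g t))\<^sup>2)"
  have n2: "0 < n2" unfolding n2_def by (rule test_function_nonzero[OF g])
  define q where "q = (2 * pi) ^ CARD('n)"
  have q: "0 < q" by (simp add: q_def)
  define J where "J = (\<integral>\<^sup>+z. ennreal (norm (stft g f (fst z) (snd z)) * exp (K\<^sup>2 * lam * \<omega> (norm z))) \<partial>lborel)"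
  let ?Ga = "Lp_norm \<infinity> (weighted \<omega> (K\<^sup>2 * lam) g)" and ?Gb = "Lp_norm \<infinity> (weighted \<omega> (K\<^sup>2 * lam) (fourier g))"
  let ?X = "exp (lam * K * \<omega> (norm x)) * norm (f x)" and ?Y = "exp (lam * K * \<omega> (norm \<xi>)) * norm (fourier f \<xi>)"
  let ?k = "ennreal (exp (lam * K\<^sup>2))"
  have Jeq: "J = (\<integral>\<^sup>+y. \<integral>\<^sup>+\<eta>. ennreal (norm (stft g f y \<eta>) * exp (K\<^sup>2 * lam * \<omega> (norm (y, \<eta>)))) \<partial>lborel \<partial>lborel)"
  proof -
    have "(\<lambda>z. ennreal (norm (stft g f (fst z) (snd z)) * exp (K\<^sup>2 * lam * \<omega> (norm z)))) \<in> borel_measurable borel"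
      using stft_measurable[OF test_functionD(1)[OF f] test_functionD(1)[OF g(1)]] unfolding borel_prod by measurable
    from nn_integral_lborel_pair[OF this] show ?thesis unfolding J_def by simp
  qed
  have Vw: "(\<lambda>(y,\<eta>). ennreal (norm (stft g f y \<eta>) * exp (K\<^sup>2 * lam * \<omega> (norm (y, \<eta>))))) \<in> borel_measurable (lborel \<Otimes>\<^sub>M lborel)"
  proof -
    have "(\<lambda>z. ennreal (norm (stft g f (fst z) (snd z)) * exp (K\<^sup>2 * lam * \<omega> (norm z)))) \<in> borel_measurable borel"
      using stft_measurable[OF test_functionD(1)[OF f] test_functionD(1)[OF g(1)]] unfolding borel_prod by measurable
    then show ?thesis by (simp add: lborel_prod split_beta')
  qed
  have "ennreal ?X * ennreal n2 \<le> ?k * ?Ga *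
    (\<integral>\<^sup>+y. ennreal (1 / q) * (\<integral>\<^sup>+\<eta>. ennreal (norm (stft g f y \<eta>)) \<partial>lborel) * ennreal (exp (K\<^sup>2 * lam * \<omega> (norm y))) \<partial>lborel)"
    unfolding n2_def q_def
    by (rule weighted_recovery[OF test_functionD(2,3)[OF g(1)] lam _ stft_recovers_time[OF f g(1)]]) measurable
  also have "\<dots> \<le> ?k * ?Ga * (ennreal (1 / q) * J)"
  proof (rule mult_left_mono)
    have "(\<integral>\<^sup>+y. ennreal (1 / q) * (\<integral>\<^sup>+\<eta>. ennreal (norm (stft g f y \<eta>)) \<partial>lborel) * ennreal (exp (K\<^sup>2 * lam * \<omega> (norm y))) \<partial>lborel)
       = (\<integral>\<^sup>+y. ennreal (1 / q) * (\<integral>\<^sup>+\<eta>. ennreal (norm (stft g f y \<eta>)) * ennreal (exp (K\<^sup>2 * lam * \<omega> (norm y))) \<partial>lborel) \<partial>lborel)"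
      by (simp add: nn_integral_multc mult.assoc)
    also have "\<dots> \<le> (\<integral>\<^sup>+y. ennreal (1 / q) * (\<integral>\<^sup>+\<eta>. ennreal (norm (stft g f y \<eta>) * exp (K\<^sup>2 * lam * \<omega> (norm (y, \<eta>)))) \<partial>lborel) \<partial>lborel)"
      using lam by (intro nn_integral_mono mult_left_mono)
        (auto simp: ennreal_mult[symmetric] intro!: ennreal_leI mult_left_mono omega_mono norm_fst_le)
    also have "\<dots> = ennreal (1 / q) * J"
      unfolding Jeq by (rule nn_integral_cmult) (use lborel.borel_measurable_nn_integral[OF Vw] in simp)
    finally show "(\<integral>\<^sup>+y. ennreal (1 / q) * (\<integral>\<^sup>+\<eta>. ennreal (norm (stft g f y \<eta>)) \<partial>lborel) * ennreal (exp (K\<^sup>2 * lam * \<omega> (norm y))) \<partial>lborel)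
       \<le> ennreal (1 / q) * J" .
  qed simp
  finally have X: "ennreal ?X * ennreal n2 \<le> ?k * ?Ga * (ennreal (1 / q) * J)" .
  have "ennreal ?Y * ennreal (LINT t|lborel. (norm (fourier g t))\<^sup>2) \<le> ?k * ?Gb *
    (\<integral>\<^sup>+\<eta>. (\<integral>\<^sup>+y. ennreal (norm (stft g f y \<eta>)) \<partial>lborel) * ennreal (exp (K\<^sup>2 * lam * \<omega> (norm \<eta>))) \<partial>lborel)"
    by (rule weighted_recovery[OF test_functionD(6,7)[OF g(1)] lam _ stft_recovers_frequency[OF f g(1)]]) measurable
  also have "(LINT t|lborel. (norm (fourier g t))\<^sup>2) = q * n2"
    unfolding q_def n2_def by (rule Plancherel[OF g(1)])
  also have "?k * ?Gb * (\<integral>\<^sup>+\<eta>. (\<integral>\<^sup>+y. ennreal (norm (stft g f y \<eta>)) \<partial>lborel) * ennreal (exp (K\<^sup>2 * lam * \<omega> (norm \<eta>))) \<partial>lborel)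
     \<le> ?k * ?Gb * J"
  proof (rule mult_left_mono)
    have "(\<integral>\<^sup>+\<eta>. (\<integral>\<^sup>+y. ennreal (norm (stft g f y \<eta>)) \<partial>lborel) * ennreal (exp (K\<^sup>2 * lam * \<omega> (norm \<eta>))) \<partial>lborel)
       = (\<integral>\<^sup>+\<eta>. \<integral>\<^sup>+y. ennreal (norm (stft g f y \<eta>)) * ennreal (exp (K\<^sup>2 * lam * \<omega> (norm \<eta>))) \<partial>lborel \<partial>lborel)"
      by (simp add: nn_integral_multc)
    also have "\<dots> \<le> (\<integral>\<^sup>+\<eta>. \<integral>\<^sup>+y. ennreal (norm (stft g f y \<eta>) * exp (K\<^sup>2 * lam * \<omega> (norm (y, \<eta>)))) \<partial>lborel \<partial>lborel)"
      using lam by (intro nn_integral_mono)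
        (auto simp: ennreal_mult[symmetric] intro!: ennreal_leI mult_left_mono omega_mono norm_snd_le)
    also have "\<dots> = J"
      unfolding Jeq by (rule lborel_pair.Fubini'[OF Vw])
    finally show "(\<integral>\<^sup>+\<eta>. (\<integral>\<^sup>+y. ennreal (norm (stft g f y \<eta>)) \<partial>lborel) * ennreal (exp (K\<^sup>2 * lam * \<omega> (norm \<eta>))) \<partial>lborel) \<le> J" .
  qed simp
  finally have Y: "ennreal ?Y * ennreal (q * n2) \<le> ?k * ?Gb * J" .
  let ?F = "Lp_norm p (weighted \<omega> m (Wig \<tau> f))" and ?G = "Lp_norm 1 (weighted \<omega> m (Wig (1 - \<tau>) (\<lambda>t. g (- t))))"
  let ?M = "Lp_norm (conj_exp (2 * p)) (\<lambda>z::(real^'n) \<times> (real^'n). exp (- \<mu> * \<omega> (norm z)))"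
  \<comment> \<open>The denominator of \<open>D2\<close>; it is multiplied in together with its
    inverse \<open>ib\<close>, which avoids division in \<open>ennreal\<close>.\<close>
  define \<beta> where "\<beta> = q\<^sup>2 * n2\<^sup>2"
  have \<beta>: "0 < \<beta>" using q n2 by (simp add: \<beta>_def)
  define ib where "ib = inverse (ennreal \<beta>)"
  have inv: "ennreal \<beta> * ib = 1"
    using \<beta> by (simp add: ib_def inverse_ennreal ennreal_mult[symmetric])
  have \<beta>_eq: "ennreal \<beta> = ennreal n2 * (ennreal (q * n2) * ennreal q)"
    using q n2 by (simp add: \<beta>_def ennreal_mult[symmetric] power2_eq_square mult_ac)
  have "Lp_norm 2 g = ennreal_powr (\<integral>\<^sup>+t. ennreal ((norm (g t))\<^sup>2) \<partial>lborel) (1/2)"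
    using Lp_norm_real[of 2 g] by simp
  also have "(\<integral>\<^sup>+t. ennreal ((norm (g t))\<^sup>2) \<partial>lborel) = ennreal n2"
    unfolding n2_def by (rule nn_integral_eq_integral) (auto intro: integrable_norm_square test_functionD(3)[OF g(1)])
  also have "ennreal_powr (ennreal n2) (1/2) = ennreal (sqrt n2)"
    using n2 by (simp add: ennreal_powr_simps powr_half_sqrt)
  finally have "(Lp_norm 2 g) ^ 4 = ennreal (sqrt n2 ^ 4)" using n2 by (simp add: ennreal_power)
  also have "sqrt n2 ^ 4 = n2\<^sup>2"
    using n2 power_mult[of "sqrt n2" 2 2] by simp
  finally have n4: "(Lp_norm 2 g) ^ 4 = ennreal (n2\<^sup>2)" .
  have "(2 * pi) ^ (2 * CARD('n)) = q\<^sup>2"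
    unfolding q_def by (simp only: power_mult[symmetric] mult.commute)
  then have "ennreal ((2 * pi) ^ (2 * CARD('n))) * (Lp_norm 2 g) ^ 4 = ennreal \<beta>"
    unfolding n4 \<beta>_def by (simp only: ennreal_mult zero_le_power2)
  then have D2: "D2 \<omega> K p lam \<mu> g = ennreal (exp (K * (1 + 2 * K) * lam)) * ?Ga * ?Gb * ?M\<^sup>2 * ib"
    by (simp add: D2_def divide_ennreal_def ib_def)
  have "lam * \<omega> (norm z) \<le> lam * (K * (1 + \<omega> (norm x) + \<omega> (norm \<xi>)))"
    unfolding z using lam by (intro mult_left_mono omega_norm_add norm_Pair_le) auto
  then have "exp (lam * \<omega> (norm z)) \<le> exp (lam * K) * exp (lam * K * \<omega> (norm x)) * exp (lam * K * \<omega> (norm \<xi>))"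
    by (simp add: exp_add[symmetric] algebra_simps)
  then have "exp (lam * \<omega> (norm z)) * (norm (f x) * norm (fourier f \<xi>)) \<le>
     exp (lam * K) * exp (lam * K * \<omega> (norm x)) * exp (lam * K * \<omega> (norm \<xi>)) * (norm (f x) * norm (fourier f \<xi>))"
    by (rule mult_right_mono) auto
  then have "ennreal (exp (lam * \<omega> (norm z)) * norm (Rihaczek f z)) \<le> ennreal (exp (lam * K) * (?X * ?Y))"
    unfolding z norm_Rihaczek by (intro ennreal_leI) (simp add: mult_ac)
  also have "\<dots> = ennreal (exp (lam * K)) * (ennreal ?X * ennreal ?Y) * (ennreal \<beta> * ib)"
    unfolding inv by (simp add: ennreal_mult)
  \<comment> \<open>The inserted factor is \<open>n2 * (q * n2) * q\<close>: the first two parts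
    complete the left sides of \<open>X\<close> and \<open>Y\<close>, and the last \<open>q\<close>
    will cancel the \<open>1 / q\<close> coming from \<open>X\<close>.\<close>
  also have "\<dots> = ennreal (exp (lam * K)) * ennreal q * ib * ((ennreal ?X * ennreal n2) * (ennreal ?Y * ennreal (q * n2)))"
    unfolding \<beta>_eq by (simp only: mult_ac)
  also have "\<dots> \<le> ennreal (exp (lam * K)) * ennreal q * ib * ((?k * ?Ga * (ennreal (1 / q) * J)) * (?k * ?Gb * J))"
    by (intro mult_left_mono mult_mono X Y) auto
  also have "\<dots> = (ennreal (exp (lam * K)) * ?k * ?k) * (ennreal q * ennreal (1 / q)) * ib * ?Ga * ?Gb * J\<^sup>2"
    by (simp only: mult_ac power2_eq_square)
  \<comment> \<open>The exponent \<open>lam * K\<close> comes from splitting \<open>z\<close> into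
    \<open>x\<close> and \<open>\<xi>\<close>, and one \<open>lam * K\<^sup>2\<close> from each
    recovery.\<close>
  also have "ennreal (exp (lam * K)) * ?k * ?k = ennreal (exp (K * (1 + 2 * K) * lam))"
    by (simp add: ennreal_mult[symmetric] exp_add[symmetric] algebra_simps power2_eq_square)
  also have "ennreal q * ennreal (1 / q) = 1"
    using q by (simp add: ennreal_mult[symmetric])
  also have "ennreal (exp (K * (1 + 2 * K) * lam)) * 1 * ib * ?Ga * ?Gb * J\<^sup>2 \<le>
     ennreal (exp (K * (1 + 2 * K) * lam)) * 1 * ib * ?Ga * ?Gb * (ennreal (exp m) * (?F * ?G) * ?M\<^sup>2)"
    unfolding J_def m_def by (intro mult_left_mono stft_weighted_L1_bound f g \<tau> lam mu p) auto
  also have "\<dots> = D2 \<omega> K p lam \<mu> g * ennreal (exp m) * ?G * ?F"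
    unfolding D2 by (simp only: mult_ac mult_1_left mult_1_right)
  finally show ?thesis .
qed

end

section \<open>Lower bound for the measure of a set of concentration\<close>

theorem proposition3p5:
  fixes \<omega> :: "real \<Rightarrow> real" and K b \<tau> \<epsilon> :: real and p :: ennreal
    and E :: "((real^'n::finite) \<times> (real^'n)) set"
  assumes "weight_function \<omega> K b"
    and "E \<in> sets lebesgue"
    and "1 \<le> p"
    and "0 < \<tau>" and "\<tau> < 1"
    and "0 < \<epsilon>" and "\<epsilon> < 1"
    and "(\<exists>(f :: real^'n \<Rightarrow> complex) \<in> S_space \<omega>. \<exists>lam\<ge>0. f \<noteq> (\<lambda>_. 0) \<and>
            (\<integral>\<^sup>+ z \<in> E. ennreal (exp (lam * \<omega> (norm z)) * norm (Wig \<tau> f z)) \<partial>lebesgue)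
            \<ge> ennreal ((1 - \<epsilon>) * sqrt (D3 CARD('n) K \<tau> lam)) *
               ennreal_powr (Lp_norm p (weighted \<omega> (4 * K\<^sup>2 * lam) (Rihaczek f))) (1/2) *
               ennreal_powr (Lp_norm (conj_exp p) (weighted \<omega> (4 * K\<^sup>2 * lam) (Rihaczek f))) (1/2))
       \<or> (\<exists>(f :: real^'n \<Rightarrow> complex) \<in> S_space \<omega>. \<exists>lam\<ge>0. \<exists>\<mu>. f \<noteq> (\<lambda>_. 0) \<and>
            \<mu> > 2 * real CARD('n) / (b * enn2real (conj_exp (2 * p))) \<and>
            (\<integral>\<^sup>+ z \<in> E. ennreal (exp (lam * \<omega> (norm z)) * norm (Rihaczek f z)) \<partial>lebesgue)
            \<ge> ennreal (1 - \<epsilon>) * D4 TYPE('n) \<omega> K \<tau> p lam \<mu> *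
               Lp_norm p (weighted \<omega> (2 * K * (K\<^sup>2 * lam + \<mu>)) (Wig \<tau> f)))"
  shows "emeasure lebesgue E \<ge> ennreal (1 - \<epsilon>)"
proof -
  interpret weight \<omega> K b by unfold_locales (rule assms(1))
  note \<tau> = assms(4,5)
  have eps: "0 < ennreal (1 - \<epsilon>)" using assms(7) by simp
  from assms(8) show ?thesis
  proof (elim disjE bexE exE conjE)
    fix f :: "real^'n \<Rightarrow> complex" and lam :: real
    assume fS: "f \<in> S_space \<omega>" and lam: "0 \<le> lam" and f0: "f \<noteq> (\<lambda>_. 0)"
    have f: "test_function f" using fS by (rule S_space_test_function)
    let ?R = "weighted \<omega> (4 * K\<^sup>2 * lam) (Rihaczek f)"
    let ?D = "D3 CARD('n) K \<tau> lam"
    assume int: "ennreal ((1 - \<epsilon>) * sqrt ?D) * ennreal_powr (Lp_norm p ?R) (1/2) * ennreal_powr (Lp_norm (conj_exp p) ?R) (1/2)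
       \<le> (\<integral>\<^sup>+ z \<in> E. ennreal (exp (lam * \<omega> (norm z)) * norm (Wig \<tau> f z)) \<partial>lebesgue)"
    have R: "rapid ?R" by (intro rapid_weighted rapid_Rihaczek f)
    have cR: "continuous_on UNIV ?R" by (intro continuous_on_weighted continuous_Rihaczek f)
    have D: "0 < ?D"
    proof -
      have "\<tau> * \<tau> < \<tau> * 1" using \<tau> by (intro mult_strict_left_mono) auto
      then have "0 < \<tau> - \<tau>\<^sup>2" by (simp add: power2_eq_square)
      then show ?thesis by (simp add: D3_def)
    qed
    \<comment> \<open>A vanishing norm would make the continuous function \<open>?R\<close> zero
      everywhere, against \<open>Rihaczek_nonzero\<close>. Positive finite norms allow the passage
      to real square roots.\<close>
    have fin: "Lp_norm q ?R < \<infinity>" "Lp_norm q ?R \<noteq> 0" if q: "1 \<le> q" for q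
    proof -
      show "Lp_norm q ?R < \<infinity>" by (rule rapid_Lp_norm_finite[OF R q])
      show "Lp_norm q ?R \<noteq> 0"
      proof
        assume "Lp_norm q ?R = 0"
        then have "AE z in lborel. ?R z = 0"
          by (rule Lp_norm_eq_0_AE[OF rapid_measurable[OF R] q])
        then have "Lp_norm \<infinity> ?R \<le> 0"
          by (intro Lp_norm_inf_le rapid_measurable[OF R]) (auto elim!: eventually_mono)
        then have "ennreal (norm (?R z)) \<le> 0" for z
          using norm_le_Lp_norm_inf[OF cR, of z] by simp
        then have "Rihaczek f z = 0" for z
          by (simp add: norm_weighted)
        then show False using Rihaczek_nonzero[OF f f0] by metis
      qed
    qed
    obtain a1 where a1: "Lp_norm p ?R = ennreal a1" "0 < a1"
      using fin[OF assms(3)] by (cases "Lp_norm p ?R") (auto simp: less_le)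
    obtain a2 where a2: "Lp_norm (conj_exp p) ?R = ennreal a2" "0 < a2"
      using fin[OF conj_exp_ge_1[OF assms(3)]] by (cases "Lp_norm (conj_exp p) ?R") (auto simp: less_le)
    \<comment> \<open>The square root of the bound in \<open>Wig_square_bound\<close>, that is, the
      lower bound in (a) without its factor \<open>1 - \<epsilon>\<close>.\<close>
    define M where "M = sqrt ?D * (sqrt a1 * sqrt a2)"
    have M: "0 < M" using D a1 a2 by (simp add: M_def)
    have W: "ennreal (exp (lam * \<omega> (norm z)) * norm (Wig \<tau> f z)) \<le> ennreal M" for z
    proof (rule ennreal_leI)
      have "ennreal ((exp (lam * \<omega> (norm z)) * norm (Wig \<tau> f z))\<^sup>2) \<le> ennreal (?D * (a1 * a2))"
        using Wig_square_bound[OF f \<tau> lam assms(3), of z] a1 a2 D by (simp add: ennreal_mult[symmetric])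
      then have "(exp (lam * \<omega> (norm z)) * norm (Wig \<tau> f z))\<^sup>2 \<le> ?D * (a1 * a2)"
        using D a1 a2 by simp
      then show "exp (lam * \<omega> (norm z)) * norm (Wig \<tau> f z) \<le> M"
        unfolding M_def real_sqrt_mult[symmetric] by (rule real_le_rsqrt)
    qed
    have "ennreal (1 - \<epsilon>) * ennreal M \<le> (\<integral>\<^sup>+ z \<in> E. ennreal (exp (lam * \<omega> (norm z)) * norm (Wig \<tau> f z)) \<partial>lebesgue)"
      using int a1 a2 D assms(7) by (simp add: ennreal_powr_simps powr_half_sqrt ennreal_mult[symmetric] M_def mult.assoc)
    then show ?thesis
      using M by (intro measure_ge_of_concentration[OF assms(2) W _ W _ eps]) auto
  next
    fix f :: "real^'n \<Rightarrow> complex" and lam \<mu> :: real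
    assume fS: "f \<in> S_space \<omega>" and lam: "0 \<le> lam" and f0: "f \<noteq> (\<lambda>_. 0)"
      and "2 * real CARD('n) / (b * enn2real (conj_exp (2 * p))) < \<mu>"
    moreover have "0 \<le> 2 * real CARD('n) / (b * enn2real (conj_exp (2 * p)))"
      using b_pos by simp
    ultimately have mu: "0 \<le> \<mu>" by linarith
    have f: "test_function f" using fS by (rule S_space_test_function)
    let ?m = "2 * K * (K\<^sup>2 * lam + \<mu>)"
    let ?L = "Lp_norm p (weighted \<omega> ?m (Wig \<tau> f))"
    let ?W = "\<lambda>z. ennreal (exp (lam * \<omega> (norm z)) * norm (Rihaczek f z))"
    assume int: "ennreal (1 - \<epsilon>) * D4 TYPE('n) \<omega> K \<tau> p lam \<mu> * ?L \<le> (\<integral>\<^sup>+ z \<in> E. ?W z \<partial>lebesgue)"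
    have L: "?L < \<infinity>" using \<tau> assms(3) by (intro rapid_Lp_norm_finite rapid_weighted rapid_Wig f)
    \<comment> \<open>\<open>Rihaczek_bound\<close> holds for every nonzero window, so the infimum
      in \<open>D4\<close> may be taken; \<open>f\<close> itself shows that there is one.\<close>
    have W: "?W z \<le> D4 TYPE('n) \<omega> K \<tau> p lam \<mu> * ?L" for z
      unfolding D4_def
    proof (rule le_INF_mult_ennreal[OF _ L])
      show "{g \<in> S_space \<omega> :: (real^'n \<Rightarrow> complex) set. g \<noteq> (\<lambda>_. 0)} \<noteq> {}" using fS f0 by blast
    qed (auto intro!: Rihaczek_bound f lam mu \<tau> assms(3) S_space_test_function)
    \<comment> \<open>A nonzero value of the integrand keeps its upper bound from being 0, as is
      needed to cancel it.\<close>
    obtain z0 where "Rihaczek f z0 \<noteq> 0" using Rihaczek_nonzero[OF f f0] by blast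
    then have nz: "D4 TYPE('n) \<omega> K \<tau> p lam \<mu> * ?L \<noteq> 0"
      using W[of z0] by (auto simp: ennreal_eq_0_iff mult_le_0_iff)
    \<comment> \<open>Finiteness of \<open>D4\<close> is not established here; the decay of
      \<open>Rihaczek f\<close> supplies the finite bound for the infinite case of
      \<open>measure_ge_of_concentration\<close>.\<close>
    have "rapid (weighted \<omega> lam (Rihaczek f))" by (intro rapid_weighted rapid_Rihaczek f)
    then obtain C where "0 \<le> C" "\<And>z. norm (weighted \<omega> lam (Rihaczek f) z) \<le> C"
      using rapid_bounded by blast
    then have C: "?W z \<le> ennreal C" for z by (auto simp: norm_weighted intro!: ennreal_leI)
    show ?thesis
      using int by (intro measure_ge_of_concentration[OF assms(2) W nz C _ eps]) (auto simp: mult.assoc)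
  qed
qed

end
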